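(* The category of locally finite MV-algebras is equivalent (as a category) to a (one-sorted) variety of algebras, with operations of at most countable arity.
   Context: MV-algebras: an MV-algebra is an algebra $\langle A,\oplus,\neg,0\rangle$ such that $\langle A,\oplus,0\rangle$ is a monoid, $\neg\neg x=x$, $\neg 0\oplus x=\neg 0$, and $\neg(\neg x\oplus y)\oplus y=\neg(\neg y\oplus x)\oplus x$. An MV-algebra is locally finite if each of its finitely generated subalgebras is finite. The category of locally finite MV-algebras has all locally finite MV-algebras as objects and all MV-homomorphisms between them as arrows. Varieties: a (one-sorted) signature $\Sigma$ is a (possibly large) class of operation symbols, each with an arity that is a (possibly infinite) cardinal. A variety of $\Sigma$-algebras is a class of $\Sigma$-algebras that can be presented by a class of (universally quantified) equations between $\Sigma$-terms and that has free algebras over every set; it is regarded as a category with all homomorphisms.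
   Formalization: MV-algebras are taken with a commutative monoid operation, as is standard; the axioms as listed (with only "monoid") do not imply commutativity, since a three-element non-commutative structure satisfies them. *)

theory Defs
  imports
    Complex_Main
    "HOL-Algebra.Group"
    "HOL-Library.FuncSet"
    "HOL-Library.Countable_Set"
    "HOL-Library.Equipollence"
begin

section \<open>Categories, functors and equivalence\<close>

text \<open>
  Categories are given by hom-sets. Composition takes the three objects involved as arguments,
  so that arrows of concrete categories can be plain (extensional) functions; arrows with
  different domain or codomain may therefore be equal as values.
  \<open>Comp C X Y Z g f\<close> is \<open>g\<close> after \<open>f\<close>, for \<open>f : X \<rightarrow> Y\<close> and \<open>g : Y \<rightarrow> Z\<close>.
\<close>

record ('o, 'm) cat =
  Obj :: "'o set"
  Hom :: "'o \<Rightarrow> 'o \<Rightarrow> 'm set"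
  Id :: "'o \<Rightarrow> 'm"
  Comp :: "'o \<Rightarrow> 'o \<Rightarrow> 'o \<Rightarrow> 'm \<Rightarrow> 'm \<Rightarrow> 'm"

locale category =
  fixes C :: "('o, 'm) cat"
  assumes Id_in_Hom: "X \<in> Obj C \<Longrightarrow> Id C X \<in> Hom C X X"
    and Comp_in_Hom:
      "\<lbrakk>X \<in> Obj C; Y \<in> Obj C; Z \<in> Obj C; f \<in> Hom C X Y; g \<in> Hom C Y Z\<rbrakk>
        \<Longrightarrow> Comp C X Y Z g f \<in> Hom C X Z"
    and Comp_Id_right:
      "\<lbrakk>X \<in> Obj C; Y \<in> Obj C; f \<in> Hom C X Y\<rbrakk> \<Longrightarrow> Comp C X X Y f (Id C X) = f"
    and Comp_Id_left:
      "\<lbrakk>X \<in> Obj C; Y \<in> Obj C; f \<in> Hom C X Y\<rbrakk> \<Longrightarrow> Comp C X Y Y (Id C Y) f = f"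
    and Comp_assoc:
      "\<lbrakk>W \<in> Obj C; X \<in> Obj C; Y \<in> Obj C; Z \<in> Obj C;
        f \<in> Hom C W X; g \<in> Hom C X Y; h \<in> Hom C Y Z\<rbrakk>
        \<Longrightarrow> Comp C W Y Z h (Comp C W X Y g f) = Comp C W X Z (Comp C X Y Z h g) f"

record ('o, 'm, 'p, 'n) func =
  omap :: "'o \<Rightarrow> 'p"
  amap :: "'o \<Rightarrow> 'o \<Rightarrow> 'm \<Rightarrow> 'n"

locale cat_functor = C: category C + D: category D
  for C :: "('o, 'm) cat" and D :: "('p, 'n) cat" +
  fixes F :: "('o, 'm, 'p, 'n) func"
  assumes omap_in_Obj: "X \<in> Obj C \<Longrightarrow> omap F X \<in> Obj D"
    and amap_in_Hom:
      "\<lbrakk>X \<in> Obj C; Y \<in> Obj C; f \<in> Hom C X Y\<rbrakk>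
        \<Longrightarrow> amap F X Y f \<in> Hom D (omap F X) (omap F Y)"
    and amap_Id: "X \<in> Obj C \<Longrightarrow> amap F X X (Id C X) = Id D (omap F X)"
    and amap_Comp:
      "\<lbrakk>X \<in> Obj C; Y \<in> Obj C; Z \<in> Obj C; f \<in> Hom C X Y; g \<in> Hom C Y Z\<rbrakk>
        \<Longrightarrow> amap F X Z (Comp C X Y Z g f) =
            Comp D (omap F X) (omap F Y) (omap F Z) (amap F Y Z g) (amap F X Y f)"

definition id_func :: "('o, 'm, 'o, 'm) func" where
  "id_func = \<lparr>omap = (\<lambda>X. X), amap = (\<lambda>X Y f. f)\<rparr>"

definition comp_func ::
    "('p, 'n, 'q, 'k) func \<Rightarrow> ('o, 'm, 'p, 'n) func \<Rightarrow> ('o, 'm, 'q, 'k) func" where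
  "comp_func G F =
     \<lparr>omap = (\<lambda>X. omap G (omap F X)),
      amap = (\<lambda>X Y f. amap G (omap F X) (omap F Y) (amap F X Y f))\<rparr>"

definition isomorphism :: "('o, 'm) cat \<Rightarrow> 'o \<Rightarrow> 'o \<Rightarrow> 'm \<Rightarrow> bool" where
  "isomorphism C X Y f \<longleftrightarrow>
     f \<in> Hom C X Y \<and>
     (\<exists>g \<in> Hom C Y X. Comp C X Y X g f = Id C X \<and> Comp C Y X Y f g = Id C Y)"

definition natural_isomorphism ::
    "('o, 'm) cat \<Rightarrow> ('p, 'n) cat \<Rightarrow> ('o, 'm, 'p, 'n) func \<Rightarrow> ('o, 'm, 'p, 'n) func
      \<Rightarrow> ('o \<Rightarrow> 'n) \<Rightarrow> bool" where
  "natural_isomorphism C D F G \<eta> \<longleftrightarrow>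
     (\<forall>X \<in> Obj C. isomorphism D (omap F X) (omap G X) (\<eta> X)) \<and>
     (\<forall>X \<in> Obj C. \<forall>Y \<in> Obj C. \<forall>f \<in> Hom C X Y.
        Comp D (omap F X) (omap F Y) (omap G Y) (\<eta> Y) (amap F X Y f) =
        Comp D (omap F X) (omap G X) (omap G Y) (amap G X Y f) (\<eta> X))"

definition equivalent_categories :: "('o, 'm) cat \<Rightarrow> ('p, 'n) cat \<Rightarrow> bool" where
  "equivalent_categories C D \<longleftrightarrow>
     (\<exists>F G \<eta> \<epsilon>. cat_functor C D F \<and> cat_functor D C G \<and>
        natural_isomorphism C C id_func (comp_func G F) \<eta> \<and>
        natural_isomorphism D D (comp_func F G) id_func \<epsilon>)"


section \<open>Small sets\<close>

text \<open>
  HOL has no proper classes ranging over all types. As usual in such a setting, a category of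
  \<^emph>\<open>all\<close> algebras of some kind is taken relative to a notion of small set: the type \<open>'u\<close> plays
  the role of the class of all sets, and \<open>\<S>\<close> collects those subclasses of \<open>'u\<close> that count as
  sets. Only very weak closure conditions are required. They hold for the small sets of any type
  modelling ZFC and for the subsets of size less than \<open>|'u|\<close> if that cardinal is inaccessible,
  but also, for instance, for the collection of all subsets of \<open>'u = nat \<Rightarrow> 'b\<close> where \<open>'b\<close> has at
  least two elements.
\<close>

definition smallness :: "'u set set \<Rightarrow> bool" where
  "smallness \<S> \<longleftrightarrow>
     (\<forall>X \<in> \<S>. \<forall>Y. Y \<lesssim> X \<longrightarrow> Y \<in> \<S>) \<and>
     (\<exists>X \<in> \<S>. infinite X) \<and>
     (\<forall>X \<in> \<S>. \<exists>Y \<in> \<S>. ((UNIV :: nat set) \<rightarrow>\<^sub>E X) \<lesssim> Y)"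


section \<open>The category of locally finite MV-algebras\<close>

text \<open>
  As usual, the monoid reduct of an MV-algebra is commutative. This does not follow from the
  other axioms: the three-element set \<open>{0, a, 1}\<close> with \<open>0\<close> neutral, \<open>x \<oplus> y = x\<close> for
  \<open>x \<noteq> 0\<close>, \<open>\<not> 0 = 1\<close>, \<open>\<not> a = a\<close> and \<open>\<not> 1 = 0\<close> satisfies all of them.
\<close>

record 'a mv = "'a partial_object" +
  mv_plus :: "'a \<Rightarrow> 'a \<Rightarrow> 'a"  (infixl \<open>\<oplus>\<^sub>M\<index>\<close> 65)
  mv_neg :: "'a \<Rightarrow> 'a"  (\<open>\<sim>\<index> _\<close> [81] 80)
  mv_zero :: 'a  (\<open>\<zero>\<^sub>M\<index>\<close>)

locale mv_algebra =
  fixes A :: "'a mv" (structure)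
  assumes comm_monoid: "comm_monoid \<lparr>carrier = carrier A, mult = mv_plus A, one = mv_zero A\<rparr>"
    and neg_closed: "x \<in> carrier A \<Longrightarrow> \<sim> x \<in> carrier A"
    and neg_neg: "x \<in> carrier A \<Longrightarrow> \<sim> (\<sim> x) = x"
    and neg_zero_plus: "x \<in> carrier A \<Longrightarrow> \<sim> \<zero>\<^sub>M \<oplus>\<^sub>M x = \<sim> \<zero>\<^sub>M"
    and lukasiewicz: "\<lbrakk>x \<in> carrier A; y \<in> carrier A\<rbrakk>
      \<Longrightarrow> \<sim> (\<sim> x \<oplus>\<^sub>M y) \<oplus>\<^sub>M y = \<sim> (\<sim> y \<oplus>\<^sub>M x) \<oplus>\<^sub>M x"

definition mv_subuniverse :: "'a mv \<Rightarrow> 'a set \<Rightarrow> bool" where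
  "mv_subuniverse A B \<longleftrightarrow>
     B \<subseteq> carrier A \<and> mv_zero A \<in> B \<and>
     (\<forall>x \<in> B. mv_neg A x \<in> B) \<and> (\<forall>x \<in> B. \<forall>y \<in> B. mv_plus A x y \<in> B)"

text \<open>\<open>mv_subuniverse A hull S\<close> is the (universe of the) subalgebra generated by \<open>S\<close>.\<close>

definition locally_finite_mv :: "'a mv \<Rightarrow> bool" where
  "locally_finite_mv A \<longleftrightarrow>
     (\<forall>S \<subseteq> carrier A. finite S \<longrightarrow> finite (mv_subuniverse A hull S))"

definition mv_hom :: "'a mv \<Rightarrow> 'b mv \<Rightarrow> ('a \<Rightarrow> 'b) set" where
  "mv_hom A B =
     {h \<in> carrier A \<rightarrow>\<^sub>E carrier B.
        h (mv_zero A) = mv_zero B \<and>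
        (\<forall>x \<in> carrier A. h (mv_neg A x) = mv_neg B (h x)) \<and>
        (\<forall>x \<in> carrier A. \<forall>y \<in> carrier A. h (mv_plus A x y) = mv_plus B (h x) (h y))}"

definition LFMV :: "'u set set \<Rightarrow> ('u mv, 'u \<Rightarrow> 'u) cat" where
  "LFMV \<S> =
     \<lparr>Obj = {A. carrier A \<in> \<S> \<and> mv_algebra A \<and> locally_finite_mv A},
      Hom = mv_hom,
      Id = (\<lambda>A. \<lambda>x \<in> carrier A. x),
      Comp = (\<lambda>A B C g f. compose (carrier A) g f)\<rparr>"


section \<open>Infinitary varieties\<close>

text \<open>
  The arity of an operation symbol is given by an index set for its arguments; as a cardinal,
  it is the cardinality of that set.
\<close>

record ('f, 'i) signature =
  ops :: "'f set"
  arity :: "'f \<Rightarrow> 'i set"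

record ('f, 'i, 'a) alg = "'a partial_object" +
  interp :: "'f \<Rightarrow> ('i \<Rightarrow> 'a) \<Rightarrow> 'a"

definition sig_algebra :: "('f, 'i) signature \<Rightarrow> ('f, 'i, 'a) alg \<Rightarrow> bool" where
  "sig_algebra \<Sigma> A \<longleftrightarrow>
     (\<forall>f \<in> ops \<Sigma>. interp A f \<in> (arity \<Sigma> f \<rightarrow>\<^sub>E carrier A) \<rightarrow> carrier A)"

definition alg_hom ::
    "('f, 'i) signature \<Rightarrow> ('f, 'i, 'a) alg \<Rightarrow> ('f, 'i, 'b) alg \<Rightarrow> ('a \<Rightarrow> 'b) set" where
  "alg_hom \<Sigma> A B =
     {h \<in> carrier A \<rightarrow>\<^sub>E carrier B.
        \<forall>f \<in> ops \<Sigma>. \<forall>xs \<in> arity \<Sigma> f \<rightarrow>\<^sub>E carrier A.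
          h (interp A f xs) = interp B f (\<lambda>i \<in> arity \<Sigma> f. h (xs i))}"

text \<open>
  In \<open>Op f ts\<close> only the subterms \<open>ts i\<close> with \<open>i\<close> in the arity of \<open>f\<close> are meaningful; the others
  are ignored by \<open>sig_term\<close> and \<open>eval_term\<close>.
\<close>

datatype ('f, 'i, 'v) trm = Var 'v | Op 'f "'i \<Rightarrow> ('f, 'i, 'v) trm"

inductive sig_term :: "('f, 'i) signature \<Rightarrow> ('f, 'i, 'v) trm \<Rightarrow> bool" for \<Sigma> where
  "sig_term \<Sigma> (Var v)"
| "\<lbrakk>f \<in> ops \<Sigma>; \<And>i. i \<in> arity \<Sigma> f \<Longrightarrow> sig_term \<Sigma> (ts i)\<rbrakk> \<Longrightarrow> sig_term \<Sigma> (Op f ts)"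

primrec eval_term ::
    "('f, 'i) signature \<Rightarrow> ('f, 'i, 'a) alg \<Rightarrow> ('v \<Rightarrow> 'a) \<Rightarrow> ('f, 'i, 'v) trm \<Rightarrow> 'a" where
  "eval_term \<Sigma> A \<rho> (Var v) = \<rho> v"
| "eval_term \<Sigma> A \<rho> (Op f ts) = interp A f (\<lambda>i \<in> arity \<Sigma> f. eval_term \<Sigma> A \<rho> (ts i))"

type_synonym ('f, 'i, 'v) equations = "(('f, 'i, 'v) trm \<times> ('f, 'i, 'v) trm) set"

definition satisfies ::
    "('f, 'i) signature \<Rightarrow> ('f, 'i, 'a) alg \<Rightarrow> ('f, 'i, 'v) equations \<Rightarrow> bool" where
  "satisfies \<Sigma> A E \<longleftrightarrow>
     (\<forall>(s, t) \<in> E. \<forall>\<rho>. range \<rho> \<subseteq> carrier A \<longrightarrow> eval_term \<Sigma> A \<rho> s = eval_term \<Sigma> A \<rho> t)"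

definition models ::
    "'u set set \<Rightarrow> ('f, 'i) signature \<Rightarrow> ('f, 'i, 'v) equations \<Rightarrow> ('f, 'i, 'u) alg set" where
  "models \<S> \<Sigma> E = {A. carrier A \<in> \<S> \<and> sig_algebra \<Sigma> A \<and> satisfies \<Sigma> A E}"

definition free_algebra_over ::
    "('f, 'i) signature \<Rightarrow> ('f, 'i, 'u) alg set \<Rightarrow> 'u set \<Rightarrow> ('f, 'i, 'u) alg
      \<Rightarrow> ('u \<Rightarrow> 'u) \<Rightarrow> bool" where
  "free_algebra_over \<Sigma> K X F \<eta> \<longleftrightarrow>
     F \<in> K \<and> \<eta> \<in> X \<rightarrow> carrier F \<and>
     (\<forall>A \<in> K. \<forall>g \<in> X \<rightarrow> carrier A. \<exists>!h. h \<in> alg_hom \<Sigma> F A \<and> (\<forall>x \<in> X. h (\<eta> x) = g x))"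

text \<open>\<open>variety \<S> \<Sigma> E\<close>: the equations \<open>E\<close> present a variety of \<open>\<Sigma>\<close>-algebras.\<close>

definition variety ::
    "'u set set \<Rightarrow> ('f, 'i) signature \<Rightarrow> ('f, 'i, 'v) equations \<Rightarrow> bool" where
  "variety \<S> \<Sigma> E \<longleftrightarrow>
     (\<forall>(s, t) \<in> E. sig_term \<Sigma> s \<and> sig_term \<Sigma> t) \<and>
     (\<forall>X \<in> \<S>. \<exists>F \<eta>. free_algebra_over \<Sigma> (models \<S> \<Sigma> E) X F \<eta>)"

definition VAR ::
    "'u set set \<Rightarrow> ('f, 'i) signature \<Rightarrow> ('f, 'i, 'v) equations
      \<Rightarrow> (('f, 'i, 'u) alg, 'u \<Rightarrow> 'u) cat" where
  "VAR \<S> \<Sigma> E =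
     \<lparr>Obj = models \<S> \<Sigma> E,
      Hom = alg_hom \<Sigma>,
      Id = (\<lambda>A. \<lambda>x \<in> carrier A. x),
      Comp = (\<lambda>A B C g f. compose (carrier A) g f)\<rparr>"

end

theory Submission
  imports Defs
begin

text \<open>
  Let \<open>A\<^sub>n\<close> be the set of those elements of a locally finite MV-algebra \<open>A\<close> whose values, at all
  points of finite subalgebras, are multiples of \<open>1 / n!\<close>. Each \<open>A\<^sub>n\<close> is a subalgebra, cut out by a
  unary equation, and \<open>A\<close> is their increasing union. Any element of \<open>A\<^sub>n\<^sub>+\<^sub>1\<close> can be retracted to
  \<open>A\<^sub>n\<close> by a term, which replaces the values that are not multiples of \<open>1 / n!\<close> by \<open>0\<close>. So
  \<open>A\<close> amounts to a model of a countably sorted equational theory, with the inclusions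
  \<open>A\<^sub>n \<rightarrow> A\<^sub>n\<^sub>+\<^sub>1\<close> and the retractions \<open>A\<^sub>n\<^sub>+\<^sub>1 \<rightarrow> A\<^sub>n\<close> as operations between sorts; the retractions
  make injectivity of the inclusions equational. As every sort has a constant, the sorts can
  be packed into the single sort \<open>\<Prod>\<^sub>n A\<^sub>n\<close> by means of the \<open>\<omega>\<close>-ary diagonal operation, which
  takes the \<open>n\<close>-th entry from its \<open>n\<close>-th argument.

  The variety is presented by all equations valid in these algebras of sequences. From a model
  \<open>A\<close> is recovered as the algebra of eventually constant sequences modulo eventual equality. It
  is locally finite since only finitely many term functions in \<open>k\<close> variables exist on the
  multiples of \<open>1 / n!\<close> in the unit interval.
\<close>

section \<open>Points of finite MV-algebras\<close>

text \<open>Local finiteness is not equational, and it is lost in infinite products; bounding the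
  denominators entry by entry is what lets sequences form a variety. Factorials are used because n!
  divides m! for n \<le> m, so that the levels increase, while every denominator divides some n!.
  The retraction can be a term because \<open>defect n\<close> maps multiples of 1/m! to multiples
  of 1/m!: where it is nonzero it is at least 1/m!, so m! copies of it add up to 1. The inclusions
  between levels become the shift \<open>uop\<close>, which fills place 0 with zero. As negation
  turns such zeros into ones, many identities hold only from some entry on; hence the truncations
  \<open>tailop\<close> in them. The theorem asks for equations chosen before \<open>\<S>\<close>,
  so \<open>lf_eqs\<close> refers to all locally finite MV-algebras on the type, small or not.
  Models live on that same type: limits are represented by chosen elements instead of classes, and
  sequences are coded by single elements.\<close>

context mv_algebra
begin

lemma plus_closed [simp, intro]: "x \<in> carrier A \<Longrightarrow> y \<in> carrier A \<Longrightarrow> x \<oplus>\<^sub>M y \<in> carrier A"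
  using monoid.m_closed[OF Group.comm_monoid.axioms(1)[OF comm_monoid]] by simp

lemma zero_closed [simp, intro]: "\<zero>\<^sub>M \<in> carrier A"
  using monoid.one_closed[OF Group.comm_monoid.axioms(1)[OF comm_monoid]] by simp

declare neg_closed [simp, intro] neg_neg [simp] neg_zero_plus [simp]

lemma plus_assoc:
  "x \<in> carrier A \<Longrightarrow> y \<in> carrier A \<Longrightarrow> z \<in> carrier A \<Longrightarrow> x \<oplus>\<^sub>M y \<oplus>\<^sub>M z = x \<oplus>\<^sub>M (y \<oplus>\<^sub>M z)"
  using monoid.m_assoc[OF Group.comm_monoid.axioms(1)[OF comm_monoid]] by simp

lemma plus_comm: "x \<in> carrier A \<Longrightarrow> y \<in> carrier A \<Longrightarrow> x \<oplus>\<^sub>M y = y \<oplus>\<^sub>M x"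
  using Group.comm_monoid.m_comm[OF comm_monoid] by simp

lemma zero_plus [simp]: "x \<in> carrier A \<Longrightarrow> \<zero>\<^sub>M \<oplus>\<^sub>M x = x"
  using monoid.l_one[OF Group.comm_monoid.axioms(1)[OF comm_monoid]] by simp

lemma plus_zero [simp]: "x \<in> carrier A \<Longrightarrow> x \<oplus>\<^sub>M \<zero>\<^sub>M = x"
  using monoid.r_one[OF Group.comm_monoid.axioms(1)[OF comm_monoid]] by simp

lemma plus_neg_zero [simp]: "x \<in> carrier A \<Longrightarrow> x \<oplus>\<^sub>M \<sim> \<zero>\<^sub>M = \<sim> \<zero>\<^sub>M"
  by (subst plus_comm) auto

text \<open>The natural order of MV-algebras: the implication from x to y equals 1, the negation of
  zero.\<close>

definition le :: "'a \<Rightarrow> 'a \<Rightarrow> bool" where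
  "le x y \<longleftrightarrow> \<sim> x \<oplus>\<^sub>M y = \<sim> \<zero>\<^sub>M"

definition sub :: "'a \<Rightarrow> 'a \<Rightarrow> 'a" where
  "sub x y = \<sim> (\<sim> x \<oplus>\<^sub>M y)"

lemma sub_closed [simp, intro]: "x \<in> carrier A \<Longrightarrow> y \<in> carrier A \<Longrightarrow> sub x y \<in> carrier A"
  by (simp add: sub_def)

text \<open>The Lukasiewicz axiom with 1 as one argument has the negation of x plus x on one side
  and 1 on the other.\<close>

lemma le_refl: "x \<in> carrier A \<Longrightarrow> le x x"
  using lukasiewicz[of "\<sim> \<zero>\<^sub>M" x] by (simp add: le_def)

text \<open>If both implications are 1, the two sides of the Lukasiewicz axiom collapse to y and to
  x.\<close>

lemma le_antisym:
  "x \<in> carrier A \<Longrightarrow> y \<in> carrier A \<Longrightarrow> le x y \<Longrightarrow> le y x \<Longrightarrow> x = y"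
  using lukasiewicz[of x y] by (simp add: le_def)

lemma le_plus: "x \<in> carrier A \<Longrightarrow> y \<in> carrier A \<Longrightarrow> le x (x \<oplus>\<^sub>M y)"
  using le_refl[of x] by (simp add: le_def flip: plus_assoc)

lemma le_plus_sub: "x \<in> carrier A \<Longrightarrow> y \<in> carrier A \<Longrightarrow> le x y \<Longrightarrow> x \<oplus>\<^sub>M sub y x = y"
  using lukasiewicz[of x y] by (simp add: le_def sub_def plus_comm)

lemma le_trans:
  assumes "x \<in> carrier A" "y \<in> carrier A" "z \<in> carrier A" "le x y" "le y z"
  shows "le x z"
proof -
  have "z = x \<oplus>\<^sub>M (sub y x \<oplus>\<^sub>M sub z y)"
    using le_plus_sub[of x y] le_plus_sub[of y z] assms by (simp flip: plus_assoc)
  then show ?thesis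
    using le_plus[of x "sub y x \<oplus>\<^sub>M sub z y"] assms by simp
qed

lemma plus_mono1:
  assumes "x \<in> carrier A" "y \<in> carrier A" "z \<in> carrier A" "le x y"
  shows "le (x \<oplus>\<^sub>M z) (y \<oplus>\<^sub>M z)"
proof -
  have "y \<oplus>\<^sub>M z = x \<oplus>\<^sub>M sub y x \<oplus>\<^sub>M z"
    using le_plus_sub[of x y] assms by simp
  also have "\<dots> = (x \<oplus>\<^sub>M z) \<oplus>\<^sub>M sub y x"
    using assms by (simp add: plus_assoc plus_comm[of z])
  finally show ?thesis
    using le_plus[of "x \<oplus>\<^sub>M z" "sub y x"] assms by simp
qed

lemma plus_mono:
  assumes "x \<in> carrier A" "y \<in> carrier A" "z \<in> carrier A" "w \<in> carrier A" "le x y" "le z w"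
  shows "le (x \<oplus>\<^sub>M z) (y \<oplus>\<^sub>M w)"
  using plus_mono1[of x y z] plus_mono1[of z w y] assms
    le_trans[of "x \<oplus>\<^sub>M z" "y \<oplus>\<^sub>M z" "y \<oplus>\<^sub>M w"]
  by (simp add: plus_comm)

text \<open>Residuation: up to associativity both sides unfold to the same equation.\<close>

lemma sub_le_iff:
  "x \<in> carrier A \<Longrightarrow> y \<in> carrier A \<Longrightarrow> z \<in> carrier A \<Longrightarrow> le (sub x y) z \<longleftrightarrow> le x (y \<oplus>\<^sub>M z)"
  by (simp add: le_def sub_def plus_assoc)

lemma sub_le: "x \<in> carrier A \<Longrightarrow> y \<in> carrier A \<Longrightarrow> le (sub x y) x"
  using le_plus[of x y] by (simp add: sub_le_iff plus_comm)

lemma zero_le: "x \<in> carrier A \<Longrightarrow> le \<zero>\<^sub>M x"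
  by (simp add: le_def)

lemma le_neg_zero: "x \<in> carrier A \<Longrightarrow> le x (\<sim> \<zero>\<^sub>M)"
  by (simp add: le_def)

lemma le_zeroD: "x \<in> carrier A \<Longrightarrow> le x \<zero>\<^sub>M \<Longrightarrow> x = \<zero>\<^sub>M"
  using le_antisym zero_le by blast

lemma sub_eq_zero_iff: "x \<in> carrier A \<Longrightarrow> y \<in> carrier A \<Longrightarrow> sub x y = \<zero>\<^sub>M \<longleftrightarrow> le x y"
  using sub_le_iff[of x y "\<zero>\<^sub>M"] le_zeroD[of "sub x y"] le_refl[of "\<zero>\<^sub>M"] by auto

lemma le_neg_iff: "x \<in> carrier A \<Longrightarrow> y \<in> carrier A \<Longrightarrow> le x (\<sim> y) \<longleftrightarrow> le y (\<sim> x)"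
  by (simp add: le_def plus_comm)

text \<open>The hypothesis says that u and v add up without truncation. The Lukasiewicz axiom for
  the negation of u and for v then collapses to the negation of u.\<close>

lemma sub_plus_cancel:
  assumes "u \<in> carrier A" "v \<in> carrier A" "le u (\<sim> v)"
  shows "sub (u \<oplus>\<^sub>M v) v = u"
proof -
  have "\<sim> (\<sim> (\<sim> (\<sim> u) \<oplus>\<^sub>M v) \<oplus>\<^sub>M v) = \<sim> (\<sim> (\<sim> v \<oplus>\<^sub>M \<sim> u) \<oplus>\<^sub>M \<sim> u)"
    using lukasiewicz[of "\<sim> u" v] assms by simp
  also have "\<dots> = u"
    using assms by (simp add: le_def plus_comm[of "\<sim> v"])
  finally show ?thesis
    using assms by (simp add: sub_def)
qed

primrec mtimes :: "nat \<Rightarrow> 'a \<Rightarrow> 'a" where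
  "mtimes 0 x = \<zero>\<^sub>M"
| "mtimes (Suc k) x = x \<oplus>\<^sub>M mtimes k x"

lemma mtimes_closed [simp, intro]: "x \<in> carrier A \<Longrightarrow> mtimes k x \<in> carrier A"
  by (induction k) auto

lemma mtimes_add: "x \<in> carrier A \<Longrightarrow> mtimes (j + k) x = mtimes j x \<oplus>\<^sub>M mtimes k x"
  by (induction j) (auto simp: plus_assoc)

lemma mtimes_mono: "x \<in> carrier A \<Longrightarrow> j \<le> k \<Longrightarrow> le (mtimes j x) (mtimes k x)"
  using mtimes_add[of x j "k - j"] le_plus[of "mtimes j x" "mtimes (k - j) x"] by simp

lemma subuniverse_mtimes: "mv_subuniverse A D \<Longrightarrow> x \<in> D \<Longrightarrow> mtimes k x \<in> D"
  by (induction k) (auto simp: mv_subuniverse_def)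

lemma subuniverse_sub: "mv_subuniverse A D \<Longrightarrow> x \<in> D \<Longrightarrow> y \<in> D \<Longrightarrow> sub x y \<in> D"
  by (auto simp: mv_subuniverse_def sub_def)

end

text \<open>For a subalgebra D these are the homomorphisms from D to the MV-algebra on the real
  interval [0,1], with arbitrary values outside D.\<close>

definition mv_point :: "'a mv \<Rightarrow> 'a set \<Rightarrow> ('a \<Rightarrow> real) \<Rightarrow> bool" where
  "mv_point A D h \<longleftrightarrow> h (mv_zero A) = 0 \<and>
     (\<forall>x \<in> D. 0 \<le> h x \<and> h x \<le> 1 \<and> h (mv_neg A x) = 1 - h x \<and>
        (\<forall>y \<in> D. h (mv_plus A x y) = min 1 (h x + h y)))"

context mv_algebra
begin

text \<open>An atom \<open>a\<close> of finite order \<open>n\<close> yields a point: \<open>h x = k / n\<close> for the largest \<open>k \<le> n\<close> such that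
  \<open>k\<close> copies of \<open>a\<close> lie below \<open>x\<close>.\<close>

lemma atom_point:
  assumes D: "mv_subuniverse A D" "finite D"
    and a: "a \<in> D" "a \<noteq> \<zero>\<^sub>M" "\<And>y. y \<in> D \<Longrightarrow> le y a \<Longrightarrow> y = \<zero>\<^sub>M \<or> y = a"
  obtains h and n :: nat where "n > 0" "mv_point A D h" "\<And>x. x \<in> D \<Longrightarrow> h x * n \<in> \<int>"
    "\<And>x. x \<in> D \<Longrightarrow> le a x \<Longrightarrow> h x \<noteq> 0"
proof -
  have Dc: "\<And>x. x \<in> D \<Longrightarrow> x \<in> carrier A" and D0: "\<zero>\<^sub>M \<in> D" and DN: "\<And>x. x \<in> D \<Longrightarrow> \<sim> x \<in> D"
    and DP: "\<And>x y. x \<in> D \<Longrightarrow> y \<in> D \<Longrightarrow> x \<oplus>\<^sub>M y \<in> D"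
    using D by (auto simp: mv_subuniverse_def)
  note [simp] = Dc[OF a(1)]
  \<comment> \<open>The multiples of a increase inside the finite set D, so they become
    stationary.\<close>
  have "\<not> inj (\<lambda>k. mtimes k a)"
  proof
    assume "inj (\<lambda>k. mtimes k a)"
    then have "infinite (range (\<lambda>k. mtimes k a))"
      by (simp add: finite_image_iff)
    moreover have "range (\<lambda>k. mtimes k a) \<subseteq> D"
      using subuniverse_mtimes[OF D(1) a(1)] by auto
    ultimately show False
      using D(2) finite_subset by blast
  qed
  then obtain i j where ij: "i < j" "mtimes i a = mtimes j a"
    by (metis (no_types, lifting) injI linorder_neqE_nat)
  have ex: "\<exists>n. mtimes n a = mtimes (Suc n) a"
    using ij mtimes_mono[of a i "Suc i"] mtimes_mono[of a "Suc i" j]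
      le_antisym[of "mtimes i a" "mtimes (Suc i) a"] by auto
  \<comment> \<open>The order of a: its multiples are distinct up to n and constant from there
    on.\<close>
  define n where "n = (LEAST n. mtimes n a = mtimes (Suc n) a)"
  have n: "mtimes n a = mtimes (Suc n) a"
    unfolding n_def by (rule LeastI_ex[OF ex])
  have nmin: "mtimes k a \<noteq> mtimes (Suc k) a" if "k < n" for k
    using not_less_Least that unfolding n_def by blast
  have n0: "n > 0"
    using n a(2) by (cases n) auto
  have stable: "mtimes k a = mtimes n a" if "k \<ge> n" for k
    using that
  proof (induction k rule: dec_induct)
    case (step k)
    then show ?case by (metis n mtimes.simps(2))
  qed simp
  have inj: "mtimes j a \<noteq> mtimes k a" if "j < k" "k \<le> n" for j k
    using that nmin[of j] mtimes_mono[of a j "Suc j"] mtimes_mono[of a "Suc j" k]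
      le_antisym[of "mtimes j a" "mtimes (Suc j) a"] by auto
  define \<nu> where "\<nu> y = Max {k. k \<le> n \<and> le (mtimes k a) y}" for y
  have fin: "finite {k. k \<le> n \<and> le (mtimes k a) y}" for y
    by simp
  have \<nu>1: "\<nu> y \<le> n \<and> le (mtimes (\<nu> y) a) y" if "y \<in> D" for y
  proof -
    have "0 \<in> {k. k \<le> n \<and> le (mtimes k a) y}"
      using that Dc zero_le by auto
    then show ?thesis
      using Max_in[OF fin[of y]] unfolding \<nu>_def by blast
  qed
  have \<nu>2: "k \<le> \<nu> y" if "k \<le> n" "le (mtimes k a) y" for y k
    using Max_ge[OF fin[of y]] that unfolding \<nu>_def by blast
  have mtimes_leI: "le (mtimes (Suc k) a) y" if "y \<in> D" "le (mtimes k a) y" "le a (sub y (mtimes k a))" for k y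
    using plus_mono[of a "sub y (mtimes k a)" "mtimes k a" "mtimes k a"] that Dc le_refl
      le_plus_sub[of "mtimes k a" y] by (auto simp: plus_comm)
  have nle: "\<not> le a (sub y (mtimes (\<nu> y) a))" if "y \<in> D" "\<nu> y < n" for y
    using mtimes_leI[of y "\<nu> y"] \<nu>1[of y] \<nu>2[of "Suc (\<nu> y)" y] that by auto
  have subD: "sub y (mtimes k a) \<in> D" if "y \<in> D" for y k
    using subuniverse_sub[OF D(1)] subuniverse_mtimes[OF D(1) a(1)] that by blast
  \<comment> \<open>As a is an atom, \<open>sub a x\<close> is zero or a. In the first case a lies
    below x, in the second residuation puts a below y.\<close>
  have prime: "le a x \<or> le a y" if "x \<in> D" "y \<in> D" "le a (x \<oplus>\<^sub>M y)" for x y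
  proof -
    have "sub a x = \<zero>\<^sub>M \<or> sub a x = a"
      using a(3)[of "sub a x"] subuniverse_sub[OF D(1) a(1)] sub_le that Dc by auto
    then show ?thesis
      using sub_le_iff[of a x y] sub_eq_zero_iff[of a x] that Dc by auto
  qed
  have \<nu>_plus: "\<nu> (x \<oplus>\<^sub>M y) = min n (\<nu> x + \<nu> y)" if xy: "x \<in> D" "y \<in> D" for x y
  proof (rule antisym)
    have xyc: "x \<in> carrier A" "y \<in> carrier A"
      using xy Dc by auto
    have "le (mtimes (min n (\<nu> x + \<nu> y)) a) (mtimes (\<nu> x + \<nu> y) a)"
      by (rule mtimes_mono) auto
    moreover have "le (mtimes (\<nu> x + \<nu> y) a) (x \<oplus>\<^sub>M y)"
      using plus_mono[of "mtimes (\<nu> x) a" x "mtimes (\<nu> y) a" y] \<nu>1 xy xyc by (simp add: mtimes_add)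
    ultimately have "le (mtimes (min n (\<nu> x + \<nu> y)) a) (x \<oplus>\<^sub>M y)"
      using le_trans[of "mtimes (min n (\<nu> x + \<nu> y)) a" "mtimes (\<nu> x + \<nu> y) a" "x \<oplus>\<^sub>M y"] xyc by auto
    then show "min n (\<nu> x + \<nu> y) \<le> \<nu> (x \<oplus>\<^sub>M y)"
      by (intro \<nu>2) auto
    \<comment> \<open>Split off all copies of a from x and from y, k in total. If one more copy
      fitted below the sum, a would lie below the sum of the two remainders, hence below one of
      them, against the maximality of \<open>\<nu>\<close>.\<close>
    show "\<nu> (x \<oplus>\<^sub>M y) \<le> min n (\<nu> x + \<nu> y)"
    proof (rule ccontr)
      define k where "k = \<nu> x + \<nu> y"
      define x' where "x' = sub x (mtimes (\<nu> x) a)"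
      define y' where "y' = sub y (mtimes (\<nu> y) a)"
      have c: "x' \<in> carrier A" "y' \<in> carrier A" "x' \<in> D" "y' \<in> D"
        using subD xy Dc unfolding x'_def y'_def by auto
      assume "\<not> \<nu> (x \<oplus>\<^sub>M y) \<le> min n (\<nu> x + \<nu> y)"
      then have lt: "k < \<nu> (x \<oplus>\<^sub>M y)" "k < n"
        using \<nu>1[of "x \<oplus>\<^sub>M y"] DP[OF xy] unfolding k_def by auto
      have "le (mtimes (Suc k) a) (mtimes (\<nu> (x \<oplus>\<^sub>M y)) a)"
        using lt by (intro mtimes_mono) auto
      then have le1: "le (mtimes (Suc k) a) (x \<oplus>\<^sub>M y)"
        using \<nu>1[of "x \<oplus>\<^sub>M y"] DP[OF xy] xyc
          le_trans[of "mtimes (Suc k) a" "mtimes (\<nu> (x \<oplus>\<^sub>M y)) a" "x \<oplus>\<^sub>M y"] by auto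
      have "x \<oplus>\<^sub>M y = (mtimes (\<nu> x) a \<oplus>\<^sub>M x') \<oplus>\<^sub>M (mtimes (\<nu> y) a \<oplus>\<^sub>M y')"
        using le_plus_sub[of "mtimes (\<nu> x) a" x] le_plus_sub[of "mtimes (\<nu> y) a" y] \<nu>1 xy xyc
        unfolding x'_def y'_def by simp
      also have "\<dots> = mtimes (\<nu> x) a \<oplus>\<^sub>M ((x' \<oplus>\<^sub>M mtimes (\<nu> y) a) \<oplus>\<^sub>M y')"
        using c by (simp add: plus_assoc)
      also have "\<dots> = mtimes k a \<oplus>\<^sub>M (x' \<oplus>\<^sub>M y')"
        using c by (simp add: plus_comm[of x'] plus_assoc mtimes_add k_def)
      finally have "le (sub (mtimes (Suc k) a) (mtimes k a)) (x' \<oplus>\<^sub>M y')"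
        using le1 c by (subst sub_le_iff) auto
      \<comment> \<open>The difference lies below the atom a, and it is nonzero because the
        multiples still grow strictly at k < n.\<close>
      moreover have "sub (mtimes (Suc k) a) (mtimes k a) = a"
      proof -
        have "sub (mtimes (Suc k) a) (mtimes k a) \<in> D"
          using subD subuniverse_mtimes[OF D(1) a(1)] by blast
        moreover have "le (sub (mtimes (Suc k) a) (mtimes k a)) a"
          using le_refl by (subst sub_le_iff) (auto simp: plus_comm)
        moreover have "sub (mtimes (Suc k) a) (mtimes k a) \<noteq> \<zero>\<^sub>M"
        proof
          assume "sub (mtimes (Suc k) a) (mtimes k a) = \<zero>\<^sub>M"
          then have "le (mtimes (Suc k) a) (mtimes k a)"
            by (subst (asm) sub_eq_zero_iff) auto
          then have "mtimes (Suc k) a = mtimes k a"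
            using mtimes_mono[of a k "Suc k"] by (intro le_antisym) auto
          then show False
            using nmin[OF lt(2)] by simp
        qed
        ultimately show ?thesis
          using a(3) by blast
      qed
      ultimately have "le a (x' \<oplus>\<^sub>M y')"
        by simp
      then show False
        using prime[of x' y'] c nle[of x] nle[of y] xy lt(2) unfolding k_def x'_def y'_def by auto
    qed
  qed
  have \<nu>_neg: "\<nu> (\<sim> x) = n - \<nu> x" if x: "x \<in> D" for x
  proof (rule antisym)
    have xc: "x \<in> carrier A"
      using x Dc by auto
    have "\<nu> (\<sim> x \<oplus>\<^sub>M x) = n"
      using le_refl[OF xc] \<nu>2[of n "\<sim> x \<oplus>\<^sub>M x"] \<nu>1[of "\<sim> x \<oplus>\<^sub>M x"] le_neg_zero DP DN x D0
      by (auto simp: le_def)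
    then show "n - \<nu> x \<le> \<nu> (\<sim> x)"
      using \<nu>_plus[of "\<sim> x" x] DN x by auto
    show "\<nu> (\<sim> x) \<le> n - \<nu> x"
    \<comment> \<open>With l > n - k, both l and n - k copies of a add to k copies without
      truncation, and both sums are the stationary multiple. Cancellation makes two distinct
      multiples equal.\<close>
    proof (rule ccontr)
      define k where "k = \<nu> x"
      define l where "l = \<nu> (\<sim> x)"
      assume "\<not> \<nu> (\<sim> x) \<le> n - \<nu> x"
      then have kl: "l > n - k" "l \<le> n" "k \<le> n"
        using \<nu>1 x DN unfolding k_def l_def by auto
      have "le (mtimes k a) x" "le (mtimes l a) (\<sim> x)"
        using \<nu>1 x DN unfolding k_def l_def by auto
      moreover have "le (\<sim> x) (\<sim> mtimes k a)"
        using calculation(1) xc le_neg_iff[of "\<sim> x" "mtimes k a"] by simp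
      ultimately have l: "le (mtimes l a) (\<sim> mtimes k a)"
        using le_trans[of "mtimes l a" "\<sim> x" "\<sim> mtimes k a"] xc by auto
      then have "sub (mtimes l a \<oplus>\<^sub>M mtimes k a) (mtimes k a) = mtimes l a"
        by (intro sub_plus_cancel) auto
      moreover have "le (mtimes (n - k) a) (mtimes l a)"
        using kl by (intro mtimes_mono) auto
      then have "le (mtimes (n - k) a) (\<sim> mtimes k a)"
        using l le_trans[of "mtimes (n - k) a" "mtimes l a" "\<sim> mtimes k a"] by auto
      then have "sub (mtimes (n - k) a \<oplus>\<^sub>M mtimes k a) (mtimes k a) = mtimes (n - k) a"
        by (intro sub_plus_cancel) auto
      ultimately have "mtimes l a = mtimes (n - k) a"
        using stable[of "l + k"] kl by (simp flip: mtimes_add)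
      then show False
        using inj[of "n - k" l] kl by simp
    qed
  qed
  define h where "h x = real (\<nu> x) / real n" for x
  have h_plus: "h (x \<oplus>\<^sub>M y) = min 1 (h x + h y)" if "x \<in> D" "y \<in> D" for x y
    using \<nu>_plus[OF that] n0 by (auto simp: h_def min_def field_simps)
  have h_neg: "h (\<sim> x) = 1 - h x" if "x \<in> D" for x
    using \<nu>_neg[OF that] \<nu>1[OF that] n0 by (auto simp: h_def field_simps of_nat_diff)
  have \<nu>_zero: "\<nu> \<zero>\<^sub>M = 0"
    using \<nu>1[OF D0] inj[of 0 "\<nu> \<zero>\<^sub>M"] le_zeroD[of "mtimes (\<nu> \<zero>\<^sub>M) a"] by fastforce
  have "mv_point A D h"
    using h_plus h_neg \<nu>1 n0 \<nu>_zero unfolding mv_point_def by (auto simp: h_def)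
  moreover have "h x \<noteq> 0" if "x \<in> D" "le a x" for x
    using \<nu>2[of 1 x] that n0 by (auto simp: h_def)
  moreover have "h x * real n \<in> \<int>" for x
    using n0 by (auto simp: h_def)
  ultimately show ?thesis
    using that n0 by blast
qed

text \<open>Induction on the number of elements of D below x: a nonzero element strictly below x has
  fewer of them.\<close>

lemma exists_atom_le:
  assumes D: "mv_subuniverse A D" "finite D" and x: "x \<in> D" "x \<noteq> \<zero>\<^sub>M"
  obtains a where "a \<in> D" "a \<noteq> \<zero>\<^sub>M" "le a x" "\<And>y. y \<in> D \<Longrightarrow> le y a \<Longrightarrow> y = \<zero>\<^sub>M \<or> y = a"
proof -
  have "\<exists>a \<in> D. a \<noteq> \<zero>\<^sub>M \<and> le a x \<and> (\<forall>y \<in> D. le y a \<longrightarrow> y = \<zero>\<^sub>M \<or> y = a)"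
    using x
  proof (induction "card {y \<in> D. le y x}" arbitrary: x rule: less_induct)
    case less
    have Dc: "\<And>x. x \<in> D \<Longrightarrow> x \<in> carrier A"
      using D by (auto simp: mv_subuniverse_def)
    show ?case
    proof (cases "\<forall>y \<in> D. le y x \<longrightarrow> y = \<zero>\<^sub>M \<or> y = x")
      case True
      then show ?thesis using less.prems le_refl Dc by blast
    next
      case False
      then obtain y where y: "y \<in> D" "le y x" "y \<noteq> \<zero>\<^sub>M" "y \<noteq> x"
        by blast
      have "{z \<in> D. le z y} \<subset> {z \<in> D. le z x}"
        using y less.prems le_refl le_trans[of _ y x] le_antisym[of x y] Dc by blast
      then have "card {z \<in> D. le z y} < card {z \<in> D. le z x}"
        using D(2) by (intro psubset_card_mono) auto
      then obtain a where "a \<in> D" "a \<noteq> \<zero>\<^sub>M" "le a y" "\<forall>y \<in> D. le y a \<longrightarrow> y = \<zero>\<^sub>M \<or> y = a"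
        using less.hyps[of y] y by blast
      then show ?thesis
        using le_trans[of a y x] y less.prems Dc by blast
    qed
  qed
  then show ?thesis using that by blast
qed

text \<open>An atom below a nonzero x yields a point that does not vanish at x; one such point is
  taken for each x. If the orders of the atoms are at most n, they all divide n!, which therefore is
  a common denominator.\<close>

lemma finite_separated:
  assumes D: "mv_subuniverse A D" "finite D"
  obtains H and n :: nat where "n > 0" "\<And>h. h \<in> H \<Longrightarrow> mv_point A D h"
    "\<And>h x. h \<in> H \<Longrightarrow> x \<in> D \<Longrightarrow> h x * fact n \<in> \<int>"
    "\<And>x y. x \<in> D \<Longrightarrow> y \<in> D \<Longrightarrow> (\<And>h. h \<in> H \<Longrightarrow> h x = h y) \<Longrightarrow> x = y"
proof -
  have Dc: "\<And>x. x \<in> D \<Longrightarrow> x \<in> carrier A"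
    using D by (auto simp: mv_subuniverse_def)
  have "\<exists>h n. n > 0 \<and> mv_point A D h \<and> (\<forall>y \<in> D. h y * real n \<in> \<int>) \<and> h x \<noteq> 0"
    if "x \<in> D - {\<zero>\<^sub>M}" for x
 
  proof -
    have x: "x \<in> D" "x \<noteq> \<zero>\<^sub>M"
      using that by auto
    obtain a where a: "a \<in> D" "a \<noteq> \<zero>\<^sub>M" "le a x" "\<And>y. y \<in> D \<Longrightarrow> le y a \<Longrightarrow> y = \<zero>\<^sub>M \<or> y = a"
      by (rule exists_atom_le[OF D x]) blast
    show ?thesis
      using atom_point[OF D a(1,2,4)] a(3) that by (metis DiffD1)
  qed
  then obtain h n where hn: "\<And>x. x \<in> D - {\<zero>\<^sub>M} \<Longrightarrow> n x > 0 \<and> mv_point A D (h x) \<and>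
      (\<forall>y \<in> D. h x y * real (n x) \<in> \<int>) \<and> h x x \<noteq> 0"
    by metis
  \<comment> \<open>The extra 1 keeps N positive when D contains only zero.\<close>
  define N where "N = Max (insert 1 (n ` (D - {\<zero>\<^sub>M})))"
  have le: "n x \<le> N" if "x \<in> D - {\<zero>\<^sub>M}" for x
    using D(2) that unfolding N_def by (intro Max_ge) auto
  have N0: "N \<ge> 1"
    using D(2) unfolding N_def by (intro Max_ge) auto
  show ?thesis
  proof (rule that[of N "h ` (D - {\<zero>\<^sub>M})"])
    show "N > 0" using N0 by simp
    show "mv_point A D g" if "g \<in> h ` (D - {\<zero>\<^sub>M})" for g
      using that hn by auto
    show "g x * fact N \<in> \<int>" if g: "g \<in> h ` (D - {\<zero>\<^sub>M})" "x \<in> D" for g x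
    proof -
      obtain y where y: "y \<in> D - {\<zero>\<^sub>M}" "g = h y"
        using g(1) by blast
      have "n y dvd fact N"
        using hn[OF y(1)] le[OF y(1)] by (simp add: dvd_fact)
      then obtain c where c: "fact N = n y * c"
        by blast
      then have "(fact N :: real) = real (n y) * real c"
        by (metis of_nat_fact of_nat_mult)
      then have "g x * fact N = h y x * real (n y) * of_nat c"
        using y by simp
      moreover have "h y x * real (n y) \<in> \<int>"
        using hn[OF y(1)] that by blast
      ultimately show ?thesis
        by (metis Ints_mult Ints_of_nat)
    qed
    show "x = y" if xy: "x \<in> D" "y \<in> D" "\<And>g. g \<in> h ` (D - {\<zero>\<^sub>M}) \<Longrightarrow> g x = g y" for x y
    proof (rule ccontr)
      \<comment> \<open>Points turn \<open>sub\<close> into truncated subtraction of reals. A point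
        that agrees on x and y thus vanishes on both differences, one of which is nonzero for
        distinct x and y.\<close>
      have *: "g (sub u v) = max 0 (g u - g v)" if "u \<in> D" "v \<in> D" "mv_point A D g" for u v g
      proof -
        have "\<sim> u \<in> D" "\<sim> u \<oplus>\<^sub>M v \<in> D"
          using that D(1) by (auto simp: mv_subuniverse_def)
        then have "g (\<sim> u) = 1 - g u" "g (\<sim> u \<oplus>\<^sub>M v) = min 1 (g (\<sim> u) + g v)"
          "g (sub u v) = 1 - g (\<sim> u \<oplus>\<^sub>M v)"
          using that unfolding mv_point_def sub_def by blast+
        then show ?thesis
          by simp
      qed
      assume "x \<noteq> y"
      then have "sub x y \<noteq> \<zero>\<^sub>M \<or> sub y x \<noteq> \<zero>\<^sub>M"
        using le_antisym[of x y] sub_eq_zero_iff[of x y] sub_eq_zero_iff[of y x] Dc[OF xy(1)] Dc[OF xy(2)]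
        by blast
      then obtain z where z: "z \<in> D - {\<zero>\<^sub>M}" "z = sub x y \<or> z = sub y x"
        using subuniverse_sub[OF D(1) xy(1,2)] subuniverse_sub[OF D(1) xy(2,1)] by blast
      have hz: "h z z \<noteq> 0" "mv_point A D (h z)" "h z x = h z y"
        using hn[OF z(1)] xy(3) z(1) by blast+
      have "h z z = 0"
        using z(2) *[OF xy(1,2) hz(2)] *[OF xy(2,1) hz(2)] hz(3) by (elim disjE) simp_all
      then show False
        using hz(1) by simp
    qed
  qed
qed

end

section \<open>Terms and denominators\<close>

text \<open>Finitary MV-terms, evaluated both in the unit interval and in arbitrary MV-algebras;
  \<open>mterm\<close> later turns them into terms of the infinitary signature.\<close>

datatype mvt = V nat | Zr | Ng mvt | Pl mvt mvt

primrec ev :: "'a mv \<Rightarrow> (nat \<Rightarrow> 'a) \<Rightarrow> mvt \<Rightarrow> 'a" where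
  "ev A \<rho> (V i) = \<rho> i"
| "ev A \<rho> Zr = mv_zero A"
| "ev A \<rho> (Ng s) = mv_neg A (ev A \<rho> s)"
| "ev A \<rho> (Pl s t) = mv_plus A (ev A \<rho> s) (ev A \<rho> t)"

definition Sb :: "mvt \<Rightarrow> mvt \<Rightarrow> mvt" where
  "Sb s t = Ng (Pl (Ng s) t)"

primrec Ml :: "nat \<Rightarrow> mvt \<Rightarrow> mvt" where
  "Ml 0 t = Zr"
| "Ml (Suc k) t = Pl t (Ml k t)"

section \<open>Finite chains in the unit interval and the terms that define them\<close>

definition unit_mv :: "real mv" where
  "unit_mv = \<lparr>carrier = {0..1}, mv_plus = (\<lambda>x y. min 1 (x + y)), mv_neg = (\<lambda>x. 1 - x), mv_zero = 0\<rparr>"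

lemma unit_mv_simps [simp]:
  "carrier unit_mv = {0..1}" "mv_plus unit_mv x y = min 1 (x + y)"
  "mv_neg unit_mv x = 1 - x" "mv_zero unit_mv = 0"
  by (simp_all add: unit_mv_def)

text \<open>A finite chain. The factorial makes these chains increase with n while every rational
  number in [0,1] occurs in one of them.\<close>

definition lev :: "nat \<Rightarrow> real set" where
  "lev n = {x. 0 \<le> x \<and> x \<le> 1 \<and> x * fact n \<in> \<int>}"

lemma lev_subuniverse: "mv_subuniverse unit_mv (lev n)"
proof -
  have "(fact n :: real) \<in> \<int>"
    by (metis Ints_of_nat of_nat_fact)
  then show ?thesis
    unfolding mv_subuniverse_def lev_def by (auto simp: min_def algebra_simps)
qed

lemma zero_lev: "0 \<in> lev n"
  by (simp add: lev_def)

lemma lev_mono: "n \<le> m \<Longrightarrow> lev n \<subseteq> lev m"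
proof -
  assume "n \<le> m"
  then obtain c :: nat where "fact m = fact n * c"
    using fact_dvd[of n m, where ?'a = nat] by blast
  then have "(fact m :: real) = fact n * real c"
    by (metis of_nat_fact of_nat_mult)
  then show ?thesis
    unfolding lev_def by (auto simp flip: mult.assoc)
qed

lemma finite_lev: "finite (lev n)"
proof -
  have "lev n \<subseteq> (\<lambda>k. of_int k / fact n) ` {0..fact n}"
  proof
    fix x assume x: "x \<in> lev n"
    then obtain k :: int where k: "x * fact n = of_int k"
      unfolding lev_def by (auto elim: Ints_cases)
    have "0 \<le> x * fact n" "x * fact n \<le> 1 * fact n"
      using x unfolding lev_def by (auto intro: mult_right_mono)
    then have "0 \<le> real_of_int k" "real_of_int k \<le> real_of_int (fact n)"
      using k by auto
    then have "k \<in> {0..fact n}"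
      by (simp only: of_int_le_iff of_int_0_le_iff atLeastAtMost_iff simp_thms)
    moreover have "x = of_int k / fact n"
      using k by (simp add: field_simps)
    ultimately show "x \<in> (\<lambda>k. of_int k / fact n) ` {0..fact n}"
      by blast
  qed
  then show ?thesis
    by (rule finite_subset) auto
qed

lemma ev_in_subuniverse: "mv_subuniverse A D \<Longrightarrow> (\<And>i. \<rho> i \<in> D) \<Longrightarrow> ev A \<rho> t \<in> D"
  by (induction t) (auto simp: mv_subuniverse_def)

lemma ev_unit: "(\<And>i. 0 \<le> \<rho> i \<and> \<rho> i \<le> 1) \<Longrightarrow> 0 \<le> ev unit_mv \<rho> t \<and> ev unit_mv \<rho> t \<le> 1"
  using ev_in_subuniverse[of unit_mv "{0..1}" \<rho> t] by (auto simp: mv_subuniverse_def)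

lemma ev_unit_Sb: "(\<And>i. 0 \<le> \<rho> i \<and> \<rho> i \<le> 1) \<Longrightarrow>
    ev unit_mv \<rho> (Sb s t) = max 0 (ev unit_mv \<rho> s - ev unit_mv \<rho> t)"
  by (auto simp: Sb_def)

lemma ev_unit_Ml: "(\<And>i. 0 \<le> \<rho> i \<and> \<rho> i \<le> 1) \<Longrightarrow>
    ev unit_mv \<rho> (Ml k t) = min 1 (real k * ev unit_mv \<rho> t)"
  using ev_unit[of \<rho> t] by (induction k) (auto simp: algebra_simps min_def)

text \<open>The induction raises the slope by one. The offset b stays general because the step uses
  the hypothesis for b and for b + 1.\<close>

lemma truncated_affine_term_nat:
  "\<exists>t. \<forall>x. 0 \<le> x \<and> x \<le> 1 \<longrightarrow> ev unit_mv (\<lambda>_. x) t = max 0 (min 1 (real m * x + of_int b))"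
proof (induction m arbitrary: b)
  case 0
  show ?case
  proof (cases "b \<ge> 1")
    case True
    then show ?thesis by (intro exI[of _ "Ng Zr"]) auto
  next
    case False
    then have "real_of_int b \<le> 0" by simp
    then show ?thesis by (intro exI[of _ Zr]) auto
  qed
next
  case (Suc m)
  obtain s where s: "\<And>x. 0 \<le> x \<and> x \<le> 1 \<Longrightarrow>
      ev unit_mv (\<lambda>_. x) s = max 0 (min 1 (real m * x + of_int b))"
    using Suc[of b] by blast
  obtain t where t: "\<And>x. 0 \<le> x \<and> x \<le> 1 \<Longrightarrow>
      ev unit_mv (\<lambda>_. x) t = max 0 (min 1 (real m * x + of_int (b + 1)))"
    using Suc[of "b + 1"] by blast
  \<comment> \<open>With y = mx + b, the truncation of y + x is the Lukasiewicz product of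
    (truncated y) plus x with the truncation of y + 1: the product cuts off at 0, the sum at
    1.\<close>
  have "ev unit_mv (\<lambda>_. x) (Ng (Pl (Ng (Pl s (V 0))) (Ng t)))
      = max 0 (min 1 (real (Suc m) * x + of_int b))" if "0 \<le> x \<and> x \<le> 1" for x
    using s[OF that] t[OF that] that by (auto simp: min_def max_def algebra_simps)
  then show ?case by blast
qed

text \<open>A negative slope is reduced to a positive one by negating the truncation of one minus
  the given function.\<close>

lemma truncated_affine_term:
  "\<exists>t. \<forall>x. 0 \<le> x \<and> x \<le> 1 \<longrightarrow>
     ev unit_mv (\<lambda>_. x) t = max 0 (min 1 (of_int a * x + of_int b))"
proof (cases "a \<ge> 0")
  case True
  then have "real_of_int a = real (nat a)" by simp
  then show ?thesis
    using truncated_affine_term_nat[of "nat a" b] by (simp only:)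
next
  case False
  then have a: "real_of_int a = - real (nat (- a))" by simp
  obtain t where t: "\<And>x. 0 \<le> x \<and> x \<le> 1 \<Longrightarrow>
      ev unit_mv (\<lambda>_. x) t = max 0 (min 1 (real (nat (- a)) * x + of_int (1 - b)))"
    using truncated_affine_term_nat[of "nat (- a)" "1 - b"] by blast
  have "ev unit_mv (\<lambda>_. x) (Ng t) = max 0 (min 1 (of_int a * x + of_int b))"
    if "0 \<le> x \<and> x \<le> 1" for x
    using t[OF that] unfolding a by (auto simp: min_def max_def algebra_simps)
  then show ?thesis by blast
qed

text \<open>The term is the minimum over k = 0, ..., N of the distances of Nx from k, truncated at
  1; the induction adds one k at a time.\<close>

lemma defect_term_exists:
  "\<exists>t. \<forall>x. 0 \<le> x \<and> x \<le> 1 \<longrightarrow> ev unit_mv (\<lambda>_. x) t = 0 \<longleftrightarrow> x * real N \<in> \<int>"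
proof -
  have "\<exists>t. \<forall>x. 0 \<le> x \<and> x \<le> 1 \<longrightarrow> ev unit_mv (\<lambda>_. x) t = 0 \<longleftrightarrow> (\<exists>k < K. x * real N = real k)" for K
  proof (induction K)
    case 0
    \<comment> \<open>The minimum over no k at all is the constant 1, which has no zeros.\<close>
    show ?case by (intro exI[of _ "Ng Zr"]) auto
  next
    case (Suc K)
    obtain s where s: "\<And>x. 0 \<le> x \<and> x \<le> 1 \<Longrightarrow>
        ev unit_mv (\<lambda>_. x) s = max 0 (min 1 (of_int (int N) * x + of_int (- int K)))"
      using truncated_affine_term[of "int N" "- int K"] by blast
    obtain t where t: "\<And>x. 0 \<le> x \<and> x \<le> 1 \<Longrightarrow>
        ev unit_mv (\<lambda>_. x) t = max 0 (min 1 (of_int (- int N) * x + of_int (int K)))"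
      using truncated_affine_term[of "- int N" "int K"] by blast
    obtain r where r: "\<And>x. 0 \<le> x \<and> x \<le> 1 \<Longrightarrow>
        ev unit_mv (\<lambda>_. x) r = 0 \<longleftrightarrow> (\<exists>k < K. x * real N = real k)"
      using Suc by blast
    \<comment> \<open>Two opposite truncated differences add up to the truncated distance of Nx from
      K, and subtracting twice from r yields a minimum.\<close>
    have "ev unit_mv (\<lambda>_. x) (Sb r (Sb r (Pl s t))) = 0 \<longleftrightarrow> (\<exists>k < Suc K. x * real N = real k)"
      if x: "0 \<le> x \<and> x \<le> 1" for x
    proof -
      have "ev unit_mv (\<lambda>_. x) (Pl s t) = 0 \<longleftrightarrow> x * real N = real K"
        using s[OF x] t[OF x] by (auto simp: min_def max_def algebra_simps)
      moreover have "ev unit_mv (\<lambda>_. x) (Sb r (Sb r (Pl s t))) =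
          min (ev unit_mv (\<lambda>_. x) r) (ev unit_mv (\<lambda>_. x) (Pl s t))"
        using ev_unit[of "\<lambda>_. x" r] ev_unit[of "\<lambda>_. x" "Pl s t"] x
        unfolding ev_unit_Sb[OF x] by (auto simp: min_def max_def)
      ultimately show ?thesis
        using r[OF x] ev_unit[of "\<lambda>_. x" r] ev_unit[of "\<lambda>_. x" "Pl s t"] x
        by (auto simp: min_def less_Suc_eq)
    qed
    then show ?case by blast
  qed
  then obtain t where t: "\<And>x. 0 \<le> x \<and> x \<le> 1 \<Longrightarrow>
      ev unit_mv (\<lambda>_. x) t = 0 \<longleftrightarrow> (\<exists>k < Suc N. x * real N = real k)"
    by blast
  have "(\<exists>k < Suc N. x * real N = real k) \<longleftrightarrow> x * real N \<in> \<int>" if x: "0 \<le> x \<and> x \<le> 1" for x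
  proof
    assume "x * real N \<in> \<int>"
    then obtain k where k: "x * real N = of_int k"
      by (auto elim: Ints_cases)
    have "0 \<le> x * real N" "x * real N \<le> 1 * real N"
      using x mult_right_mono[of x 1 "real N"] by auto
    then have "0 \<le> real_of_int k" "real_of_int k \<le> real_of_int (int N)"
      using k by auto
    then have "0 \<le> k" "k \<le> int N"
      by (simp_all only: of_int_le_iff of_int_0_le_iff)
    then show "\<exists>k < Suc N. x * real N = real k"
      using k by (intro exI[of _ "nat k"]) auto
  qed auto
  then show ?thesis using t by blast
qed

text \<open>The choice fixes only the zero set in [0,1]. That is enough, as the term serves to
  express membership in a level by an equation.\<close>

definition defect :: "nat \<Rightarrow> mvt" where
  "defect n = (SOME t. \<forall>x. 0 \<le> x \<and> x \<le> 1 \<longrightarrow>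
     ev unit_mv (\<lambda>_. x) t = 0 \<longleftrightarrow> x * fact n \<in> \<int>)"

lemma ev_defect: "0 \<le> x \<Longrightarrow> x \<le> 1 \<Longrightarrow> ev unit_mv (\<lambda>_. x) (defect n) = 0 \<longleftrightarrow> x \<in> lev n"
  using someI_ex[OF defect_term_exists[of "fact n"]]
  by (simp add: defect_def lev_def)

definition retract :: "nat \<Rightarrow> nat \<Rightarrow> mvt" where
  "retract n m = Sb (V 0) (Ml (fact m) (defect n))"

text \<open>The defect of x again lies in \<open>lev m\<close>. It is either zero, and nothing is
  subtracted, or at least 1/m!, and the m! copies of it in the term amount to 1.\<close>

lemma ev_retract:
  assumes x: "x \<in> lev m"
  shows "ev unit_mv (\<lambda>_. x) (retract n m) = (if x \<in> lev n then x else 0)"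
proof -
  have x01: "0 \<le> x \<and> x \<le> 1"
    using x by (simp add: lev_def)
  define d where "d = ev unit_mv (\<lambda>_. x) (defect n)"
  have d: "d \<in> lev m"
    unfolding d_def by (rule ev_in_subuniverse[OF lev_subuniverse x])
  have "fact m * d \<ge> 1" if "d \<noteq> 0"
  proof -
    obtain k where k: "d * fact m = of_int k"
      using d by (auto simp: lev_def elim: Ints_cases)
    have "d * fact m > 0"
      using d that by (auto simp: lev_def)
    then have "k > 0"
      using k by simp
    then show ?thesis
      using k by (simp add: mult.commute)
  qed
  then have "d \<noteq> 0 \<Longrightarrow> min 1 (real (fact m) * d) = 1"
    by simp
  then show ?thesis
    using x01 ev_defect[of x n] unfolding retract_def ev_unit_Sb[OF x01] ev_unit_Ml[OF x01]
    by (cases "d = 0") (auto simp: d_def)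
qed

section \<open>Levels and retractions in locally finite MV-algebras\<close>

lemma point_ev:
  assumes "mv_subuniverse A D" "mv_point A D h" "\<And>i. \<rho> i \<in> D"
  shows "h (ev A \<rho> t) = ev unit_mv (\<lambda>i. h (\<rho> i)) t"
  using ev_in_subuniverse[OF assms(1,3)] assms(2,3)
  by (induction t) (auto simp: mv_point_def)

lemma mv_hom_ev:
  assumes "mv_subuniverse A (carrier A)" "g \<in> mv_hom A B" "\<And>i. \<rho> i \<in> carrier A"
  shows "g (ev A \<rho> t) = ev B (\<lambda>i. g (\<rho> i)) t"
  using ev_in_subuniverse[OF assms(1,3)] assms(2,3)
  by (induction t) (auto simp: mv_hom_def)

text \<open>Being given by an equation in the language of MV-algebras, levels are preserved by
  homomorphisms.\<close>

definition lvl :: "'a mv \<Rightarrow> nat \<Rightarrow> 'a set" where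
  "lvl A n = {x \<in> carrier A. ev A (\<lambda>_. x) (defect n) = mv_zero A}"

text \<open>The target level n comes first. The term behaves as a retraction only on arguments from
  level m.\<close>

definition rtr :: "'a mv \<Rightarrow> nat \<Rightarrow> nat \<Rightarrow> 'a \<Rightarrow> 'a" where
  "rtr A n m x = ev A (\<lambda>_. x) (retract n m)"

text \<open>Evaluation at H embeds the subalgebra D into a power of [0,1], so equations in D can be
  checked pointwise in the reals.\<close>

definition separated :: "'a mv \<Rightarrow> 'a set \<Rightarrow> ('a \<Rightarrow> real) set \<Rightarrow> bool" where
  "separated A D H \<longleftrightarrow> mv_subuniverse A D \<and> (\<forall>h \<in> H. mv_point A D h) \<and>
     (\<forall>x \<in> D. \<forall>y \<in> D. (\<forall>h \<in> H. h x = h y) \<longrightarrow> x = y)"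

lemma separated_eqI:
  "separated A D H \<Longrightarrow> x \<in> D \<Longrightarrow> y \<in> D \<Longrightarrow> (\<And>h. h \<in> H \<Longrightarrow> h x = h y) \<Longrightarrow> x = y"
  unfolding separated_def by blast

lemma separated_ev:
  "separated A D H \<Longrightarrow> (\<And>i. \<rho> i \<in> D) \<Longrightarrow> ev A \<rho> t \<in> D"
  unfolding separated_def by (blast intro: ev_in_subuniverse)

lemma separated_point_ev:
  "separated A D H \<Longrightarrow> h \<in> H \<Longrightarrow> (\<And>i. \<rho> i \<in> D) \<Longrightarrow> h (ev A \<rho> t) = ev unit_mv (\<lambda>i. h (\<rho> i)) t"
  unfolding separated_def by (blast intro: point_ev)

text \<open>Points commute with terms, so the defect of x is zero exactly if the real defect of
  every h x is; this links the equational definition of levels to denominators.\<close>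

lemma separated_lvl_iff:
  assumes "separated A D H" "x \<in> D"
  shows "x \<in> lvl A n \<longleftrightarrow> (\<forall>h \<in> H. h x \<in> lev n)"
proof -
  have D: "mv_subuniverse A D" and H: "\<And>h. h \<in> H \<Longrightarrow> mv_point A D h"
    using assms unfolding separated_def by auto
  have h01: "0 \<le> h x \<and> h x \<le> 1" and h0: "h (mv_zero A) = 0" if "h \<in> H" for h
    using H[OF that] assms(2) by (auto simp: mv_point_def)
  have "mv_zero A \<in> D"
    using D by (simp add: mv_subuniverse_def)
  moreover have "ev A (\<lambda>_. x) (defect n) \<in> D"
    by (rule separated_ev[OF assms])
  ultimately have "ev A (\<lambda>_. x) (defect n) = mv_zero A \<longleftrightarrow>
      (\<forall>h \<in> H. h (ev A (\<lambda>_. x) (defect n)) = h (mv_zero A))"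
    using separated_eqI[OF assms(1), of "ev A (\<lambda>_. x) (defect n)" "mv_zero A"] by metis
  also have "\<dots> \<longleftrightarrow> (\<forall>h \<in> H. h (ev A (\<lambda>_. x) (defect n)) = 0)"
    by (metis h0)
  also have "\<dots> \<longleftrightarrow> (\<forall>h \<in> H. h x \<in> lev n)"
  proof (rule ball_cong[OF refl])
    fix h assume h: "h \<in> H"
    show "h (ev A (\<lambda>_. x) (defect n)) = 0 \<longleftrightarrow> h x \<in> lev n"
      unfolding separated_point_ev[OF assms(1) h assms(2)] using ev_defect h01[OF h] by simp
  qed
  finally show ?thesis
    using assms(2) D by (auto simp: lvl_def mv_subuniverse_def)
qed

locale lf_mv = mv_algebra +
  assumes lf: "locally_finite_mv A"
begin

lemma carrier_subuniverse: "mv_subuniverse A (carrier A)"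
  by (auto simp: mv_subuniverse_def)

lemma lvl_closed: "x \<in> lvl A n \<Longrightarrow> x \<in> carrier A"
  by (simp add: lvl_def)

text \<open>Local finiteness makes the generated subalgebra finite, and
  \<open>finite_separated\<close> supplies points with a common denominator for it.\<close>

lemma separating_points:
  assumes S: "finite S" "S \<subseteq> carrier A"
  obtains D H N where "separated A D H" "S \<subseteq> D" "\<And>h x. h \<in> H \<Longrightarrow> x \<in> D \<Longrightarrow> h x \<in> lev N"
proof -
  define D where "D = mv_subuniverse A hull S"
  have D: "mv_subuniverse A D"
    unfolding D_def hull_def mv_subuniverse_def using carrier_subuniverse S
    by (auto simp: mv_subuniverse_def)
  have fD: "finite D"
    using lf S unfolding locally_finite_mv_def D_def by blast
  obtain H and N :: nat where H: "\<And>h. h \<in> H \<Longrightarrow> mv_point A D h"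
    "\<And>h x. h \<in> H \<Longrightarrow> x \<in> D \<Longrightarrow> h x * fact N \<in> \<int>"
    "\<And>x y. x \<in> D \<Longrightarrow> y \<in> D \<Longrightarrow> (\<And>h. h \<in> H \<Longrightarrow> h x = h y) \<Longrightarrow> x = y"
    by (rule finite_separated[OF D fD]) blast
  have "separated A D H"
    using D H(1,3) by (simp add: separated_def)
  moreover have "S \<subseteq> D"
    unfolding D_def by (rule hull_subset)
  moreover have "h x \<in> lev N" if "h \<in> H" "x \<in> D" for h x
    using H(1)[OF that(1)] H(2)[OF that] that(2) by (auto simp: mv_point_def lev_def)
  ultimately show ?thesis
    using that by blast
qed

lemma lvl_subuniverse: "mv_subuniverse A (lvl A n)"
proof -
  have *: "\<zero>\<^sub>M \<in> lvl A n \<and> \<sim> x \<in> lvl A n \<and> x \<oplus>\<^sub>M y \<in> lvl A n"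
    if xy: "x \<in> lvl A n \<union> {\<zero>\<^sub>M}" "y \<in> lvl A n \<union> {\<zero>\<^sub>M}" for x y
  proof -
    have xyc: "finite {x, y}" "{x, y} \<subseteq> carrier A"
      using xy lvl_closed by auto
    obtain D H N where D: "separated A D H" "{x, y} \<subseteq> D" "\<And>h x. h \<in> H \<Longrightarrow> x \<in> D \<Longrightarrow> h x \<in> lev N"
      by (rule separating_points[OF xyc]) blast
    have xD: "\<zero>\<^sub>M \<in> D" "x \<in> D" "y \<in> D" "\<sim> x \<in> D" "x \<oplus>\<^sub>M y \<in> D"
      using D(1,2) by (auto simp: mv_subuniverse_def separated_def)
    have "h \<zero>\<^sub>M \<in> lev n \<and> h (\<sim> x) \<in> lev n \<and> h (x \<oplus>\<^sub>M y) \<in> lev n" if h: "h \<in> H" for h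
    proof -
      have pt: "mv_point A D h"
        using D(1) h by (simp add: separated_def)
      then have h0: "h \<zero>\<^sub>M = 0" "0 \<in> lev n"
        by (simp_all add: mv_point_def lev_def)
      have "h x \<in> lev n" "h y \<in> lev n"
        using separated_lvl_iff[OF D(1), of _ n] xD xy h h0 by auto
      moreover have "h (\<sim> x) = 1 - h x" "h (x \<oplus>\<^sub>M y) = min 1 (h x + h y)"
        using pt xD unfolding mv_point_def by blast+
      ultimately show ?thesis
        using lev_subuniverse[of n] h0 by (auto simp: mv_subuniverse_def)
    qed
    then show ?thesis
      using separated_lvl_iff[OF D(1), of _ n] xD by blast
  qed
  show ?thesis
    using * lvl_closed by (auto simp: mv_subuniverse_def)
qed

lemma lvl_mono:
  assumes "n \<le> m" "x \<in> lvl A n"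
  shows "x \<in> lvl A m"
proof -
  have "finite {x}" "{x} \<subseteq> carrier A"
    using assms lvl_closed by auto
  then obtain D H N where D: "separated A D H" "{x} \<subseteq> D"
      "\<And>h x. h \<in> H \<Longrightarrow> x \<in> D \<Longrightarrow> h x \<in> lev N"
    by (rule separating_points) blast
  then show ?thesis
    using lev_mono[OF assms(1)] assms(2) separated_lvl_iff[OF D(1), of x] by auto
qed

lemma lvl_exhaust:
  assumes "x \<in> carrier A"
  obtains n where "x \<in> lvl A n"
proof -
  have "finite {x}" "{x} \<subseteq> carrier A"
    using assms by auto
  then obtain D H N where D: "separated A D H" "{x} \<subseteq> D"
      "\<And>h x. h \<in> H \<Longrightarrow> x \<in> D \<Longrightarrow> h x \<in> lev N"
    by (rule separating_points) blast
  then show ?thesis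
    using separated_lvl_iff[OF D(1), of x] that[of N] by auto
qed

text \<open>Reduces identities on a level to identities on the chain \<open>lev n\<close>. The
  finite range of the valuation is what allows local finiteness to provide separating points. That
  they vanish at zero is passed on, for variables that are assigned zero.\<close>

lemma ev_eq_on_lvl:
  assumes \<rho>: "\<And>i. \<rho> i \<in> lvl A n" "finite (range \<rho>)"
    and eq: "\<And>h. (\<And>i. h (\<rho> i) \<in> lev n) \<Longrightarrow> h (mv_zero A) = 0 \<Longrightarrow>
      ev unit_mv (\<lambda>i. h (\<rho> i)) s = ev unit_mv (\<lambda>i. h (\<rho> i)) t"
  shows "ev A \<rho> s = ev A \<rho> t"
proof -
  have "range \<rho> \<subseteq> carrier A"
    using \<rho>(1) lvl_closed by blast
  with \<rho>(2) obtain D H N where D: "separated A D H" "range \<rho> \<subseteq> D"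
      "\<And>h x. h \<in> H \<Longrightarrow> x \<in> D \<Longrightarrow> h x \<in> lev N"
    by (rule separating_points) blast
  have \<rho>D: "\<And>i. \<rho> i \<in> D" using D(2) by auto
  show ?thesis
  proof (rule separated_eqI[OF D(1) separated_ev[OF D(1) \<rho>D] separated_ev[OF D(1) \<rho>D]])
    fix h assume h: "h \<in> H"
    have "h (\<rho> i) \<in> lev n" for i
      using separated_lvl_iff[OF D(1) \<rho>D] \<rho>(1) h by blast
    moreover have "h (mv_zero A) = 0"
      using D(1) h by (simp add: separated_def mv_point_def)
    ultimately show "h (ev A \<rho> s) = h (ev A \<rho> t)"
      unfolding separated_point_ev[OF D(1) h \<rho>D] by (rule eq)
  qed
qed

text \<open>In coordinates a retraction keeps or kills each value, so its laws follow by comparing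
  chains at every point.\<close>

lemma rtr_facts:
  assumes "x \<in> carrier A"
  obtains D H where "separated A D H" "x \<in> D" "\<And>n m y. y \<in> D \<Longrightarrow> rtr A n m y \<in> D"
    "\<And>h n m y. h \<in> H \<Longrightarrow> y \<in> D \<Longrightarrow> h y \<in> lev m \<Longrightarrow>
       h (rtr A n m y) = (if h y \<in> lev n then h y else 0)"
proof -
  have "finite {x}" "{x} \<subseteq> carrier A"
    using assms by auto
  then obtain D H N where D: "separated A D H" "{x} \<subseteq> D"
      "\<And>h x. h \<in> H \<Longrightarrow> x \<in> D \<Longrightarrow> h x \<in> lev N"
    by (rule separating_points) blast
  have r1: "rtr A n m y \<in> D" if "y \<in> D" for n m y
    unfolding rtr_def by (rule separated_ev[OF D(1) that])
  have r2: "h (rtr A n m y) = (if h y \<in> lev n then h y else 0)"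
    if "h \<in> H" "y \<in> D" "h y \<in> lev m" for h n m y
    unfolding rtr_def separated_point_ev[OF D(1) that(1) that(2)] by (rule ev_retract[OF that(3)])
  show ?thesis
    using D(2) by (intro that[OF D(1) _ r1 r2]) auto
qed

lemma rtr_in_lvl:
  assumes "x \<in> lvl A m"
  shows "rtr A n m x \<in> lvl A n"
proof -
  obtain D H where D: "separated A D H" "x \<in> D" "\<And>n m y. y \<in> D \<Longrightarrow> rtr A n m y \<in> D"
    "\<And>h n m y. h \<in> H \<Longrightarrow> y \<in> D \<Longrightarrow> h y \<in> lev m \<Longrightarrow>
       h (rtr A n m y) = (if h y \<in> lev n then h y else 0)"
    by (rule rtr_facts[OF lvl_closed[OF assms]]) blast
  have "h (rtr A n m x) \<in> lev n" if "h \<in> H" for h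
  proof -
    have "h x \<in> lev m"
      using separated_lvl_iff[OF D(1,2), of m] assms that by blast
    then show ?thesis
      using D(4)[OF that D(2), of m n] zero_lev by simp
  qed
  then show ?thesis
    using separated_lvl_iff[OF D(1) D(3)[OF D(2)], of n] by blast
qed

lemma rtr_eq:
  assumes "x \<in> lvl A n" "n \<le> m"
  shows "rtr A n m x = x"
proof -
  obtain D H where D: "separated A D H" "x \<in> D" "\<And>n m y. y \<in> D \<Longrightarrow> rtr A n m y \<in> D"
    "\<And>h n m y. h \<in> H \<Longrightarrow> y \<in> D \<Longrightarrow> h y \<in> lev m \<Longrightarrow>
       h (rtr A n m y) = (if h y \<in> lev n then h y else 0)"
    by (rule rtr_facts[OF lvl_closed[OF assms(1)]]) blast
  have "h x \<in> lev n \<and> h x \<in> lev m" if "h \<in> H" for h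
    using separated_lvl_iff[OF D(1,2), of n] assms that lev_mono[OF assms(2)] by auto
  then show ?thesis
    using D(4)[OF _ D(2), of _ m n] by (intro separated_eqI[OF D(1) D(3)[OF D(2)] D(2)]) auto
qed

text \<open>As \<open>lev n\<close> is contained in \<open>lev m\<close>, the inner retraction kills
  only values that the composite kills too.\<close>

lemma rtr_rtr:
  assumes "x \<in> lvl A m'" "n \<le> m" "m \<le> m'"
  shows "rtr A n m (rtr A m m' x) = rtr A n m' x"
proof -
  obtain D H where D: "separated A D H" "x \<in> D"
    "\<And>h n m y. h \<in> H \<Longrightarrow> y \<in> D \<Longrightarrow> h y \<in> lev m \<Longrightarrow>
       h (rtr A n m y) = (if h y \<in> lev n then h y else 0)"
    "\<And>n m y. y \<in> D \<Longrightarrow> rtr A n m y \<in> D"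
    by (rule rtr_facts[OF lvl_closed[OF assms(1)]]) blast
  show ?thesis
  proof (rule separated_eqI[OF D(1) D(4)[OF D(4)[OF D(2)]] D(4)[OF D(2)]])
    fix h assume h: "h \<in> H"
    have "h x \<in> lev m'"
      using separated_lvl_iff[OF D(1,2)] assms h by auto
    then show "h (rtr A n m (rtr A m m' x)) = h (rtr A n m' x)"
      using D(3)[OF h D(2), of m'] D(3)[OF h D(4)[OF D(2)], of m] lev_mono[OF assms(2)] zero_lev
      by auto
  qed
qed

lemma rtr_zero: "rtr A n m \<zero>\<^sub>M = \<zero>\<^sub>M" if "n \<le> m"
  using rtr_eq[OF _ that, of "\<zero>\<^sub>M"] lvl_subuniverse[of n] by (auto simp: mv_subuniverse_def)

end

section \<open>Fully faithful and essentially surjective functors\<close>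

lemma (in category) Comp_assoc_rev:
  "\<lbrakk>W \<in> Obj C; X \<in> Obj C; Y \<in> Obj C; Z \<in> Obj C;
    f \<in> Hom C W X; g \<in> Hom C X Y; h \<in> Hom C Y Z\<rbrakk>
    \<Longrightarrow> Comp C W X Z (Comp C X Y Z h g) f = Comp C W Y Z h (Comp C W X Y g f)"
  using Comp_assoc by simp

text \<open>The quasi-inverse picks a preimage of every object up to isomorphism and acts on arrows
  by conjugating with the chosen isomorphisms and then inverting F on hom-sets.\<close>

lemma equivalent_categoriesI:
  fixes C :: "('o, 'm) cat" and D :: "('p, 'n) cat"
  assumes F: "cat_functor C D F"
    and ff: "\<And>X Y. X \<in> Obj C \<Longrightarrow> Y \<in> Obj C \<Longrightarrow>
      bij_betw (amap F X Y) (Hom C X Y) (Hom D (omap F X) (omap F Y))"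
    and eso: "\<And>Z. Z \<in> Obj D \<Longrightarrow> \<exists>X \<in> Obj C. \<exists>f. isomorphism D (omap F X) Z f"
  shows "equivalent_categories C D"
proof -
  interpret cat_functor C D F by (rule F)
  have "\<forall>Z. \<exists>X e d. Z \<in> Obj D \<longrightarrow> X \<in> Obj C \<and> e \<in> Hom D (omap F X) Z \<and> d \<in> Hom D Z (omap F X) \<and>
      Comp D (omap F X) Z (omap F X) d e = Id D (omap F X) \<and> Comp D Z (omap F X) Z e d = Id D Z"
    using eso unfolding isomorphism_def by meson
  then obtain G0 e d where G0: "\<And>Z. Z \<in> Obj D \<Longrightarrow> G0 Z \<in> Obj C"
    and e: "\<And>Z. Z \<in> Obj D \<Longrightarrow> e Z \<in> Hom D (omap F (G0 Z)) Z"
    and d: "\<And>Z. Z \<in> Obj D \<Longrightarrow> d Z \<in> Hom D Z (omap F (G0 Z))"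
    and de: "\<And>Z. Z \<in> Obj D \<Longrightarrow>
      Comp D (omap F (G0 Z)) Z (omap F (G0 Z)) (d Z) (e Z) = Id D (omap F (G0 Z))"
    and ed: "\<And>Z. Z \<in> Obj D \<Longrightarrow> Comp D Z (omap F (G0 Z)) Z (e Z) (d Z) = Id D Z"
    by metis
  define P where "P X Y = inv_into (Hom C X Y) (amap F X Y)" for X Y
  have P_in: "P X Y g \<in> Hom C X Y" and FP: "amap F X Y (P X Y g) = g"
    if "X \<in> Obj C" "Y \<in> Obj C" "g \<in> Hom D (omap F X) (omap F Y)" for X Y g
    using ff[OF that(1,2)] that(3) unfolding P_def bij_betw_def
    by (auto intro: inv_into_into f_inv_into_f)
  have F_inj: "f = g" if "X \<in> Obj C" "Y \<in> Obj C" "f \<in> Hom C X Y" "g \<in> Hom C X Y"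
      "amap F X Y f = amap F X Y g" for X Y f g
    using ff[OF that(1,2)] that(3-5) unfolding bij_betw_def inj_on_def by blast
  define k where "k Z W g = Comp D (omap F (G0 Z)) W (omap F (G0 W)) (d W)
      (Comp D (omap F (G0 Z)) Z W g (e Z))" for Z W g
  note [simp] = G0 e d de ed P_in FP omap_in_Obj amap_in_Hom C.Id_in_Hom D.Id_in_Hom
    C.Comp_in_Hom D.Comp_in_Hom D.Comp_Id_left D.Comp_Id_right C.Comp_Id_left C.Comp_Id_right
    D.Comp_assoc_rev amap_Id amap_Comp
  \<comment> \<open>Simplification nests composites to the right, so the cancellation of inverse
    arrows is also needed in front of a further arrow y.\<close>
  have e_d [simp]: "Comp D V (omap F (G0 Z)) Z (e Z) (Comp D V Z (omap F (G0 Z)) (d Z) y) = y"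
    if "V \<in> Obj D" "Z \<in> Obj D" "y \<in> Hom D V Z" for V Z y
    using that D.Comp_assoc[of V Z "omap F (G0 Z)" Z y "d Z" "e Z"] by simp
  have d_e [simp]: "Comp D V Z (omap F (G0 Z)) (d Z) (Comp D V (omap F (G0 Z)) Z (e Z) y) = y"
    if "V \<in> Obj D" "Z \<in> Obj D" "y \<in> Hom D V (omap F (G0 Z))" for V Z y
    using that D.Comp_assoc[of V "omap F (G0 Z)" Z "omap F (G0 Z)" y "e Z" "d Z"] by simp
  have k_in [simp]: "k Z W g \<in> Hom D (omap F (G0 Z)) (omap F (G0 W))"
    if "Z \<in> Obj D" "W \<in> Obj D" "g \<in> Hom D Z W" for Z W g
    using that by (simp add: k_def)
  define G where "G = \<lparr>omap = G0, amap = (\<lambda>Z W g. P (G0 Z) (G0 W) (k Z W g))\<rparr>"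
  have G: "cat_functor D C G"
  proof
    fix X assume X: "X \<in> Obj D"
    show "omap G X \<in> Obj C"
      using X by (simp add: G_def)
    \<comment> \<open>Equations between arrows of C are verified after applying F, which is
      faithful.\<close>
    have "P (G0 X) (G0 X) (k X X (Id D X)) = Id C (G0 X)"
      by (rule F_inj[of "G0 X" "G0 X"]) (use X in \<open>simp_all add: k_def\<close>)
    then show "amap G X X (Id D X) = Id C (omap G X)"
      by (simp add: G_def)
  next
    fix X Y f assume "X \<in> Obj D" "Y \<in> Obj D" "f \<in> Hom D X Y"
    then show "amap G X Y f \<in> Hom C (omap G X) (omap G Y)"
      by (simp add: G_def)
  next
    fix X Y Z f g
    assume "X \<in> Obj D" "Y \<in> Obj D" "Z \<in> Obj D" "f \<in> Hom D X Y" "g \<in> Hom D Y Z"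
    then have "P (G0 X) (G0 Z) (k X Z (Comp D X Y Z g f)) =
        Comp C (G0 X) (G0 Y) (G0 Z) (P (G0 Y) (G0 Z) (k Y Z g)) (P (G0 X) (G0 Y) (k X Y f))"
      by (intro F_inj[of "G0 X" "G0 Z"]) (simp_all add: k_def)
    then show "amap G X Z (Comp D X Y Z g f) =
        Comp C (omap G X) (omap G Y) (omap G Z) (amap G Y Z g) (amap G X Y f)"
      by (simp add: G_def)
  qed
  define \<eta> where "\<eta> X = P X (G0 (omap F X)) (d (omap F X))" for X
  have "natural_isomorphism C C id_func (comp_func G F) \<eta>"
    unfolding natural_isomorphism_def isomorphism_def
  proof (intro conjI ballI)
    fix X assume X: "X \<in> Obj C"
    then show "\<eta> X \<in> Hom C (omap id_func X) (omap (comp_func G F) X)"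
      by (simp add: \<eta>_def id_func_def comp_func_def G_def)
    show "\<exists>g \<in> Hom C (omap (comp_func G F) X) (omap id_func X).
        Comp C (omap id_func X) (omap (comp_func G F) X) (omap id_func X) g (\<eta> X) =
          Id C (omap id_func X) \<and>
        Comp C (omap (comp_func G F) X) (omap id_func X) (omap (comp_func G F) X) (\<eta> X) g =
          Id C (omap (comp_func G F) X)"
    proof (intro bexI conjI)
      let ?g = "P (G0 (omap F X)) X (e (omap F X))"
      show "?g \<in> Hom C (omap (comp_func G F) X) (omap id_func X)"
        using X by (simp add: id_func_def comp_func_def G_def)
      have "Comp C X (G0 (omap F X)) X ?g (\<eta> X) = Id C X"
        by (rule F_inj[of X X]) (use X in \<open>simp_all add: \<eta>_def\<close>)
      then show "Comp C (omap id_func X) (omap (comp_func G F) X) (omap id_func X) ?g (\<eta> X) =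
          Id C (omap id_func X)"
        by (simp add: id_func_def comp_func_def G_def)
      have "Comp C (G0 (omap F X)) X (G0 (omap F X)) (\<eta> X) ?g = Id C (G0 (omap F X))"
        by (rule F_inj[of "G0 (omap F X)" "G0 (omap F X)"]) (use X in \<open>simp_all add: \<eta>_def\<close>)
      then show "Comp C (omap (comp_func G F) X) (omap id_func X) (omap (comp_func G F) X) (\<eta> X) ?g =
          Id C (omap (comp_func G F) X)"
        by (simp add: id_func_def comp_func_def G_def)
    qed
  next
    fix X Y f assume "X \<in> Obj C" "Y \<in> Obj C" "f \<in> Hom C X Y"
    then have "Comp C X Y (G0 (omap F Y)) (\<eta> Y) f =
        Comp C X (G0 (omap F X)) (G0 (omap F Y))
          (P (G0 (omap F X)) (G0 (omap F Y)) (k (omap F X) (omap F Y) (amap F X Y f))) (\<eta> X)"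
      by (intro F_inj[of X "G0 (omap F Y)"]) (simp_all add: \<eta>_def k_def)
    then show "Comp C (omap id_func X) (omap id_func Y) (omap (comp_func G F) Y) (\<eta> Y)
          (amap id_func X Y f) =
        Comp C (omap id_func X) (omap (comp_func G F) X) (omap (comp_func G F) Y)
          (amap (comp_func G F) X Y f) (\<eta> X)"
      by (simp add: id_func_def comp_func_def G_def)
  qed
  moreover have "natural_isomorphism D D (comp_func F G) id_func e"
    unfolding natural_isomorphism_def isomorphism_def
  proof (intro conjI ballI)
    fix Z assume Z: "Z \<in> Obj D"
    then show "e Z \<in> Hom D (omap (comp_func F G) Z) (omap id_func Z)"
      by (simp add: id_func_def comp_func_def G_def)
    show "\<exists>g \<in> Hom D (omap id_func Z) (omap (comp_func F G) Z).
        Comp D (omap (comp_func F G) Z) (omap id_func Z) (omap (comp_func F G) Z) g (e Z) =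
          Id D (omap (comp_func F G) Z) \<and>
        Comp D (omap id_func Z) (omap (comp_func F G) Z) (omap id_func Z) (e Z) g =
          Id D (omap id_func Z)"
      by (rule bexI[of _ "d Z"]) (use Z in \<open>simp_all add: id_func_def comp_func_def G_def\<close>)
  next
    fix X Y f assume "X \<in> Obj D" "Y \<in> Obj D" "f \<in> Hom D X Y"
    then show "Comp D (omap (comp_func F G) X) (omap (comp_func F G) Y) (omap id_func Y) (e Y)
          (amap (comp_func F G) X Y f) =
        Comp D (omap (comp_func F G) X) (omap id_func X) (omap id_func Y) (amap id_func X Y f) (e X)"
      by (simp add: id_func_def comp_func_def G_def k_def)
  qed
  ultimately show ?thesis
    unfolding equivalent_categories_def using F G by blast
qed

section \<open>Free algebras\<close>

inductive_set terms_over :: "('f, 'i) signature \<Rightarrow> 'v set \<Rightarrow> ('f, 'i, 'v) trm set"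
  for \<Sigma> :: "('f, 'i) signature" and X :: "'v set" where
  Var: "v \<in> X \<Longrightarrow> Var v \<in> terms_over \<Sigma> X"
| Op: "\<lbrakk>f \<in> ops \<Sigma>; \<And>i. i \<in> arity \<Sigma> f \<Longrightarrow> ts i \<in> terms_over \<Sigma> X\<rbrakk> \<Longrightarrow> Op f ts \<in> terms_over \<Sigma> X"

primrec subst_term :: "('v \<Rightarrow> ('f, 'i, 'w) trm) \<Rightarrow> ('f, 'i, 'v) trm \<Rightarrow> ('f, 'i, 'w) trm" where
  "subst_term \<sigma> (Var v) = \<sigma> v"
| "subst_term \<sigma> (Op f ts) = Op f (\<lambda>i. subst_term \<sigma> (ts i))"

lemma eval_subst_term: "eval_term \<Sigma> A \<rho> (subst_term \<sigma> t) = eval_term \<Sigma> A (\<lambda>v. eval_term \<Sigma> A \<rho> (\<sigma> v)) t"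
  by (induction t) (auto intro!: arg_cong[where f = "interp A _"])

lemma subst_term_in: "sig_term \<Sigma> t \<Longrightarrow> (\<And>v. \<sigma> v \<in> terms_over \<Sigma> X) \<Longrightarrow> subst_term \<sigma> t \<in> terms_over \<Sigma> X"
  by (induction rule: sig_term.induct) (auto intro: terms_over.intros)

lemma interp_closed:
  "sig_algebra \<Sigma> A \<Longrightarrow> f \<in> ops \<Sigma> \<Longrightarrow> xs \<in> arity \<Sigma> f \<rightarrow>\<^sub>E carrier A \<Longrightarrow> interp A f xs \<in> carrier A"
  unfolding sig_algebra_def by (metis funcset_mem)

lemma eval_term_closed:
  "t \<in> terms_over \<Sigma> X \<Longrightarrow> sig_algebra \<Sigma> A \<Longrightarrow> \<rho> ` X \<subseteq> carrier A \<Longrightarrow> eval_term \<Sigma> A \<rho> t \<in> carrier A"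
proof (induction rule: terms_over.induct)
  case (Op f ts)
  then have "(\<lambda>i \<in> arity \<Sigma> f. eval_term \<Sigma> A \<rho> (ts i)) \<in> arity \<Sigma> f \<rightarrow>\<^sub>E carrier A"
    by auto
  then show ?case
    using interp_closed[OF Op.prems(1) Op.hyps(1)] by simp
qed auto

text \<open>A term is coded by the labels of its nodes, and a node is addressed by the path leading to it
  from the root. The label of a node is itself a sequence of elements, in which \<open>a\<close> and \<open>b\<close> serve
  as bits.\<close>

primrec term_code :: "('f \<Rightarrow> nat) \<Rightarrow> ('v \<Rightarrow> 'u) \<Rightarrow> 'u \<Rightarrow> 'u \<Rightarrow> ('f, 'i) signature \<Rightarrow>
    ('f, 'i, 'v) trm \<Rightarrow> 'i list \<Rightarrow> nat \<Rightarrow> 'u" where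
  "term_code \<phi> \<iota> a b \<Sigma> (Var v) = (\<lambda>p k. case p of
     [] \<Rightarrow> if k = 0 then b else if k = 1 then \<iota> v else a | _ # _ \<Rightarrow> a)"
| "term_code \<phi> \<iota> a b \<Sigma> (Op f ts) = (\<lambda>p k. case p of
     [] \<Rightarrow> if k = \<phi> f + 2 then b else a
   | i # q \<Rightarrow> if i \<in> arity \<Sigma> f then term_code \<phi> \<iota> a b \<Sigma> (ts i) q k else a)"

lemma term_code_range:
  "t \<in> terms_over \<Sigma> X \<Longrightarrow> a \<in> Y \<Longrightarrow> b \<in> Y \<Longrightarrow> \<iota> ` X \<subseteq> Y \<Longrightarrow> term_code \<phi> \<iota> a b \<Sigma> t p k \<in> Y"
  by (induction arbitrary: p rule: terms_over.induct) (auto split: list.split)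

text \<open>Codes see only the subterms at indices in the arity. Terms that differ elsewhere share a
  code, so the conclusion is about values instead of terms.\<close>

lemma eval_eq_if_term_code_eq:
  assumes "t \<in> terms_over \<Sigma> X" "t' \<in> terms_over \<Sigma> X" "a \<noteq> b" "inj_on \<iota> X" "inj \<phi>"
    and "term_code \<phi> \<iota> a b \<Sigma> t = term_code \<phi> \<iota> a b \<Sigma> t'"
  shows "eval_term \<Sigma> A \<rho> t = eval_term \<Sigma> A \<rho> t'"
  using assms(1,2,6)
proof (induction arbitrary: t' rule: terms_over.induct)
  case (Var v)
  show ?case
  proof (cases t')
    case (Var w)
    then have "\<iota> v = \<iota> w"
      using fun_cong[OF fun_cong[OF Var.prems(2)], of "[]" 1] by simp
    moreover have "w \<in> X"
      using Var.prems(1) Var by (auto elim: terms_over.cases)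
    ultimately show ?thesis
      using Var Var.hyps assms(4) by (auto dest: inj_onD)
  next
    case (Op f ts)
    then show ?thesis
      \<comment> \<open>At the root, place 0 of the label holds b for a variable and a for an
        operation.\<close>
      using fun_cong[OF fun_cong[OF Var.prems(2)], of "[]" 0] assms(3) by simp
  qed
next
  case (Op f ts)
  show ?case
  proof (cases t')
    case (Var w)
    then show ?thesis
      using fun_cong[OF fun_cong[OF Op.prems(2)], of "[]" 0] assms(3) by simp
  next
    case t': (Op g ts')
    have "\<phi> f = \<phi> g"
      using fun_cong[OF fun_cong[OF Op.prems(2)], of "[]" "\<phi> f + 2"] assms(3) t'
      by (auto split: if_splits)
    then have fg: "f = g"
      using assms(5) by (auto dest: injD)
    have "eval_term \<Sigma> A \<rho> (ts i) = eval_term \<Sigma> A \<rho> (ts' i)" if i: "i \<in> arity \<Sigma> f" for i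
    proof (rule Op.IH[OF i])
      show "ts' i \<in> terms_over \<Sigma> X"
        using Op.prems(1) i unfolding t' fg by (auto elim: terms_over.cases)
      show "term_code \<phi> \<iota> a b \<Sigma> (ts i) = term_code \<phi> \<iota> a b \<Sigma> (ts' i)"
      proof (intro ext)
        fix p k
        show "term_code \<phi> \<iota> a b \<Sigma> (ts i) p k = term_code \<phi> \<iota> a b \<Sigma> (ts' i) p k"
          using fun_cong[OF fun_cong[OF Op.prems(2)], of "i # p" k] i unfolding t' fg by simp
      qed
    qed
    then show ?thesis
      using t' fg by (auto intro!: arg_cong[where f = "interp A _"])
  qed
qed

lemma smallness_subset: "smallness \<S> \<Longrightarrow> X \<in> \<S> \<Longrightarrow> Y \<lesssim> X \<Longrightarrow> Y \<in> \<S>"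
  unfolding smallness_def by blast

text \<open>Nodes and label positions are countable in number, so a code is a sequence over a small
  set, and \<open>smallness\<close> bounds the set of such sequences.\<close>

lemma terms_small:
  fixes \<Sigma> :: "('f :: countable, 'i :: countable) signature" and X :: "'u set"
  assumes S: "smallness \<S>" and X: "X \<in> \<S>"
  obtains c :: "('f, 'i, 'u) trm \<Rightarrow> 'u" and Y where "Y \<in> \<S>" "c ` terms_over \<Sigma> X \<subseteq> Y"
    "\<And>s t A \<rho>. s \<in> terms_over \<Sigma> X \<Longrightarrow> t \<in> terms_over \<Sigma> X \<Longrightarrow> c s = c t \<Longrightarrow>
       eval_term \<Sigma> (A :: ('f, 'i, 'u) alg) \<rho> s = eval_term \<Sigma> A \<rho> t"
proof -
  obtain X0 where X0: "X0 \<in> \<S>" "infinite X0"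
    using S unfolding smallness_def by blast
  \<comment> \<open>X may have fewer than two elements, but codes need two distinct bits; X is
    therefore first embedded in an infinite small set.\<close>
  have "\<exists>Z \<in> \<S>. infinite Z \<and> X \<lesssim> Z"
  proof (cases "finite X")
    case True
    then have "X \<lesssim> X0"
      using X0 by (simp add: finite_lepoll_infinite)
    then show ?thesis
      using X0 by blast
  qed (use X in \<open>blast intro: lepoll_refl\<close>)
  then obtain Z \<iota> where Z: "Z \<in> \<S>" "infinite Z" "inj_on \<iota> X" "\<iota> ` X \<subseteq> Z"
    unfolding lepoll_def by blast
  obtain a where a: "a \<in> Z"
    using infinite_imp_nonempty[OF Z(2)] by blast
  obtain b where b: "b \<in> Z - {a}"
    using infinite_imp_nonempty[OF infinite_remove[OF Z(2)]] by blast
  have ab: "a \<in> Z" "b \<in> Z" "a \<noteq> b"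
    using a b by auto
  obtain Y g where Y: "Y \<in> \<S>" "inj_on g ((UNIV :: nat set) \<rightarrow>\<^sub>E Z)" "g ` ((UNIV :: nat set) \<rightarrow>\<^sub>E Z) \<subseteq> Y"
    using S Z(1) unfolding smallness_def lepoll_def by metis
  define code where "code t = (\<lambda>n :: nat. case_prod (term_code to_nat \<iota> a b \<Sigma> t) (from_nat n))"
    for t :: "('f, 'i, 'u) trm"
  have code: "code t \<in> UNIV \<rightarrow>\<^sub>E Z" if "t \<in> terms_over \<Sigma> X" for t
    using term_code_range[OF that ab(1,2) Z(4)] by (auto simp: code_def split: prod.split)
  show ?thesis
  proof (rule that[of Y "g \<circ> code"])
    show "Y \<in> \<S>" by (rule Y(1))
    show "(g \<circ> code) ` terms_over \<Sigma> X \<subseteq> Y"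
      using code Y(3) by fastforce
    fix s t \<rho> and A :: "('f, 'i, 'u) alg"
    assume st: "s \<in> terms_over \<Sigma> X" "t \<in> terms_over \<Sigma> X" "(g \<circ> code) s = (g \<circ> code) t"
    then have "code s = code t"
      using inj_onD[OF Y(2) _ code[OF st(1)] code[OF st(2)]] by simp
    then have "code s (to_nat (p, k)) = code t (to_nat (p, k))" for p :: "'i list" and k :: nat
      by simp
    then have "term_code to_nat \<iota> a b \<Sigma> s = term_code to_nat \<iota> a b \<Sigma> t"
      by (intro ext) (simp add: code_def)
    then show "eval_term \<Sigma> A \<rho> s = eval_term \<Sigma> A \<rho> t"
      using eval_eq_if_term_code_eq[OF st(1,2) ab(3) Z(3) inj_to_nat] by blast
  qed
qed

text \<open>The free algebra consists of the terms over X, identified when they agree in all models.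
  Its elements must belong to the type of X, so a class is represented by the code of a chosen term
  in it.\<close>

lemma free_algebra_exists:
  fixes \<Sigma> :: "('f :: countable, 'i :: countable) signature" and E :: "('f, 'i, 'v) equations"
    and X :: "'u set"
  assumes E: "\<forall>(s, t) \<in> E. sig_term \<Sigma> s \<and> sig_term \<Sigma> t" and S: "smallness \<S>" and X: "X \<in> \<S>"
  shows "\<exists>F \<eta>. free_algebra_over \<Sigma> (models \<S> \<Sigma> E) X F \<eta>"
proof -
  let ?T = "terms_over \<Sigma> X" and ?K = "models \<S> \<Sigma> E :: ('f, 'i, 'u) alg set"
  define eqv :: "('f, 'i, 'u) trm \<Rightarrow> ('f, 'i, 'u) trm \<Rightarrow> bool" where
    "eqv s t \<longleftrightarrow> (\<forall>A \<in> ?K. \<forall>\<rho>. \<rho> ` X \<subseteq> carrier A \<longrightarrow> eval_term \<Sigma> A \<rho> s = eval_term \<Sigma> A \<rho> t)" for s t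
  obtain c Y where c: "Y \<in> \<S>" "c ` ?T \<subseteq> Y"
    "\<And>s t A \<rho>. s \<in> ?T \<Longrightarrow> t \<in> ?T \<Longrightarrow> c s = c t \<Longrightarrow>
       eval_term \<Sigma> (A :: ('f, 'i, 'u) alg) \<rho> s = eval_term \<Sigma> A \<rho> t"
    by (rule terms_small[OF S X, of \<Sigma>]) blast
  \<comment> \<open>Choosing a term before coding makes \<open>\<kappa>\<close> constant on classes:
    equivalent terms give the same choice predicate, hence the same representative.\<close>
  define rep where "rep t = (SOME s. s \<in> ?T \<and> eqv s t)" for t
  define \<kappa> where "\<kappa> t = c (rep t)" for t
  have rep: "rep t \<in> ?T \<and> eqv (rep t) t" if "t \<in> ?T" for t
    unfolding rep_def by (rule someI[of _ t]) (use that in \<open>auto simp: eqv_def\<close>)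
  have \<kappa>_iff: "\<kappa> s = \<kappa> t \<longleftrightarrow> eqv s t" if st: "s \<in> ?T" "t \<in> ?T" for s t
  proof
    assume "\<kappa> s = \<kappa> t"
    then have "eqv (rep s) (rep t)"
      unfolding \<kappa>_def eqv_def using c(3) rep[OF st(1)] rep[OF st(2)] by blast
    then show "eqv s t"
      using rep[OF st(1)] rep[OF st(2)] unfolding eqv_def by metis
  next
    assume "eqv s t"
    then have "(\<lambda>r. r \<in> ?T \<and> eqv r s) = (\<lambda>r. r \<in> ?T \<and> eqv r t)"
      unfolding eqv_def by (intro ext) metis
    then show "\<kappa> s = \<kappa> t"
      unfolding \<kappa>_def rep_def by simp
  qed
  have \<kappa>_small: "\<kappa> ` ?T \<in> \<S>"
  proof (rule smallness_subset[OF S c(1)])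
    have "\<kappa> ` ?T \<subseteq> Y"
      using c(2) rep unfolding \<kappa>_def by blast
    then show "\<kappa> ` ?T \<lesssim> Y"
      by (rule subset_imp_lepoll)
  qed
  define rp where "rp = inv_into ?T \<kappa>"
  have rp: "rp x \<in> ?T" "\<kappa> (rp x) = x" if "x \<in> \<kappa> ` ?T" for x
    using that unfolding rp_def by (auto intro: inv_into_into f_inv_into_f)
  define F :: "('f, 'i, 'u) alg" where
    "F = \<lparr>carrier = \<kappa> ` ?T, interp = (\<lambda>f xs. \<kappa> (Op f (\<lambda>i. rp (xs i))))\<rparr>"
  have F_carrier [simp]: "carrier F = \<kappa> ` ?T"
    by (simp add: F_def)
  have Op_in: "Op f (\<lambda>i. rp (xs i)) \<in> ?T" if "f \<in> ops \<Sigma>" "xs \<in> arity \<Sigma> f \<rightarrow>\<^sub>E \<kappa> ` ?T" for f xs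
    using that rp by (auto intro!: terms_over.Op)
  have interp_F: "interp F f (\<lambda>i \<in> arity \<Sigma> f. \<kappa> (ts i)) = \<kappa> (Op f ts)"
    if "f \<in> ops \<Sigma>" "\<And>i. i \<in> arity \<Sigma> f \<Longrightarrow> ts i \<in> ?T" for f ts
  proof -
    have xs: "(\<lambda>i \<in> arity \<Sigma> f. \<kappa> (ts i)) \<in> arity \<Sigma> f \<rightarrow>\<^sub>E \<kappa> ` ?T"
      using that by auto
    have "eqv (rp (\<kappa> (ts i))) (ts i)" if "i \<in> arity \<Sigma> f" for i
      using \<kappa>_iff rp[of "\<kappa> (ts i)"] \<open>\<And>i. i \<in> arity \<Sigma> f \<Longrightarrow> ts i \<in> ?T\<close>[OF that] by blast
    then have "eqv (Op f (\<lambda>i. rp ((\<lambda>i \<in> arity \<Sigma> f. \<kappa> (ts i)) i))) (Op f ts)"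
      unfolding eqv_def by (auto intro!: arg_cong[where f = "interp _ f"])
    then show ?thesis
      using \<kappa>_iff[OF Op_in[OF that(1) xs] terms_over.Op[OF that]] by (simp add: F_def)
  qed
  \<comment> \<open>Evaluation in F is substitution of representing terms. It thereby reduces the
    equations of E in F to their instances in the models, where they hold.\<close>
  have eval_F: "eval_term \<Sigma> F \<rho> t = \<kappa> (subst_term (\<lambda>v. rp (\<rho> v)) t)"
    if "sig_term \<Sigma> t" "range \<rho> \<subseteq> carrier F" for \<rho> and t :: "('f, 'i, 'v) trm"
    using that
  proof (induction rule: sig_term.induct)
    case (1 v)
    then have "\<rho> v \<in> \<kappa> ` ?T"
      by auto
    then show ?case
      using rp(2) by simp
  next
    case (2 f ts)
    have rp\<rho>: "rp (\<rho> v) \<in> ?T" for v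
      using 2(4) by (intro rp(1)) auto
    have "eval_term \<Sigma> F \<rho> (Op f ts) = interp F f (\<lambda>i \<in> arity \<Sigma> f. \<kappa> (subst_term (\<lambda>v. rp (\<rho> v)) (ts i)))"
      using 2 by (auto intro!: arg_cong[where f = "interp F f"])
    also have "\<dots> = \<kappa> (Op f (\<lambda>i. subst_term (\<lambda>v. rp (\<rho> v)) (ts i)))"
      using 2 rp\<rho> by (intro interp_F subst_term_in) auto
    finally show ?case by simp
  qed
  have F_model: "F \<in> ?K"
    unfolding models_def
  proof (intro CollectI conjI)
    show "carrier F \<in> \<S>"
      using \<kappa>_small by simp
    show "sig_algebra \<Sigma> F"
      unfolding sig_algebra_def using Op_in by (auto simp: F_def)
    show "satisfies \<Sigma> F E"
      unfolding satisfies_def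
    proof safe
      fix s t and \<rho> :: "'v \<Rightarrow> 'u" assume st: "(s, t) \<in> E" and \<rho>: "range \<rho> \<subseteq> carrier F"
      have sig: "sig_term \<Sigma> s" "sig_term \<Sigma> t"
        using E st by auto
      have rp\<rho>: "rp (\<rho> v) \<in> ?T" for v
        using \<rho> by (intro rp(1)) auto
      have "eqv (subst_term (\<lambda>v. rp (\<rho> v)) s) (subst_term (\<lambda>v. rp (\<rho> v)) t)"
        unfolding eqv_def eval_subst_term
      proof safe
        fix A :: "('f, 'i, 'u) alg" and \<rho>' :: "'u \<Rightarrow> 'u" assume A: "A \<in> ?K" "\<rho>' ` X \<subseteq> carrier A"
        have "range (\<lambda>v. eval_term \<Sigma> A \<rho>' (rp (\<rho> v))) \<subseteq> carrier A"
          using eval_term_closed[OF rp\<rho> _ A(2)] A(1) by (auto simp: models_def)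
        then show "eval_term \<Sigma> A (\<lambda>v. eval_term \<Sigma> A \<rho>' (rp (\<rho> v))) s =
            eval_term \<Sigma> A (\<lambda>v. eval_term \<Sigma> A \<rho>' (rp (\<rho> v))) t"
          using A(1) st by (auto simp: models_def satisfies_def)
      qed
      then show "eval_term \<Sigma> F \<rho> s = eval_term \<Sigma> F \<rho> t"
        using eval_F[OF sig(1) \<rho>] eval_F[OF sig(2) \<rho>] \<kappa>_iff subst_term_in[OF sig(1) rp\<rho>]
          subst_term_in[OF sig(2) rp\<rho>] by simp
    qed
  qed
  have "free_algebra_over \<Sigma> ?K X F (\<lambda>x. \<kappa> (Var x))"
    unfolding free_algebra_over_def
  proof (intro conjI ballI)
    show "F \<in> ?K" by (rule F_model)
    show "(\<lambda>x. \<kappa> (Var x)) \<in> X \<rightarrow> carrier F"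
      by (auto intro: terms_over.Var)
    fix A g assume A: "A \<in> ?K" and g: "g \<in> X \<rightarrow> carrier A"
    then have gX: "g ` X \<subseteq> carrier A" and sA: "sig_algebra \<Sigma> A"
      by (auto simp: models_def)
    define h where "h = (\<lambda>x \<in> carrier F. eval_term \<Sigma> A g (rp x))"
    have h: "h (\<kappa> t) = eval_term \<Sigma> A g t" if t: "t \<in> ?T" for t
    proof -
      have "eqv (rp (\<kappa> t)) t"
        using \<kappa>_iff rp[of "\<kappa> t"] t by blast
      then show ?thesis
        using t A gX by (simp add: h_def eqv_def)
    qed
    have Op_restrict: "interp F f xs = \<kappa> (Op f (\<lambda>i. rp (xs i)))" for f xs
      by (simp add: F_def)
    show "\<exists>!h. h \<in> alg_hom \<Sigma> F A \<and> (\<forall>x \<in> X. h (\<kappa> (Var x)) = g x)"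
    proof (rule ex1I)
      show "h \<in> alg_hom \<Sigma> F A \<and> (\<forall>x \<in> X. h (\<kappa> (Var x)) = g x)"
        unfolding alg_hom_def
      proof (intro conjI CollectI ballI)
        show "h \<in> carrier F \<rightarrow>\<^sub>E carrier A"
          using eval_term_closed[OF _ sA gX] rp by (auto simp: h_def)
        show "h (\<kappa> (Var x)) = g x" if "x \<in> X" for x
          using h[OF terms_over.Var[OF that]] by simp
        fix f xs assume f: "f \<in> ops \<Sigma>" "xs \<in> arity \<Sigma> f \<rightarrow>\<^sub>E carrier F"
        have "h (interp F f xs) = interp A f (\<lambda>i \<in> arity \<Sigma> f. eval_term \<Sigma> A g (rp (xs i)))"
          using h[OF Op_in] f by (simp add: Op_restrict)
        also have "(\<lambda>i \<in> arity \<Sigma> f. eval_term \<Sigma> A g (rp (xs i))) = (\<lambda>i \<in> arity \<Sigma> f. h (xs i))"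
          using f by (auto simp: h_def PiE_iff intro!: restrict_ext)
        finally show "h (interp F f xs) = interp A f (\<lambda>i \<in> arity \<Sigma> f. h (xs i))" .
      qed
    next
      fix h' assume h': "h' \<in> alg_hom \<Sigma> F A \<and> (\<forall>x \<in> X. h' (\<kappa> (Var x)) = g x)"
      have "h' (\<kappa> t) = eval_term \<Sigma> A g t" if "t \<in> ?T" for t
        using that
      proof (induction rule: terms_over.induct)
        case (Var v)
        then show ?case using h' by simp
      next
        case (Op f ts)
        have "(\<lambda>i \<in> arity \<Sigma> f. \<kappa> (ts i)) \<in> arity \<Sigma> f \<rightarrow>\<^sub>E carrier F"
          using Op by auto
        then have "h' (\<kappa> (Op f ts)) = interp A f (\<lambda>i \<in> arity \<Sigma> f. h' ((\<lambda>i \<in> arity \<Sigma> f. \<kappa> (ts i)) i))"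
          using h' Op.hyps interp_F[OF Op.hyps] unfolding alg_hom_def by fastforce
        then show ?case
          using Op.IH by (auto intro!: arg_cong[where f = "interp A f"])
      qed
      then have "h' x = h x" if "x \<in> carrier F" for x
        using that h by auto
      moreover have "h' \<in> extensional (carrier F)" "h \<in> extensional (carrier F)"
        using h' by (auto simp: alg_hom_def h_def PiE_def)
      ultimately show "h' = h"
        by (meson extensionalityI)
    qed
  qed
  then show ?thesis by blast
qed

section \<open>Categories of algebras\<close>

lemma alg_hom_compose:
  assumes X: "sig_algebra \<Sigma> X" and f: "f \<in> alg_hom \<Sigma> X Y" and g: "g \<in> alg_hom \<Sigma> Y Z"
  shows "compose (carrier X) g f \<in> alg_hom \<Sigma> X Z"
  unfolding alg_hom_def
proof (intro CollectI conjI ballI)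
  have fX: "f x \<in> carrier Y" if "x \<in> carrier X" for x
    using f that by (auto simp: alg_hom_def)
  have gY: "g y \<in> carrier Z" if "y \<in> carrier Y" for y
    using g that by (auto simp: alg_hom_def)
  show "compose (carrier X) g f \<in> carrier X \<rightarrow>\<^sub>E carrier Z"
    using fX gY by (auto simp: compose_def)
  fix k xs assume k: "k \<in> ops \<Sigma>" "xs \<in> arity \<Sigma> k \<rightarrow>\<^sub>E carrier X"
  have "(\<lambda>i \<in> arity \<Sigma> k. f (xs i)) \<in> arity \<Sigma> k \<rightarrow>\<^sub>E carrier Y"
    using k fX by auto
  then have "g (f (interp X k xs)) = interp Z k (\<lambda>i \<in> arity \<Sigma> k. g ((\<lambda>i \<in> arity \<Sigma> k. f (xs i)) i))"
    using f g k unfolding alg_hom_def by simp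
  moreover have "(\<lambda>i \<in> arity \<Sigma> k. g ((\<lambda>i \<in> arity \<Sigma> k. f (xs i)) i)) =
      (\<lambda>i \<in> arity \<Sigma> k. compose (carrier X) g f (xs i))"
    using k by (auto simp: compose_def PiE_iff intro!: restrict_ext)
  ultimately show "compose (carrier X) g f (interp X k xs) =
      interp Z k (\<lambda>i \<in> arity \<Sigma> k. compose (carrier X) g f (xs i))"
    using interp_closed[OF X k] by (simp add: compose_def)
qed

lemma category_VAR: "category (VAR \<S> \<Sigma> E)"
proof
  fix X assume "X \<in> Obj (VAR \<S> \<Sigma> E)"
  then have X: "sig_algebra \<Sigma> X"
    by (simp add: VAR_def models_def)
  show "Id (VAR \<S> \<Sigma> E) X \<in> Hom (VAR \<S> \<Sigma> E) X X"
    unfolding VAR_def alg_hom_def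
  proof (simp, intro ballI)
    fix f xs assume f: "f \<in> ops \<Sigma>" "xs \<in> arity \<Sigma> f \<rightarrow>\<^sub>E carrier X"
    have "(\<lambda>i \<in> arity \<Sigma> f. if xs i \<in> carrier X then xs i else undefined) = xs"
      using f(2) by (auto simp: PiE_iff extensional_def fun_eq_iff)
    then show "(interp X f xs \<in> carrier X \<longrightarrow> interp X f xs =
          interp X f (\<lambda>i \<in> arity \<Sigma> f. if xs i \<in> carrier X then xs i else undefined)) \<and>
        (interp X f xs \<notin> carrier X \<longrightarrow> undefined =
          interp X f (\<lambda>i \<in> arity \<Sigma> f. if xs i \<in> carrier X then xs i else undefined))"
      using interp_closed[OF X f] by simp
  qed
next
  fix X Y Z f g
  assume "X \<in> Obj (VAR \<S> \<Sigma> E)" and fg: "f \<in> Hom (VAR \<S> \<Sigma> E) X Y" "g \<in> Hom (VAR \<S> \<Sigma> E) Y Z"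
  then have X: "sig_algebra \<Sigma> X" and f: "f \<in> alg_hom \<Sigma> X Y" and g: "g \<in> alg_hom \<Sigma> Y Z"
    by (simp_all add: VAR_def models_def)
  show "Comp (VAR \<S> \<Sigma> E) X Y Z g f \<in> Hom (VAR \<S> \<Sigma> E) X Z"
    using alg_hom_compose[OF X f g] by (simp add: VAR_def)
qed (auto simp: VAR_def alg_hom_def compose_def PiE_iff extensional_def fun_eq_iff)

lemma category_LFMV: "category (LFMV \<S>)"
proof
  fix X assume "X \<in> Obj (LFMV \<S>)"
  then interpret lf_mv X
    by (simp add: LFMV_def lf_mv_def lf_mv_axioms_def)
  show "Id (LFMV \<S>) X \<in> Hom (LFMV \<S>) X X"
    by (simp add: LFMV_def mv_hom_def)
next
  fix X Y Z f g
  assume X: "X \<in> Obj (LFMV \<S>)" and fg: "f \<in> Hom (LFMV \<S>) X Y" "g \<in> Hom (LFMV \<S>) Y Z"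
  then interpret lf_mv X
    by (simp add: LFMV_def lf_mv_def lf_mv_axioms_def)
  show "Comp (LFMV \<S>) X Y Z g f \<in> Hom (LFMV \<S>) X Z"
    using fg by (auto simp: LFMV_def mv_hom_def compose_def PiE_iff)
qed (auto simp: LFMV_def mv_hom_def compose_def PiE_iff extensional_def fun_eq_iff)

lemma isomorphism_sym: "isomorphism C X Y f \<Longrightarrow> \<exists>g. isomorphism C Y X g"
  unfolding isomorphism_def by blast

lemma bijective_alg_hom_isomorphism:
  assumes X: "X \<in> models \<S> \<Sigma> E" and Y: "Y \<in> models \<S> \<Sigma> E"
    and g: "g \<in> alg_hom \<Sigma> X Y" "bij_betw g (carrier X) (carrier Y)"
  shows "isomorphism (VAR \<S> \<Sigma> E) X Y g"
proof -
  have sX: "sig_algebra \<Sigma> X"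
    using X by (simp add: models_def)
  define h where "h = (\<lambda>y \<in> carrier Y. inv_into (carrier X) g y)"
  have hg: "h (g x) = x" if "x \<in> carrier X" for x
    using g that by (auto simp: h_def bij_betw_def)
  have gh: "h y \<in> carrier X" "g (h y) = y" if "y \<in> carrier Y" for y
    using g that by (auto simp: h_def bij_betw_def inv_into_into f_inv_into_f)
  have "h \<in> alg_hom \<Sigma> Y X"
    unfolding alg_hom_def
  proof (intro CollectI conjI ballI)
    show "h \<in> carrier Y \<rightarrow>\<^sub>E carrier X"
      using gh by (auto simp: h_def)
    fix f ys assume f: "f \<in> ops \<Sigma>" "ys \<in> arity \<Sigma> f \<rightarrow>\<^sub>E carrier Y"
    have xs: "(\<lambda>i \<in> arity \<Sigma> f. h (ys i)) \<in> arity \<Sigma> f \<rightarrow>\<^sub>E carrier X"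
      using f gh by auto
    have "(\<lambda>i \<in> arity \<Sigma> f. g ((\<lambda>i \<in> arity \<Sigma> f. h (ys i)) i)) = ys"
      using f(2) gh by (auto simp: PiE_iff extensional_def fun_eq_iff)
    then have "g (interp X f (\<lambda>i \<in> arity \<Sigma> f. h (ys i))) = interp Y f ys"
      using g(1) f(1) xs unfolding alg_hom_def by auto
    then show "h (interp Y f ys) = interp X f (\<lambda>i \<in> arity \<Sigma> f. h (ys i))"
      using hg[OF interp_closed[OF sX f(1) xs]] by simp
  qed
  moreover have "compose (carrier X) h g = (\<lambda>x \<in> carrier X. x)"
    using hg by (auto simp: compose_def)
  moreover have "compose (carrier Y) g h = (\<lambda>y \<in> carrier Y. y)"
    using gh by (auto simp: compose_def)
  ultimately show ?thesis
    using g(1) unfolding isomorphism_def VAR_def by auto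
qed

text \<open>Transport of structure along an injection. It moves sequence algebras, whose elements
  are functions, onto the type on which the objects of the category live.\<close>

definition copy_alg :: "('f, 'i) signature \<Rightarrow> ('a \<Rightarrow> 'b) \<Rightarrow> ('f, 'i, 'a) alg \<Rightarrow> ('f, 'i, 'b) alg" where
  "copy_alg \<Sigma> \<kappa> B = \<lparr>carrier = \<kappa> ` carrier B,
     interp = (\<lambda>f xs. \<kappa> (interp B f (\<lambda>i \<in> arity \<Sigma> f. inv_into (carrier B) \<kappa> (xs i))))\<rparr>"

lemma carrier_copy_alg [simp]: "carrier (copy_alg \<Sigma> \<kappa> B) = \<kappa> ` carrier B"
  by (simp add: copy_alg_def)

lemma interp_copy_alg:
  assumes "inj_on \<kappa> (carrier B)" "\<And>i. i \<in> arity \<Sigma> f \<Longrightarrow> xs i \<in> carrier B"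
  shows "interp (copy_alg \<Sigma> \<kappa> B) f (\<lambda>i \<in> arity \<Sigma> f. \<kappa> (xs i)) =
    \<kappa> (interp B f (\<lambda>i \<in> arity \<Sigma> f. xs i))"
proof -
  have "(\<lambda>i \<in> arity \<Sigma> f. inv_into (carrier B) \<kappa> ((\<lambda>i \<in> arity \<Sigma> f. \<kappa> (xs i)) i)) = (\<lambda>i \<in> arity \<Sigma> f. xs i)"
    using assms by (auto intro!: restrict_ext)
  then show ?thesis
    by (simp add: copy_alg_def)
qed

lemma copy_alg_args:
  assumes "xs \<in> I \<rightarrow>\<^sub>E \<kappa> ` C"
  obtains ys where "ys \<in> I \<rightarrow>\<^sub>E C" "xs = (\<lambda>i \<in> I. \<kappa> (ys i))"
proof
  show "(\<lambda>i \<in> I. inv_into C \<kappa> (xs i)) \<in> I \<rightarrow>\<^sub>E C"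
    using assms by (auto intro!: inv_into_into)
  show "xs = (\<lambda>i \<in> I. \<kappa> ((\<lambda>i \<in> I. inv_into C \<kappa> (xs i)) i))"
    using assms by (auto simp: PiE_iff extensional_def f_inv_into_f fun_eq_iff)
qed

lemma sig_algebra_copy:
  assumes "sig_algebra \<Sigma> B" "inj_on \<kappa> (carrier B)"
  shows "sig_algebra \<Sigma> (copy_alg \<Sigma> \<kappa> B)"
  unfolding sig_algebra_def
proof (intro ballI funcsetI)
  fix f xs assume f: "f \<in> ops \<Sigma>" and "xs \<in> arity \<Sigma> f \<rightarrow>\<^sub>E carrier (copy_alg \<Sigma> \<kappa> B)"
  then obtain ys where ys: "ys \<in> arity \<Sigma> f \<rightarrow>\<^sub>E carrier B" "xs = (\<lambda>i \<in> arity \<Sigma> f. \<kappa> (ys i))"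
    using copy_alg_args[of xs "arity \<Sigma> f" \<kappa> "carrier B"] by auto
  have "interp (copy_alg \<Sigma> \<kappa> B) f xs = \<kappa> (interp B f (restrict ys (arity \<Sigma> f)))"
    unfolding ys(2) using ys(1) by (intro interp_copy_alg assms) auto
  moreover have "interp B f (restrict ys (arity \<Sigma> f)) \<in> carrier B"
    using ys by (intro interp_closed[OF assms(1) f]) auto
  ultimately show "interp (copy_alg \<Sigma> \<kappa> B) f xs \<in> carrier (copy_alg \<Sigma> \<kappa> B)"
    by simp
qed

lemma copy_hom:
  assumes "sig_algebra \<Sigma> B" "inj_on \<kappa> (carrier B)"
  shows "(\<lambda>x \<in> carrier B. \<kappa> x) \<in> alg_hom \<Sigma> B (copy_alg \<Sigma> \<kappa> B)"
  unfolding alg_hom_def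
proof (intro CollectI conjI ballI)
  fix f xs assume f: "f \<in> ops \<Sigma>" and xs: "xs \<in> arity \<Sigma> f \<rightarrow>\<^sub>E carrier B"
  have "(\<lambda>i \<in> arity \<Sigma> f. (\<lambda>x \<in> carrier B. \<kappa> x) (xs i)) = (\<lambda>i \<in> arity \<Sigma> f. \<kappa> (xs i))"
    using xs by (auto intro!: restrict_ext)
  moreover have "restrict xs (arity \<Sigma> f) = xs"
    using xs by (auto simp: PiE_iff extensional_restrict)
  ultimately show "(\<lambda>x \<in> carrier B. \<kappa> x) (interp B f xs) =
      interp (copy_alg \<Sigma> \<kappa> B) f (\<lambda>i \<in> arity \<Sigma> f. (\<lambda>x \<in> carrier B. \<kappa> x) (xs i))"
    using interp_copy_alg[OF assms(2) PiE_mem[OF xs]] interp_closed[OF assms(1) f xs] by simp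
qed auto

lemma eval_copy:
  assumes "sig_algebra \<Sigma> B" "inj_on \<kappa> (carrier B)" "\<And>v. \<rho> v \<in> carrier B" "sig_term \<Sigma> t"
  shows "eval_term \<Sigma> (copy_alg \<Sigma> \<kappa> B) (\<lambda>v. \<kappa> (\<rho> v)) t = \<kappa> (eval_term \<Sigma> B \<rho> t) \<and>
    eval_term \<Sigma> B \<rho> t \<in> carrier B"
  using assms(4)
proof (induction rule: sig_term.induct)
  case (2 f ts)
  have "(\<lambda>i \<in> arity \<Sigma> f. eval_term \<Sigma> (copy_alg \<Sigma> \<kappa> B) (\<lambda>v. \<kappa> (\<rho> v)) (ts i)) =
      (\<lambda>i \<in> arity \<Sigma> f. \<kappa> (eval_term \<Sigma> B \<rho> (ts i)))"
    using 2 by (auto intro!: restrict_ext)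
  then show ?case
    using interp_copy_alg[OF assms(2), of \<Sigma> f "\<lambda>i. eval_term \<Sigma> B \<rho> (ts i)"] 2
      interp_closed[OF assms(1) 2(1), of "\<lambda>i \<in> arity \<Sigma> f. eval_term \<Sigma> B \<rho> (ts i)"]
    by auto
qed (use assms in auto)

lemma satisfies_copy:
  fixes \<Sigma> :: "('a, 'b) signature" and B :: "('a, 'b, 'c) alg" and E :: "('a, 'b, 'd) equations"
    and \<kappa> :: "'c \<Rightarrow> 'e"
  assumes "sig_algebra \<Sigma> B" "inj_on \<kappa> (carrier B)" "satisfies \<Sigma> B E"
    "\<forall>(s, t) \<in> E. sig_term \<Sigma> s \<and> sig_term \<Sigma> t"
  shows "satisfies \<Sigma> (copy_alg \<Sigma> \<kappa> B) E"
  unfolding satisfies_def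
proof safe
  fix s t :: "('a, 'b, 'd) trm" and \<rho> :: "'d \<Rightarrow> 'e"
  assume st: "(s, t) \<in> E" and \<rho>: "range \<rho> \<subseteq> carrier (copy_alg \<Sigma> \<kappa> B)"
  define \<sigma> where "\<sigma> v = inv_into (carrier B) \<kappa> (\<rho> v)" for v
  have \<sigma>: "\<sigma> v \<in> carrier B" "\<rho> v = \<kappa> (\<sigma> v)" for v
  proof -
    have "\<rho> v \<in> \<kappa> ` carrier B"
      using \<rho> by auto
    then show "\<sigma> v \<in> carrier B" "\<rho> v = \<kappa> (\<sigma> v)"
      by (simp_all add: \<sigma>_def inv_into_into f_inv_into_f)
  qed
  have "\<rho> = (\<lambda>v. \<kappa> (\<sigma> v))"
    using \<sigma>(2) by blast
  moreover have "range \<sigma> \<subseteq> carrier B"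
    using \<sigma>(1) by auto
  then have "eval_term \<Sigma> B \<sigma> s = eval_term \<Sigma> B \<sigma> t"
    using assms(3) st by (auto simp: satisfies_def)
  moreover have "sig_term \<Sigma> s" "sig_term \<Sigma> t"
    using assms(4) st by auto
  ultimately show "eval_term \<Sigma> (copy_alg \<Sigma> \<kappa> B) \<rho> s = eval_term \<Sigma> (copy_alg \<Sigma> \<kappa> B) \<rho> t"
    using eval_copy[OF assms(1,2), of \<sigma> s] eval_copy[OF assms(1,2), of \<sigma> t] \<sigma>(1) by simp
qed

section \<open>Sequences of elements with bounded denominators\<close>

text \<open>Symbols 0, 1, 2 are zero, negation and sum, symbol 3 is the diagonal, symbol 4 the
  inclusions and symbol 5 the retractions between neighbouring levels.\<close>

definition lf_sig :: "(nat, nat) signature" where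
  "lf_sig = \<lparr>ops = {..5}, arity = (\<lambda>f. if f = 0 then {} else if f = 2 then {0, 1}
     else if f = 3 then UNIV else {0})\<rparr>"

lemma ops_lf_sig [simp]: "f \<in> ops lf_sig \<longleftrightarrow> f \<le> 5"
  by (simp add: lf_sig_def)

lemma arity_lf_sig [simp]:
  "arity lf_sig 0 = {}" "arity lf_sig (Suc 0) = {0}" "arity lf_sig 2 = {0, 1}"
  "arity lf_sig 3 = UNIV" "arity lf_sig 4 = {0}" "arity lf_sig 5 = {0}"
  by (simp_all add: lf_sig_def)

definition zop :: "(nat, nat, 'a) alg \<Rightarrow> 'a" where
  "zop B = interp B 0 (\<lambda>_. undefined)"
definition nop :: "(nat, nat, 'a) alg \<Rightarrow> 'a \<Rightarrow> 'a" where
  "nop B x = interp B (Suc 0) (\<lambda>i \<in> {0}. x)"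
definition pop :: "(nat, nat, 'a) alg \<Rightarrow> 'a \<Rightarrow> 'a \<Rightarrow> 'a" where
  "pop B x y = interp B 2 (\<lambda>i \<in> {0, 1}. if i = 0 then x else y)"
definition dop :: "(nat, nat, 'a) alg \<Rightarrow> (nat \<Rightarrow> 'a) \<Rightarrow> 'a" where
  "dop B xs = interp B 3 xs"
definition uop :: "(nat, nat, 'a) alg \<Rightarrow> 'a \<Rightarrow> 'a" where
  "uop B x = interp B 4 (\<lambda>i \<in> {0}. x)"
definition wop :: "(nat, nat, 'a) alg \<Rightarrow> 'a \<Rightarrow> 'a" where
  "wop B x = interp B 5 (\<lambda>i \<in> {0}. x)"

lemmas op_defs = zop_def nop_def pop_def dop_def uop_def wop_def

definition mv_of :: "(nat, nat, 'a) alg \<Rightarrow> 'a mv" where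
  "mv_of B = \<lparr>carrier = carrier B, mv_plus = pop B, mv_neg = nop B, mv_zero = zop B\<rparr>"

lemma mv_of_simps [simp]:
  "carrier (mv_of B) = carrier B" "mv_plus (mv_of B) = pop B" "mv_neg (mv_of B) = nop B"
  "mv_zero (mv_of B) = zop B"
  by (simp_all add: mv_of_def)

lemma op_closed:
  assumes "sig_algebra lf_sig B"
  shows "zop B \<in> carrier B" "x \<in> carrier B \<Longrightarrow> nop B x \<in> carrier B"
    "x \<in> carrier B \<Longrightarrow> y \<in> carrier B \<Longrightarrow> pop B x y \<in> carrier B"
    "(\<And>i. xs i \<in> carrier B) \<Longrightarrow> dop B xs \<in> carrier B"
    "x \<in> carrier B \<Longrightarrow> uop B x \<in> carrier B" "x \<in> carrier B \<Longrightarrow> wop B x \<in> carrier B"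
  unfolding op_defs by (rule interp_closed[OF assms]; auto)+

lemma lf_sig_args:
  assumes "f \<in> ops lf_sig" "xs \<in> arity lf_sig f \<rightarrow>\<^sub>E C"
  obtains "f = 0" "xs = (\<lambda>_. undefined)"
  | x where "f = Suc 0" "x \<in> C" "xs = (\<lambda>i \<in> {0}. x)"
  | x y where "f = 2" "x \<in> C" "y \<in> C" "xs = (\<lambda>i \<in> {0, 1}. if i = 0 then x else y)"
  | "f = 3" "\<And>i. xs i \<in> C"
  | x where "f = 4" "x \<in> C" "xs = (\<lambda>i \<in> {0}. x)"
  | x where "f = 5" "x \<in> C" "xs = (\<lambda>i \<in> {0}. x)"
proof -
  have unary: "xs 0 \<in> C" "xs = (\<lambda>i \<in> {0}. xs 0)" if "arity lf_sig f = {0}"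
    using assms(2) unfolding that by (auto simp: PiE_iff extensional_def fun_eq_iff)
  have "f \<le> 5"
    using assms(1) by simp
  then consider "f = 0" | "f = Suc 0" | "f = 2" | "f = 3" | "f = 4" | "f = 5"
    by linarith
  then show ?thesis
  proof cases
    case 1
    then show ?thesis
      using assms(2) by (intro that(1)) auto
  next
    case 2
    then show ?thesis
      using unary by (intro that(2)) auto
  next
    case 3
    then have xs: "xs \<in> {0, 1} \<rightarrow>\<^sub>E C"
      using assms(2) by simp
    have "xs = (\<lambda>i \<in> {0, 1}. if i = 0 then xs 0 else xs 1)"
      using xs by (auto simp: PiE_iff extensional_def fun_eq_iff)
    then show ?thesis
      using xs by (intro that(3)[OF 3]) auto
  next
    case 4
    then show ?thesis
      using assms(2) by (intro that(4)) auto
  next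
    case 5
    then show ?thesis
      using unary by (intro that(5)) auto
  next
    case 6
    then show ?thesis
      using unary by (intro that(6)) auto
  qed
qed

lemma sig_algebra_lf_sigI:
  assumes "zop B \<in> carrier B" "\<And>x. x \<in> carrier B \<Longrightarrow> nop B x \<in> carrier B"
    "\<And>x y. x \<in> carrier B \<Longrightarrow> y \<in> carrier B \<Longrightarrow> pop B x y \<in> carrier B"
    "\<And>xs. (\<And>i. xs i \<in> carrier B) \<Longrightarrow> dop B xs \<in> carrier B"
    "\<And>x. x \<in> carrier B \<Longrightarrow> uop B x \<in> carrier B" "\<And>x. x \<in> carrier B \<Longrightarrow> wop B x \<in> carrier B"
  shows "sig_algebra lf_sig B"
  unfolding sig_algebra_def
proof (intro ballI funcsetI)
  fix f xs assume "f \<in> ops lf_sig" "xs \<in> arity lf_sig f \<rightarrow>\<^sub>E carrier B"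
  then show "interp B f xs \<in> carrier B"
    by (rule lf_sig_args) (use assms in \<open>simp_all add: op_defs\<close>)
qed

lemma alg_hom_ops:
  assumes h: "h \<in> alg_hom lf_sig B C"
  shows "h (zop B) = zop C" "x \<in> carrier B \<Longrightarrow> h (nop B x) = nop C (h x)"
    "x \<in> carrier B \<Longrightarrow> y \<in> carrier B \<Longrightarrow> h (pop B x y) = pop C (h x) (h y)"
    "(\<And>i. xs i \<in> carrier B) \<Longrightarrow> h (dop B xs) = dop C (\<lambda>i. h (xs i))"
    "x \<in> carrier B \<Longrightarrow> h (uop B x) = uop C (h x)"
    "x \<in> carrier B \<Longrightarrow> h (wop B x) = wop C (h x)"
    "x \<in> carrier B \<Longrightarrow> h x \<in> carrier C"
proof -
  have *: "h (interp B f xs) = interp C f (\<lambda>i \<in> arity lf_sig f. h (xs i))"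
    if "f \<le> 5" "xs \<in> arity lf_sig f \<rightarrow>\<^sub>E carrier B" for f xs
    using h that unfolding alg_hom_def by simp
  show "h (zop B) = zop C"
    unfolding op_defs by (subst *) (auto simp: restrict_def)
  show "h (nop B x) = nop C (h x)" if "x \<in> carrier B"
    unfolding op_defs by (subst *) (use that in \<open>auto intro!: arg_cong[where f = "interp C _"]\<close>)
  show "h (pop B x y) = pop C (h x) (h y)" if "x \<in> carrier B" "y \<in> carrier B"
    unfolding op_defs by (subst *) (use that in \<open>auto intro!: arg_cong[where f = "interp C _"]\<close>)
  show "h (dop B xs) = dop C (\<lambda>i. h (xs i))" if "\<And>i. xs i \<in> carrier B"
    unfolding op_defs by (subst *) (use that in \<open>auto simp: restrict_def\<close>)
  show "h (uop B x) = uop C (h x)" if "x \<in> carrier B"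
    unfolding op_defs by (subst *) (use that in \<open>auto intro!: arg_cong[where f = "interp C _"]\<close>)
  show "h (wop B x) = wop C (h x)" if "x \<in> carrier B"
    unfolding op_defs by (subst *) (use that in \<open>auto intro!: arg_cong[where f = "interp C _"]\<close>)
  show "h x \<in> carrier C" if "x \<in> carrier B"
    using h that by (auto simp: alg_hom_def)
qed

lemma alg_hom_lf_sigI:
  assumes "h \<in> carrier B \<rightarrow>\<^sub>E carrier C"
    and z: "h (zop B) = zop C" and n: "\<And>x. x \<in> carrier B \<Longrightarrow> h (nop B x) = nop C (h x)"
    and p: "\<And>x y. x \<in> carrier B \<Longrightarrow> y \<in> carrier B \<Longrightarrow> h (pop B x y) = pop C (h x) (h y)"
    and d: "\<And>xs. (\<And>i. xs i \<in> carrier B) \<Longrightarrow> h (dop B xs) = dop C (\<lambda>i. h (xs i))"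
    and u: "\<And>x. x \<in> carrier B \<Longrightarrow> h (uop B x) = uop C (h x)"
    and w: "\<And>x. x \<in> carrier B \<Longrightarrow> h (wop B x) = wop C (h x)"
  shows "h \<in> alg_hom lf_sig B C"
  unfolding alg_hom_def
proof (intro CollectI conjI ballI)
  show "h \<in> carrier B \<rightarrow>\<^sub>E carrier C" by fact
  fix f xs assume "f \<in> ops lf_sig" "xs \<in> arity lf_sig f \<rightarrow>\<^sub>E carrier B"
  then show "h (interp B f xs) = interp C f (\<lambda>i \<in> arity lf_sig f. h (xs i))"
  proof (rule lf_sig_args)
    assume "f = 0" "xs = (\<lambda>_. undefined)"
    then show ?thesis using z by (simp add: zop_def restrict_def)
  next
    fix x assume "f = Suc 0" "x \<in> carrier B" "xs = (\<lambda>i \<in> {0}. x)"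
    then show ?thesis using n[of x] by (simp add: nop_def cong: restrict_cong)
  next
    fix x y assume *: "f = 2" "x \<in> carrier B" "y \<in> carrier B"
      "xs = (\<lambda>i \<in> {0, 1}. if i = 0 then x else y)"
    have "(\<lambda>i \<in> {0, 1}. h (xs i)) = (\<lambda>i \<in> {0, 1}. if i = 0 then h x else h y)"
      using * by (auto intro!: restrict_ext)
    then show ?thesis using p[of x y] * by (simp add: pop_def)
  next
    assume "f = 3" "\<And>i. xs i \<in> carrier B"
    then show ?thesis using d[of xs] by (simp add: dop_def restrict_def)
  next
    fix x assume "f = 4" "x \<in> carrier B" "xs = (\<lambda>i \<in> {0}. x)"
    then show ?thesis using u[of x] by (simp add: uop_def cong: restrict_cong)
  next
    fix x assume "f = 5" "x \<in> carrier B" "xs = (\<lambda>i \<in> {0}. x)"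
    then show ?thesis using w[of x] by (simp add: wop_def cong: restrict_cong)
  qed
qed

text \<open>The product of all levels. Symbol 4 views entry n as entry n + 1, with zero at the
  vacant place 0; symbol 5 retracts entry n + 1 to entry n.\<close>

definition seq_alg :: "'a mv \<Rightarrow> (nat, nat, nat \<Rightarrow> 'a) alg" where
  "seq_alg A = \<lparr>carrier = {x. \<forall>n. x n \<in> lvl A n},
     interp = (\<lambda>f xs. if f = 0 then (\<lambda>_. mv_zero A)
       else if f = 1 then (\<lambda>n. mv_neg A (xs 0 n))
       else if f = 2 then (\<lambda>n. mv_plus A (xs 0 n) (xs 1 n))
       else if f = 3 then (\<lambda>n. xs n n)
       else if f = 4 then case_nat (mv_zero A) (xs 0)
       else (\<lambda>n. rtr A n (Suc n) (xs 0 (Suc n))))\<rparr>"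

lemma seq_alg_simps [simp]:
  "x \<in> carrier (seq_alg A) \<longleftrightarrow> (\<forall>n. x n \<in> lvl A n)"
  "zop (seq_alg A) = (\<lambda>_. mv_zero A)"
  "nop (seq_alg A) x = (\<lambda>n. mv_neg A (x n))"
  "pop (seq_alg A) x y = (\<lambda>n. mv_plus A (x n) (y n))"
  "dop (seq_alg A) xs = (\<lambda>n. xs n n)"
  "uop (seq_alg A) x = case_nat (mv_zero A) x"
  "wop (seq_alg A) x = (\<lambda>n. rtr A n (Suc n) (x (Suc n)))"
  by (simp_all add: op_defs seq_alg_def)

lemma ev_seq_alg: "ev (mv_of (seq_alg A)) \<rho> t n = ev A (\<lambda>i. \<rho> i n) t"
  by (induction t) auto

lemma uop_pow_seq: "(uop (seq_alg A) ^^ j) x k = (if k < j then mv_zero A else x (k - j))"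
  by (induction j arbitrary: k) (auto split: nat.split)

context lf_mv
begin

lemma lvl_ops [simp]:
  "\<zero>\<^sub>M \<in> lvl A n" "x \<in> lvl A n \<Longrightarrow> \<sim> x \<in> lvl A n"
  "x \<in> lvl A n \<Longrightarrow> y \<in> lvl A n \<Longrightarrow> x \<oplus>\<^sub>M y \<in> lvl A n"
  using lvl_subuniverse[of n] by (auto simp: mv_subuniverse_def)

lemma sig_algebra_seq: "sig_algebra lf_sig (seq_alg A)"
  using lvl_mono[OF le_SucI[OF order_refl]]
  by (intro sig_algebra_lf_sigI) (auto split: nat.split intro: rtr_in_lvl)

lemma wop_pow_seq:
  "x \<in> carrier (seq_alg A) \<Longrightarrow> (wop (seq_alg A) ^^ j) x n = rtr A n (n + j) (x (n + j))"
proof (induction j arbitrary: n)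
  case 0
  then show ?case by (simp add: rtr_eq)
next
  case (Suc j)
  then show ?case by (simp add: rtr_rtr)
qed

end

definition lift_hom :: "'a mv \<Rightarrow> ('a \<Rightarrow> 'b) \<Rightarrow> (nat \<Rightarrow> 'a) \<Rightarrow> nat \<Rightarrow> 'b" where
  "lift_hom A h = (\<lambda>x \<in> carrier (seq_alg A). \<lambda>n. h (x n))"

lemma mv_hom_lvl:
  assumes "lf_mv A" "h \<in> mv_hom A B" "x \<in> lvl A n"
  shows "h x \<in> lvl B n"
proof -
  interpret A: lf_mv A by fact
  have "h (ev A (\<lambda>_. x) (defect n)) = ev B (\<lambda>_. h x) (defect n)"
    using assms A.lvl_closed by (intro mv_hom_ev[OF A.carrier_subuniverse]) auto
  then show ?thesis
    using assms by (auto simp: lvl_def mv_hom_def)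
qed

lemma lift_hom_in:
  assumes A: "lf_mv A" and h: "h \<in> mv_hom A B"
  shows "lift_hom A h \<in> alg_hom lf_sig (seq_alg A) (seq_alg B)"
proof -
  interpret A: lf_mv A by fact
  note closed = op_closed[OF A.sig_algebra_seq]
  have hz: "h (mv_zero A) = mv_zero B" and hn: "\<And>x. x \<in> carrier A \<Longrightarrow> h (mv_neg A x) = mv_neg B (h x)"
    and hp: "\<And>x y. x \<in> carrier A \<Longrightarrow> y \<in> carrier A \<Longrightarrow> h (mv_plus A x y) = mv_plus B (h x) (h y)"
    using h by (auto simp: mv_hom_def)
  have hr: "h (rtr A n m x) = rtr B n m (h x)" if "x \<in> carrier A" for n m x
    unfolding rtr_def using that by (intro mv_hom_ev[OF A.carrier_subuniverse h])
  have L: "lift_hom A h x = (\<lambda>n. h (x n))" if "x \<in> carrier (seq_alg A)" for x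
    using that by (simp add: lift_hom_def del: seq_alg_simps)
  show ?thesis
  proof (rule alg_hom_lf_sigI)
    show "lift_hom A h \<in> carrier (seq_alg A) \<rightarrow>\<^sub>E carrier (seq_alg B)"
      using mv_hom_lvl[OF A h] by (auto simp: lift_hom_def)
    show "lift_hom A h (zop (seq_alg A)) = zop (seq_alg B)"
      unfolding L[OF closed(1)] by (simp add: hz)
    fix x assume x: "x \<in> carrier (seq_alg A)"
    then have xc: "x n \<in> carrier A" for n
      using A.lvl_closed by auto
    show "lift_hom A h (nop (seq_alg A) x) = nop (seq_alg B) (lift_hom A h x)"
      unfolding L[OF closed(2)[OF x]] L[OF x] by (simp add: hn xc)
    show "lift_hom A h (uop (seq_alg A) x) = uop (seq_alg B) (lift_hom A h x)"
      unfolding L[OF closed(5)[OF x]] L[OF x] by (auto simp: hz split: nat.split)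
    show "lift_hom A h (wop (seq_alg A) x) = wop (seq_alg B) (lift_hom A h x)"
      unfolding L[OF closed(6)[OF x]] L[OF x] by (simp add: hr xc)
    fix y assume y: "y \<in> carrier (seq_alg A)"
    then have yc: "y n \<in> carrier A" for n
      using A.lvl_closed by auto
    show "lift_hom A h (pop (seq_alg A) x y) = pop (seq_alg B) (lift_hom A h x) (lift_hom A h y)"
      unfolding L[OF closed(3)[OF x y]] L[OF x] L[OF y] by (simp add: hp xc yc)
  next
    fix xs :: "nat \<Rightarrow> nat \<Rightarrow> 'a" assume xs: "\<And>i. xs i \<in> carrier (seq_alg A)"
    show "lift_hom A h (dop (seq_alg A) xs) = dop (seq_alg B) (\<lambda>i. lift_hom A h (xs i))"
      unfolding L[OF closed(4)[OF xs]] L[OF xs] by simp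
  qed
qed

text \<open>Commuting with the diagonal forces a homomorphism of sequence algebras to act entry by
  entry, and commuting with the shift makes the entry maps agree on smaller levels. They glue to a
  map on the union of the levels.\<close>

lemma lift_hom_bij:
  assumes A: "lf_mv A" and B: "lf_mv B"
  shows "bij_betw (lift_hom A) (mv_hom A B) (alg_hom lf_sig (seq_alg A) (seq_alg B))"
  unfolding bij_betw_def
proof
  interpret A: lf_mv A by fact
  interpret B: lf_mv B by fact
  define \<delta> where "\<delta> n a = (\<lambda>k. if k = n then a else mv_zero A)" for n :: nat and a
  have \<delta>: "\<delta> n a \<in> carrier (seq_alg A)" if "a \<in> lvl A n" for n a
    using that by (simp add: \<delta>_def)
  show "inj_on (lift_hom A) (mv_hom A B)"
  proof (rule inj_onI)
    fix h k assume hk: "h \<in> mv_hom A B" "k \<in> mv_hom A B" "lift_hom A h = lift_hom A k"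
    have "h a = k a" if a: "a \<in> carrier A" for a
    proof -
      obtain n where n: "a \<in> lvl A n"
        by (rule A.lvl_exhaust[OF a])
      have "lift_hom A h (\<delta> n a) n = lift_hom A k (\<delta> n a) n"
        using hk(3) by simp
      then show ?thesis
        using \<delta>[OF n] by (simp add: lift_hom_def \<delta>_def)
    qed
    moreover have "h \<in> extensional (carrier A)" "k \<in> extensional (carrier A)"
      using hk by (auto simp: mv_hom_def PiE_def)
    ultimately show "h = k"
      by (meson extensionalityI)
  qed
  show "lift_hom A ` mv_hom A B = alg_hom lf_sig (seq_alg A) (seq_alg B)"
  proof (intro equalityI subsetI)
    fix g assume "g \<in> lift_hom A ` mv_hom A B"
    then show "g \<in> alg_hom lf_sig (seq_alg A) (seq_alg B)"
      using lift_hom_in[OF A] by auto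
  next
    fix g assume g: "g \<in> alg_hom lf_sig (seq_alg A) (seq_alg B)"
    note gops = alg_hom_ops[OF g]
    define \<gamma> where "\<gamma> n a = g (\<delta> n a) n" for n a
    have g_\<gamma>: "g x n = \<gamma> n (x n)" if x: "x \<in> carrier (seq_alg A)" for x n
    proof -
      let ?xs = "\<lambda>k. if k = n then x else zop (seq_alg A)"
      \<comment> \<open>The diagonal of x at place n and zero elsewhere keeps only entry n of x.
        Applying g shows that entry n of \<open>g x\<close> depends on \<open>x n\<close>
        alone.\<close>
      have "\<delta> n (x n) = dop (seq_alg A) ?xs"
        by (auto simp: \<delta>_def)
      moreover have "g (dop (seq_alg A) ?xs) = dop (seq_alg B) (\<lambda>k. g (?xs k))"
        using x by (intro gops(4)) auto
      ultimately show ?thesis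
        by (simp add: \<gamma>_def)
    qed
    have \<gamma>_Suc: "\<gamma> (Suc n) a = \<gamma> n a" if a: "a \<in> lvl A n" for n a
    proof -
      have "uop (seq_alg A) (\<delta> n a) = \<delta> (Suc n) a"
        by (auto simp: \<delta>_def split: nat.split)
      then have "g (\<delta> (Suc n) a) = uop (seq_alg B) (g (\<delta> n a))"
        using gops(5)[OF \<delta>[OF a]] by simp
      then show ?thesis
        by (simp add: \<gamma>_def)
    qed
    have \<gamma>_mono: "\<gamma> m a = \<gamma> n a" if "n \<le> m" "a \<in> lvl A n" for n m a
      using that
    proof (induction m rule: dec_induct)
      case (step m)
      then show ?case
        using \<gamma>_Suc[of a m] A.lvl_mono[of n m a] by simp
    qed simp
    \<comment> \<open>Any level containing a would do, by \<open>\<gamma>_mono\<close>; the least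
      one is a mere choice.\<close>
    define h where "h = (\<lambda>a \<in> carrier A. \<gamma> (LEAST n. a \<in> lvl A n) a)"
    have h: "h a = \<gamma> n a" if a: "a \<in> lvl A n" for n a
      using \<gamma>_mono[OF Least_le[of "\<lambda>n. a \<in> lvl A n", OF a] LeastI[of "\<lambda>n. a \<in> lvl A n", OF a]]
        A.lvl_closed[OF a] by (simp add: h_def)
    have gh: "g x n = h (x n)" if "x \<in> carrier (seq_alg A)" for x n
      using g_\<gamma>[OF that] h[of "x n" n] that by simp
    have h_closed: "h a \<in> carrier B" if a: "a \<in> carrier A" for a
    proof -
      obtain n where n: "a \<in> lvl A n"
        by (rule A.lvl_exhaust[OF a])
      have "g (\<delta> n a) n \<in> lvl B n"
        using gops(7)[OF \<delta>[OF n]] by simp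
      then show ?thesis
        using h[OF n] B.lvl_closed by (simp add: \<gamma>_def)
    qed
    have "h \<in> mv_hom A B"
      unfolding mv_hom_def
    proof (intro CollectI conjI ballI)
      show "h \<in> carrier A \<rightarrow>\<^sub>E carrier B"
        using h_closed by (auto simp: h_def)
      show "h (mv_zero A) = mv_zero B"
        using gh[of "zop (seq_alg A)" 0] gops(1) by simp
      fix a assume "a \<in> carrier A"
      then obtain n where n: "a \<in> lvl A n"
        using A.lvl_exhaust by blast
      show "h (mv_neg A a) = mv_neg B (h a)"
        using gh[OF \<delta>[OF n], of n] gh[OF op_closed(2)[OF A.sig_algebra_seq \<delta>[OF n]], of n]
          gops(2)[OF \<delta>[OF n]] by (simp add: \<delta>_def)
      fix b assume "b \<in> carrier A"
      then obtain m where m: "b \<in> lvl A m"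
        using A.lvl_exhaust by blast
      \<comment> \<open>Both summands are placed in a common level, so that their sum is computed in
        one entry.\<close>
      define k where "k = max n m"
      have k: "a \<in> lvl A k" "b \<in> lvl A k"
        using A.lvl_mono[OF _ n, of k] A.lvl_mono[OF _ m, of k] by (auto simp: k_def)
      show "h (mv_plus A a b) = mv_plus B (h a) (h b)"
        using gh[OF \<delta>[OF k(1)], of k] gh[OF \<delta>[OF k(2)], of k]
          gh[OF op_closed(3)[OF A.sig_algebra_seq \<delta>[OF k(1)] \<delta>[OF k(2)]], of k]
          gops(3)[OF \<delta>[OF k(1)] \<delta>[OF k(2)]] by (simp add: \<delta>_def)
    qed
    moreover have "g = lift_hom A h"
    proof (rule extensionalityI)
      show "g \<in> extensional (carrier (seq_alg A))"
        using g by (auto simp: alg_hom_def PiE_def)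
      show "lift_hom A h \<in> extensional (carrier (seq_alg A))"
        by (simp add: lift_hom_def del: seq_alg_simps)
      show "g x = lift_hom A h x" if "x \<in> carrier (seq_alg A)" for x
        using gh[OF that] that by (auto simp: lift_hom_def simp del: seq_alg_simps)
    qed
    ultimately show "g \<in> lift_hom A ` mv_hom A B"
      by blast
  qed
qed

section \<open>Equations valid for sequences\<close>

definition Zt :: "(nat, nat, 'v) trm" where "Zt = Op 0 (\<lambda>_. undefined)"
definition Nt :: "(nat, nat, 'v) trm \<Rightarrow> (nat, nat, 'v) trm" where "Nt s = Op (Suc 0) (\<lambda>_. s)"
definition Pt :: "(nat, nat, 'v) trm \<Rightarrow> (nat, nat, 'v) trm \<Rightarrow> (nat, nat, 'v) trm" where
  "Pt s t = Op 2 (\<lambda>i. if i = 0 then s else t)"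
definition Dt :: "(nat \<Rightarrow> (nat, nat, 'v) trm) \<Rightarrow> (nat, nat, 'v) trm" where "Dt ss = Op 3 ss"
definition Ut :: "(nat, nat, 'v) trm \<Rightarrow> (nat, nat, 'v) trm" where "Ut s = Op 4 (\<lambda>_. s)"
definition Wt :: "(nat, nat, 'v) trm \<Rightarrow> (nat, nat, 'v) trm" where "Wt s = Op 5 (\<lambda>_. s)"

lemmas trm_defs = Zt_def Nt_def Pt_def Dt_def Ut_def Wt_def

text \<open>In an algebra of sequences, \<open>tailop B n x\<close> replaces the first \<open>n\<close> entries of \<open>x\<close> by zero,
  and \<open>stab B n x\<close> is zero before \<open>n\<close> and constantly the \<open>n\<close>-th entry of \<open>x\<close> from there on.\<close>

definition tailop :: "(nat, nat, 'a) alg \<Rightarrow> nat \<Rightarrow> 'a \<Rightarrow> 'a" where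
  "tailop B n x = dop B (\<lambda>k. if k < n then zop B else x)"
definition stab :: "(nat, nat, 'a) alg \<Rightarrow> nat \<Rightarrow> 'a \<Rightarrow> 'a" where
  "stab B n x = dop B (\<lambda>k. if k < n then zop B else (uop B ^^ (k - n)) x)"

definition Tt :: "nat \<Rightarrow> (nat, nat, 'v) trm \<Rightarrow> (nat, nat, 'v) trm" where
  "Tt n s = Dt (\<lambda>k. if k < n then Zt else s)"
definition St :: "nat \<Rightarrow> (nat, nat, 'v) trm \<Rightarrow> (nat, nat, 'v) trm" where
  "St n s = Dt (\<lambda>k. if k < n then Zt else (Ut ^^ (k - n)) s)"

primrec mterm :: "mvt \<Rightarrow> (nat \<Rightarrow> (nat, nat, 'v) trm) \<Rightarrow> (nat, nat, 'v) trm" where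
  "mterm (V i) ss = ss i"
| "mterm Zr ss = Zt"
| "mterm (Ng s) ss = Nt (mterm s ss)"
| "mterm (Pl s t) ss = Pt (mterm s ss) (mterm t ss)"

lemma sig_term_basic [simp]:
  "sig_term \<Sigma> (Var v)" "sig_term lf_sig Zt" "sig_term lf_sig s \<Longrightarrow> sig_term lf_sig (Nt s)"
  "sig_term lf_sig s \<Longrightarrow> sig_term lf_sig t \<Longrightarrow> sig_term lf_sig (Pt s t)"
  "(\<And>i. sig_term lf_sig (ss i)) \<Longrightarrow> sig_term lf_sig (Dt ss)"
  "sig_term lf_sig s \<Longrightarrow> sig_term lf_sig (Ut s)" "sig_term lf_sig s \<Longrightarrow> sig_term lf_sig (Wt s)"
  unfolding trm_defs by (auto intro!: sig_term.intros)

lemma sig_term_pow [simp]: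
  "sig_term lf_sig s \<Longrightarrow> sig_term lf_sig ((Ut ^^ j) s)"
  "sig_term lf_sig s \<Longrightarrow> sig_term lf_sig ((Wt ^^ j) s)"
  by (induction j) auto

lemma sig_term_derived [simp]:
  "sig_term lf_sig s \<Longrightarrow> sig_term lf_sig (Tt n s)"
  "sig_term lf_sig s \<Longrightarrow> sig_term lf_sig (St n s)"
  by (auto simp: Tt_def St_def)

lemma sig_term_mterm [simp]: "(\<And>i. sig_term lf_sig (ss i)) \<Longrightarrow> sig_term lf_sig (mterm t ss)"
  by (induction t) auto

lemma eval_basic [simp]:
  "eval_term lf_sig B \<rho> Zt = zop B"
  "eval_term lf_sig B \<rho> (Nt s) = nop B (eval_term lf_sig B \<rho> s)"
  "eval_term lf_sig B \<rho> (Pt s t) = pop B (eval_term lf_sig B \<rho> s) (eval_term lf_sig B \<rho> t)"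
  "eval_term lf_sig B \<rho> (Dt ss) = dop B (\<lambda>k. eval_term lf_sig B \<rho> (ss k))"
  "eval_term lf_sig B \<rho> (Ut s) = uop B (eval_term lf_sig B \<rho> s)"
  "eval_term lf_sig B \<rho> (Wt s) = wop B (eval_term lf_sig B \<rho> s)"
  unfolding trm_defs op_defs by (auto simp: restrict_def intro!: arg_cong[where f = "interp B _"])

lemma eval_pow [simp]:
  "eval_term lf_sig B \<rho> ((Ut ^^ j) s) = (uop B ^^ j) (eval_term lf_sig B \<rho> s)"
  "eval_term lf_sig B \<rho> ((Wt ^^ j) s) = (wop B ^^ j) (eval_term lf_sig B \<rho> s)"
  by (induction j) auto

lemma eval_if: "eval_term \<Sigma> B \<rho> (if c then s else t) =
    (if c then eval_term \<Sigma> B \<rho> s else eval_term \<Sigma> B \<rho> t)"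
  by simp

lemma eval_derived [simp]:
  "eval_term lf_sig B \<rho> (Tt n s) = tailop B n (eval_term lf_sig B \<rho> s)"
  "eval_term lf_sig B \<rho> (St n s) = stab B n (eval_term lf_sig B \<rho> s)"
  unfolding Tt_def St_def tailop_def stab_def by (simp_all add: eval_if cong: if_cong)

lemma eval_mterm [simp]:
  "eval_term lf_sig B \<rho> (mterm t ss) = ev (mv_of B) (\<lambda>i. eval_term lf_sig B \<rho> (ss i)) t"
  by (induction t) auto

lemma tailop_seq [simp]: "tailop (seq_alg A) n x = (\<lambda>k. if k < n then mv_zero A else x k)"
  by (auto simp: tailop_def fun_eq_iff)

lemma stab_seq [simp]: "stab (seq_alg A) n x = (\<lambda>k. if k < n then mv_zero A else x n)"
  by (auto simp: stab_def fun_eq_iff uop_pow_seq)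

text \<open>Taking all valid equations spares an axiom list: a required identity is verified in
  sequences once and then holds in every model. The type argument fixes where the MV-algebras live,
  without reference to a collection of small sets.\<close>

definition lf_eqs :: "'u itself \<Rightarrow> (nat, nat, nat) equations" where
  "lf_eqs _ = {(s, t). sig_term lf_sig s \<and> sig_term lf_sig t \<and>
     (\<forall>A :: 'u mv. lf_mv A \<longrightarrow> satisfies lf_sig (seq_alg A) {(s, t)})}"

lemma lf_simps:
  assumes "lf_mv A" "x \<in> carrier A"
  shows "mv_plus A x (mv_zero A) = x" "mv_plus A (mv_zero A) x = x" "mv_neg A (mv_neg A x) = x"
    "mv_plus A (mv_neg A (mv_zero A)) x = mv_neg A (mv_zero A)"
proof -
  interpret lf_mv A by fact
  show "mv_plus A x (mv_zero A) = x" "mv_plus A (mv_zero A) x = x" "mv_neg A (mv_neg A x) = x"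
    "mv_plus A (mv_neg A (mv_zero A)) x = mv_neg A (mv_zero A)"
    using assms(2) by auto
qed

lemma lf_zero: "lf_mv A \<Longrightarrow> mv_zero A \<in> carrier A" "lf_mv A \<Longrightarrow> mv_zero A \<in> lvl A n"
  using mv_algebra.zero_closed[OF lf_mv.axioms(1)] lf_mv.lvl_ops(1) by blast+

lemma lvl_defect: "x \<in> lvl A n \<Longrightarrow> ev A (\<lambda>_. x) (defect n) = mv_zero A"
  by (simp add: lvl_def)

lemma lf_wop_pow:
  assumes "lf_mv A" "\<And>k. x k \<in> lvl A k"
  shows "(wop (seq_alg A) ^^ j) x n = rtr A n (n + j) (x (n + j))"
  using lf_mv.wop_pow_seq[OF assms(1), of x j n] assms(2) by simp

lemma lf_assoc: "lf_mv A \<Longrightarrow> x \<in> carrier A \<Longrightarrow> y \<in> carrier A \<Longrightarrow> z \<in> carrier A \<Longrightarrow>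
    mv_plus A (mv_plus A x y) z = mv_plus A x (mv_plus A y z)"
  by (simp add: lf_mv_def mv_algebra.plus_assoc)

lemma lf_comm: "lf_mv A \<Longrightarrow> x \<in> carrier A \<Longrightarrow> y \<in> carrier A \<Longrightarrow> mv_plus A x y = mv_plus A y x"
  by (rule mv_algebra.plus_comm[OF lf_mv.axioms(1)])

lemma lf_luk: "lf_mv A \<Longrightarrow> x \<in> carrier A \<Longrightarrow> y \<in> carrier A \<Longrightarrow>
    mv_plus A (mv_neg A (mv_plus A (mv_neg A x) y)) y = mv_plus A (mv_neg A (mv_plus A (mv_neg A y) x)) x"
  by (rule mv_algebra.lukasiewicz[OF lf_mv.axioms(1)])

lemma rtr_seq: "rtr (mv_of (seq_alg A)) n m x k = rtr A n m (x k)"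
  by (simp add: rtr_def ev_seq_alg)

lemma lf_rtr_eq: "lf_mv A \<Longrightarrow> x \<in> lvl A n \<Longrightarrow> n \<le> m \<Longrightarrow> rtr A n m x = x"
  by (rule lf_mv.rtr_eq)

lemma lf_rtr_zero: "lf_mv A \<Longrightarrow> n \<le> m \<Longrightarrow> rtr A n m (mv_zero A) = mv_zero A"
  by (rule lf_mv.rtr_zero)

section \<open>Identities of sequence algebras, transferred to arbitrary models\<close>

locale lf_model =
  fixes M :: "(nat, nat, 'u) alg"
  assumes sig: "sig_algebra lf_sig M" and eqs: "satisfies lf_sig M (lf_eqs TYPE('u))"
begin

lemmas closed [simp] = op_closed[OF sig]

lemma pow_closed [simp]:
  "x \<in> carrier M \<Longrightarrow> (uop M ^^ j) x \<in> carrier M" "x \<in> carrier M \<Longrightarrow> (wop M ^^ j) x \<in> carrier M"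
  by (induction j) auto

lemma derived_closed [simp]:
  "x \<in> carrier M \<Longrightarrow> tailop M n x \<in> carrier M" "x \<in> carrier M \<Longrightarrow> stab M n x \<in> carrier M"
  unfolding tailop_def stab_def by auto

text \<open>The last premise says that the equation belongs to \<open>lf_eqs\<close>; it is stated
  with entries in the carrier of A for the sake of calculation there.\<close>

lemma transfer:
  fixes s t :: "(nat, nat, nat) trm"
  assumes "\<And>v. \<rho> v \<in> carrier M" "sig_term lf_sig s" "sig_term lf_sig t"
    and "\<And>(A :: 'u mv) \<sigma>. lf_mv A \<Longrightarrow> (\<And>v. \<sigma> v \<in> carrier (seq_alg A)) \<Longrightarrow>
      (\<And>v k. \<sigma> v k \<in> carrier A) \<Longrightarrow> eval_term lf_sig (seq_alg A) \<sigma> s = eval_term lf_sig (seq_alg A) \<sigma> t"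
  shows "eval_term lf_sig M \<rho> s = eval_term lf_sig M \<rho> t"
proof -
  have "eval_term lf_sig (seq_alg A) \<sigma> s = eval_term lf_sig (seq_alg A) \<sigma> t"
    if A: "lf_mv A" and \<sigma>: "range \<sigma> \<subseteq> carrier (seq_alg A)" for A :: "'u mv" and \<sigma> :: "nat \<Rightarrow> nat \<Rightarrow> 'u"
  proof (rule assms(4)[OF A])
    show *: "\<sigma> v \<in> carrier (seq_alg A)" for v
      using \<sigma> by blast
    show "\<sigma> v k \<in> carrier A" for v k
      using *[of v] lf_mv.lvl_closed[OF A, of _ k] by auto
  qed
  then have "(s, t) \<in> lf_eqs TYPE('u)"
    using assms(2,3) by (auto simp: lf_eqs_def satisfies_def)
  moreover have "range \<rho> \<subseteq> carrier M"
    using assms(1) by auto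
  ultimately show ?thesis
    using eqs unfolding satisfies_def by blast
qed

lemma pop_assoc:
  assumes "x \<in> carrier M" "y \<in> carrier M" "w \<in> carrier M"
  shows "pop M (pop M x y) w = pop M x (pop M y w)"
proof -
  have "eval_term lf_sig M (\<lambda>i. if i = 0 then x else if i = 1 then y else w) (Pt (Pt (Var (0 :: nat)) (Var (1 :: nat))) (Var (2 :: nat))) =
      eval_term lf_sig M (\<lambda>i. if i = 0 then x else if i = 1 then y else w) (Pt (Var (0 :: nat)) (Pt (Var (1 :: nat)) (Var (2 :: nat))))"
    by (rule transfer) (use assms in \<open>auto simp: fun_eq_iff lf_simps lf_zero lf_assoc\<close>)
  then show ?thesis
    by simp
qed

lemma pop_comm:
  assumes "x \<in> carrier M" "y \<in> carrier M"
  shows "pop M x y = pop M y x"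
proof -
  have "eval_term lf_sig M (\<lambda>i. if i = 0 then x else y) (Pt (Var (0 :: nat)) (Var (1 :: nat))) =
      eval_term lf_sig M (\<lambda>i. if i = 0 then x else y) (Pt (Var (1 :: nat)) (Var (0 :: nat)))"
    by (rule transfer) (use assms in \<open>auto simp: fun_eq_iff lf_simps lf_zero lf_comm\<close>)
  then show ?thesis
    by simp
qed

lemma zop_pop:
  assumes "x \<in> carrier M"
  shows "pop M (zop M) x = x"
proof -
  have "eval_term lf_sig M (\<lambda>_ :: nat. x) (Pt Zt (Var (0 :: nat))) =
      eval_term lf_sig M (\<lambda>_ :: nat. x) (Var (0 :: nat))"
    by (rule transfer) (use assms in \<open>auto simp: fun_eq_iff lf_simps lf_zero\<close>)
  then show ?thesis
    by simp
qed

lemma nop_nop: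
  assumes "x \<in> carrier M"
  shows "nop M (nop M x) = x"
proof -
  have "eval_term lf_sig M (\<lambda>_ :: nat. x) (Nt (Nt (Var (0 :: nat)))) =
      eval_term lf_sig M (\<lambda>_ :: nat. x) (Var (0 :: nat))"
    by (rule transfer) (use assms in \<open>auto simp: fun_eq_iff lf_simps lf_zero\<close>)
  then show ?thesis
    by simp
qed

lemma nop_zop_pop:
  assumes "x \<in> carrier M"
  shows "pop M (nop M (zop M)) x = nop M (zop M)"
proof -
  have "eval_term lf_sig M (\<lambda>_ :: nat. x) (Pt (Nt Zt) (Var (0 :: nat))) =
      eval_term lf_sig M (\<lambda>_ :: nat. x) (Nt Zt)"
    by (rule transfer) (use assms in \<open>auto simp: fun_eq_iff lf_simps lf_zero\<close>)
  then show ?thesis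
    by simp
qed

lemma pop_lukasiewicz:
  assumes "x \<in> carrier M" "y \<in> carrier M"
  shows "pop M (nop M (pop M (nop M x) y)) y = pop M (nop M (pop M (nop M y) x)) x"
proof -
  have "eval_term lf_sig M (\<lambda>i. if i = 0 then x else y) (Pt (Nt (Pt (Nt (Var (0 :: nat))) (Var (1 :: nat)))) (Var (1 :: nat))) =
      eval_term lf_sig M (\<lambda>i. if i = 0 then x else y) (Pt (Nt (Pt (Nt (Var (1 :: nat))) (Var (0 :: nat)))) (Var (0 :: nat)))"
    by (rule transfer) (use assms in \<open>auto simp: fun_eq_iff lf_simps lf_zero lf_luk\<close>)
  then show ?thesis
    by simp
qed

lemma mv_algebra_mv_of: "mv_algebra (mv_of M)"
proof (rule mv_algebra.intro)
  show "Group.comm_monoid \<lparr>carrier = carrier (mv_of M), mult = mv_plus (mv_of M), one = mv_zero (mv_of M)\<rparr>"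
    by (rule comm_monoidI) (auto simp: pop_assoc zop_pop intro: pop_comm)
qed (auto simp: nop_nop nop_zop_pop pop_lukasiewicz)

lemma tail_tail:
  assumes "x \<in> carrier M" "n \<le> m"
  shows "tailop M m (tailop M n x) = tailop M m x"
proof -
  have "eval_term lf_sig M (\<lambda>_ :: nat. x) (Tt m (Tt n (Var (0 :: nat)))) =
      eval_term lf_sig M (\<lambda>_ :: nat. x) (Tt m (Var (0 :: nat)))"
    by (rule transfer) (use assms in \<open>auto simp: fun_eq_iff lf_simps lf_zero\<close>)
  then show ?thesis
    by simp
qed

lemma tail_pop:
  assumes "x \<in> carrier M" "y \<in> carrier M"
  shows "tailop M n (pop M x y) = pop M (tailop M n x) (tailop M n y)"
proof -
  have "eval_term lf_sig M (\<lambda>i. if i = 0 then x else y) (Tt n (Pt (Var (0 :: nat)) (Var (1 :: nat)))) =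
      eval_term lf_sig M (\<lambda>i. if i = 0 then x else y) (Pt (Tt n (Var (0 :: nat))) (Tt n (Var (1 :: nat))))"
    by (rule transfer) (use assms in \<open>auto simp: fun_eq_iff lf_simps lf_zero\<close>)
  then show ?thesis
    by simp
qed

text \<open>Negation turns the inserted zeros into ones, so truncation commutes with it only under
  an outer truncation.\<close>

lemma tail_nop:
  assumes "x \<in> carrier M"
  shows "tailop M n (nop M (tailop M n x)) = tailop M n (nop M x)"
proof -
  have "eval_term lf_sig M (\<lambda>_ :: nat. x) (Tt n (Nt (Tt n (Var (0 :: nat))))) =
      eval_term lf_sig M (\<lambda>_ :: nat. x) (Tt n (Nt (Var (0 :: nat))))"
    by (rule transfer) (use assms in \<open>auto simp: fun_eq_iff lf_simps lf_zero\<close>)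
  then show ?thesis
    by simp
qed

lemma tail_zop: "tailop M n (zop M) = zop M"
proof -
  have "eval_term lf_sig M (\<lambda>_ :: nat. zop M) (Tt n Zt) =
      eval_term lf_sig M (\<lambda>_ :: nat. zop M) (Zt)"
    by (rule transfer) (auto simp: fun_eq_iff lf_simps lf_zero)
  then show ?thesis
    by simp
qed

lemma tail_uop:
  assumes "x \<in> carrier M"
  shows "tailop M (Suc n) (uop M x) = uop M (tailop M n x)"
proof -
  have "eval_term lf_sig M (\<lambda>_ :: nat. x) (Tt (Suc n) (Ut (Var (0 :: nat)))) =
      eval_term lf_sig M (\<lambda>_ :: nat. x) (Ut (Tt n (Var (0 :: nat))))"
    by (rule transfer)
      (use assms in \<open>auto simp: fun_eq_iff lf_simps lf_zero split: nat.split\<close>)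
  then show ?thesis
    by simp
qed

lemma uop_pop:
  assumes "x \<in> carrier M" "y \<in> carrier M"
  shows "uop M (pop M x y) = pop M (uop M x) (uop M y)"
proof -
  have "eval_term lf_sig M (\<lambda>i. if i = 0 then x else y) (Ut (Pt (Var (0 :: nat)) (Var (1 :: nat)))) =
      eval_term lf_sig M (\<lambda>i. if i = 0 then x else y) (Pt (Ut (Var (0 :: nat))) (Ut (Var (1 :: nat))))"
    by (rule transfer)
      (use assms in \<open>auto simp: fun_eq_iff lf_simps lf_zero split: nat.split\<close>)
  then show ?thesis
    by simp
qed

text \<open>Shift and negation differ at place 0, where the shift inserts zero; the outer truncation
  hides this place.\<close>

lemma tail_uop_nop:
  assumes "x \<in> carrier M"
  shows "tailop M (Suc n) (uop M (nop M x)) = tailop M (Suc n) (nop M (uop M x))"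
proof -
  have "eval_term lf_sig M (\<lambda>_ :: nat. x) (Tt (Suc n) (Ut (Nt (Var (0 :: nat))))) =
      eval_term lf_sig M (\<lambda>_ :: nat. x) (Tt (Suc n) (Nt (Ut (Var (0 :: nat)))))"
    by (rule transfer)
      (use assms in \<open>auto simp: fun_eq_iff lf_simps lf_zero split: nat.split\<close>)
  then show ?thesis
    by simp
qed

lemma uop_zop: "uop M (zop M) = zop M"
proof -
  have "eval_term lf_sig M (\<lambda>_ :: nat. zop M) (Ut Zt) =
      eval_term lf_sig M (\<lambda>_ :: nat. zop M) (Zt)"
    by (rule transfer) (auto simp: fun_eq_iff lf_simps lf_zero split: nat.split)
  then show ?thesis
    by simp
qed

text \<open>The diagonal reads entry k of argument k, and cutting that argument below k leaves this
  entry alone.\<close>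

lemma stab_tail_pow:
  assumes "x \<in> carrier M"
  shows "dop M (\<lambda>k. if k < m then zop M else tailop M k ((uop M ^^ (k - m)) x)) = stab M m x"
proof -
  have "eval_term lf_sig M (\<lambda>_ :: nat. x) (Dt (\<lambda>k. if k < m then Zt else Tt k ((Ut ^^ (k - m)) (Var (0 :: nat))))) =
      eval_term lf_sig M (\<lambda>_ :: nat. x) (St m (Var (0 :: nat)))"
    by (rule transfer)
      (use assms in \<open>auto simp: fun_eq_iff lf_simps lf_zero eval_if uop_pow_seq\<close>)
  then show ?thesis
    by (simp add: eval_if cong: if_cong)
qed

lemma dop_tail:
  assumes "x \<in> carrier M"
  shows "dop M (\<lambda>k. if k < m then zop M else tailop M k x) = tailop M m x"
proof -
  have "eval_term lf_sig M (\<lambda>_ :: nat. x) (Dt (\<lambda>k. if k < m then Zt else Tt k (Var (0 :: nat)))) =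
      eval_term lf_sig M (\<lambda>_ :: nat. x) (Tt m (Var (0 :: nat)))"
    by (rule transfer) (use assms in \<open>auto simp: fun_eq_iff lf_simps lf_zero eval_if\<close>)
  then show ?thesis
    by (simp add: eval_if cong: if_cong)
qed

lemma tail_uop_stab:
  assumes "x \<in> carrier M"
  shows "tailop M (Suc n) (uop M (stab M n x)) = tailop M (Suc n) (stab M n x)"
proof -
  have "eval_term lf_sig M (\<lambda>_ :: nat. x) (Tt (Suc n) (Ut (St n (Var (0 :: nat))))) =
      eval_term lf_sig M (\<lambda>_ :: nat. x) (Tt (Suc n) (St n (Var (0 :: nat))))"
    by (rule transfer)
      (use assms in \<open>auto simp: fun_eq_iff lf_simps lf_zero split: nat.split\<close>)
  then show ?thesis
    by simp
qed

lemma stab_pop: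
  assumes "x \<in> carrier M" "y \<in> carrier M"
  shows "stab M n (pop M x y) = pop M (stab M n x) (stab M n y)"
proof -
  have "eval_term lf_sig M (\<lambda>i. if i = 0 then x else y) (St n (Pt (Var (0 :: nat)) (Var (1 :: nat)))) =
      eval_term lf_sig M (\<lambda>i. if i = 0 then x else y) (Pt (St n (Var (0 :: nat))) (St n (Var (1 :: nat))))"
    by (rule transfer) (use assms in \<open>auto simp: fun_eq_iff lf_simps lf_zero\<close>)
  then show ?thesis
    by simp
qed

lemma stab_nop:
  assumes "x \<in> carrier M"
  shows "tailop M n (stab M n (nop M x)) = tailop M n (nop M (stab M n x))"
proof -
  have "eval_term lf_sig M (\<lambda>_ :: nat. x) (Tt n (St n (Nt (Var (0 :: nat))))) =
      eval_term lf_sig M (\<lambda>_ :: nat. x) (Tt n (Nt (St n (Var (0 :: nat)))))"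
    by (rule transfer) (use assms in \<open>auto simp: fun_eq_iff lf_simps lf_zero\<close>)
  then show ?thesis
    by simp
qed

lemma stab_zop: "stab M n (zop M) = zop M"
proof -
  have "eval_term lf_sig M (\<lambda>_ :: nat. zop M) (St n Zt) =
      eval_term lf_sig M (\<lambda>_ :: nat. zop M) (Zt)"
    by (rule transfer) (auto simp: fun_eq_iff lf_simps lf_zero)
  then show ?thesis
    by simp
qed

lemma stab_dop:
  assumes "\<And>i. xs i \<in> carrier M"
  shows "stab M n (dop M xs) = stab M n (xs n)"
proof -
  have "eval_term lf_sig M (xs) (St n (Dt (Var :: nat \<Rightarrow> _))) =
      eval_term lf_sig M (xs) (St n (Var n))"
    by (rule transfer) (use assms in \<open>auto simp: fun_eq_iff lf_simps lf_zero\<close>)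
  then show ?thesis
    by simp
qed

lemma stab_uop:
  assumes "x \<in> carrier M"
  shows "tailop M (Suc n) (stab M n x) = stab M (Suc n) (uop M x)"
proof -
  have "eval_term lf_sig M (\<lambda>_ :: nat. x) (Tt (Suc n) (St n (Var (0 :: nat)))) =
      eval_term lf_sig M (\<lambda>_ :: nat. x) (St (Suc n) (Ut (Var (0 :: nat))))"
    by (rule transfer) (use assms in \<open>auto simp: fun_eq_iff lf_simps lf_zero\<close>)
  then show ?thesis
    by simp
qed

lemma stab_0_uop:
  assumes "x \<in> carrier M"
  shows "stab M 0 (uop M x) = zop M"
proof -
  have "eval_term lf_sig M (\<lambda>_ :: nat. x) (St 0 (Ut (Var (0 :: nat)))) =
      eval_term lf_sig M (\<lambda>_ :: nat. x) (Zt)"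
    by (rule transfer) (use assms in \<open>auto simp: fun_eq_iff lf_simps lf_zero\<close>)
  then show ?thesis
    by simp
qed

lemma defect_stab:
  assumes "x \<in> carrier M"
  shows "ev (mv_of M) (\<lambda>_. stab M n x) (defect n) = zop M"
proof -
  have "eval_term lf_sig M (\<lambda>_ :: nat. x) (mterm (defect n) (\<lambda>_. St n (Var (0 :: nat)))) =
      eval_term lf_sig M (\<lambda>_ :: nat. x) (Zt)"
    by (rule transfer)
      (use assms in \<open>auto simp: fun_eq_iff lf_simps lf_zero ev_seq_alg lvl_defect\<close>)
  then show ?thesis
    by simp
qed

text \<open>Truncation removes the retracted value at place n, where the right-hand side still has
  the retraction of zero.\<close>

lemma stab_wop:
  assumes "x \<in> carrier M"
  shows "tailop M (Suc n) (stab M n (wop M x)) = ev (mv_of M) (\<lambda>_. stab M (Suc n) x) (retract n (Suc n))"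
proof -
  have "eval_term lf_sig M (\<lambda>_ :: nat. x) (Tt (Suc n) (St n (Wt (Var (0 :: nat))))) =
      eval_term lf_sig M (\<lambda>_ :: nat. x) (mterm (retract n (Suc n)) (\<lambda>_. St (Suc n) (Var (0 :: nat))))"
    by (rule transfer)
      (use assms in \<open>auto simp: fun_eq_iff lf_simps lf_zero ev_seq_alg lf_rtr_zero rtr_def[symmetric] rtr_seq\<close>)
  then show ?thesis
    by simp
qed

text \<open>Recovers a stabilised element from any of its tails: m - n retractions bring entry m
  back to level n, where it started. This is the equational form of the injectivity of the
  inclusions.\<close>

lemma stab_pow_wop_tail_stab:
  assumes "x \<in> carrier M" "n \<le> m"
  shows "stab M n ((wop M ^^ (m - n)) (tailop M m (stab M n x))) = stab M n x"
proof -
  have "eval_term lf_sig M (\<lambda>_ :: nat. x) (St n ((Wt ^^ (m - n)) (Tt m (St n (Var (0 :: nat)))))) =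
      eval_term lf_sig M (\<lambda>_ :: nat. x) (St n (Var (0 :: nat)))"
  proof (rule transfer)
    fix A :: "'u mv" and \<sigma> :: "nat \<Rightarrow> nat \<Rightarrow> 'u"
    assume A: "lf_mv A" and \<sigma>: "\<And>v. \<sigma> v \<in> carrier (seq_alg A)"
    have "\<sigma> 0 n \<in> lvl A k" if "n \<le> k" for k
      using lf_mv.lvl_mono[OF A that] \<sigma>[of 0] by simp
    \<comment> \<open>The truncated constant sequence must be seen to respect the levels before
      iterated retraction can be computed on it.\<close>
    then have "(if k < m then mv_zero A else if k < n then mv_zero A else \<sigma> 0 n) \<in> lvl A k" for k
      using A assms(2) by (auto simp: lf_zero)
    note wop = lf_wop_pow[where x = "\<lambda>k. if k < m then mv_zero A else if k < n then mv_zero A else \<sigma> 0 n",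
        OF A this, of "m - n" n]
    show "eval_term lf_sig (seq_alg A) \<sigma> (St n ((Wt ^^ (m - n)) (Tt m (St n (Var (0 :: nat)))))) =
        eval_term lf_sig (seq_alg A) \<sigma> (St n (Var (0 :: nat)))"
      using A assms(2) \<sigma>[of 0] by (simp add: fun_eq_iff wop lf_rtr_eq)
  qed (use assms in auto)
  then show ?thesis
    by simp
qed

lemma dop_stab:
  assumes "x \<in> carrier M"
  shows "dop M (\<lambda>n. stab M n x) = x"
proof -
  have "eval_term lf_sig M (\<lambda>_ :: nat. x) (Dt (\<lambda>n. St n (Var (0 :: nat)))) =
      eval_term lf_sig M (\<lambda>_ :: nat. x) (Var (0 :: nat))"
    by (rule transfer) (use assms in \<open>auto simp: fun_eq_iff lf_simps lf_zero\<close>)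
  then show ?thesis
    by simp
qed

text \<open>Both sides carry the retraction of entry m from place m on. On the right the earlier
  entries are retractions of zero, hence zero.\<close>

lemma tail_stab_pow_wop:
  assumes "x \<in> carrier M" "n \<le> m"
  shows "tailop M m (stab M n ((wop M ^^ (m - n)) x)) = ev (mv_of M) (\<lambda>_. stab M m x) (retract n m)"
proof -
  have "eval_term lf_sig M (\<lambda>_ :: nat. x) (Tt m (St n ((Wt ^^ (m - n)) (Var (0 :: nat))))) =
      eval_term lf_sig M (\<lambda>_ :: nat. x) (mterm (retract n m) (\<lambda>_. St m (Var (0 :: nat))))"
    by (rule transfer)
      (use assms in \<open>auto simp: fun_eq_iff lf_simps lf_zero ev_seq_alg lf_wop_pow lf_rtr_zero rtr_def[symmetric] rtr_seq\<close>)
  then show ?thesis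
    by simp
qed

text \<open>Zero lies in every level, so its defect is zero and the truncated entries match.\<close>

lemma defect_tail:
  assumes "x \<in> carrier M"
  shows "ev (mv_of M) (\<lambda>_. tailop M m x) (defect n) = tailop M m (ev (mv_of M) (\<lambda>_. x) (defect n))"
proof -
  have "eval_term lf_sig M (\<lambda>_ :: nat. x) (mterm (defect n) (\<lambda>_. Tt m (Var (0 :: nat)))) =
      eval_term lf_sig M (\<lambda>_ :: nat. x) (Tt m (mterm (defect n) (\<lambda>_. Var (0 :: nat))))"
    by (rule transfer)
      (use assms in \<open>auto simp: fun_eq_iff lf_simps lf_zero ev_seq_alg lvl_defect lf_zero\<close>)
  then show ?thesis
    by simp
qed

section \<open>The MV-algebra of a model\<close>

text \<open>For sequences: all entries from place n on are equal. The shift compares entry k with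
  entry k - 1, so the comparison starts at place n + 1.\<close>

definition stable :: "nat \<Rightarrow> 'u \<Rightarrow> bool" where
  "stable n x \<longleftrightarrow> x \<in> carrier M \<and> tailop M (Suc n) (uop M x) = tailop M (Suc n) x"

definition threads :: "'u set" where
  "threads = {x. \<exists>n. stable n x}"

definition eqv :: "'u \<Rightarrow> 'u \<Rightarrow> bool" where
  "eqv x y \<longleftrightarrow> (\<exists>n. tailop M n x = tailop M n y)"

lemma tail_eq_mono:
  assumes "tailop M n x = tailop M n y" "n \<le> m" "x \<in> carrier M" "y \<in> carrier M"
  shows "tailop M m x = tailop M m y"
  using arg_cong[OF assms(1), of "tailop M m"] assms(2-) by (simp add: tail_tail)

lemma stable_mono: "stable n x \<Longrightarrow> n \<le> m \<Longrightarrow> stable m x"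
  using tail_eq_mono[of "Suc n" "uop M x" x "Suc m"] by (simp add: stable_def)

lemma threads_carrier: "x \<in> threads \<Longrightarrow> x \<in> carrier M"
  by (auto simp: threads_def stable_def)

lemma eqv_refl: "eqv x x"
  by (auto simp: eqv_def)

lemma eqv_sym: "eqv x y \<Longrightarrow> eqv y x"
  by (auto simp: eqv_def dest: sym)

lemma eqv_trans:
  assumes "eqv x y" "eqv y z" "x \<in> carrier M" "y \<in> carrier M" "z \<in> carrier M"
  shows "eqv x z"
proof -
  obtain n m where "tailop M n x = tailop M n y" "tailop M m y = tailop M m z"
    using assms by (auto simp: eqv_def)
  then have "tailop M (max n m) x = tailop M (max n m) y" "tailop M (max n m) y = tailop M (max n m) z"
    using assms by (auto intro: tail_eq_mono)
  then show ?thesis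
    unfolding eqv_def by metis
qed

lemma stable_pop:
  assumes "stable n x" "stable n y"
  shows "stable n (pop M x y)"
  using assms by (simp add: stable_def uop_pop tail_pop)

lemma stable_nop:
  assumes "stable n x"
  shows "stable n (nop M x)"
proof -
  have x: "x \<in> carrier M" "tailop M (Suc n) (uop M x) = tailop M (Suc n) x"
    using assms by (auto simp: stable_def)
  \<comment> \<open>Stability of x concerns only its truncation, which \<open>tail_nop\<close>
    allows to be inserted and removed below the negation.\<close>
  have "tailop M (Suc n) (uop M (nop M x)) = tailop M (Suc n) (nop M (tailop M (Suc n) (uop M x)))"
    using x(1) by (simp add: tail_uop_nop tail_nop)
  also have "\<dots> = tailop M (Suc n) (nop M x)"
    using x by (simp add: tail_nop)
  finally show ?thesis
    using x(1) by (simp add: stable_def)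
qed

lemma stable_zop: "stable n (zop M)"
  by (simp add: stable_def uop_zop)

lemma stable_stab: "x \<in> carrier M \<Longrightarrow> stable n (stab M n x)"
  by (simp add: stable_def tail_uop_stab)

lemma stab_threads: "x \<in> carrier M \<Longrightarrow> stab M n x \<in> threads"
  using stable_stab by (auto simp: threads_def)

lemma threads_subuniverse: "mv_subuniverse (mv_of M) threads"
proof -
  have "pop M x y \<in> threads" if xy: "x \<in> threads" "y \<in> threads" for x y
  proof -
    obtain n m where nm: "stable n x" "stable m y"
      using xy by (auto simp: threads_def)
    have "stable (max n m) (pop M x y)"
      using stable_mono[OF nm(1), of "max n m"] stable_mono[OF nm(2), of "max n m"]
      by (intro stable_pop) auto
    then show ?thesis
      by (auto simp: threads_def)
  qed
  moreover have "nop M x \<in> threads" if "x \<in> threads" for x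
    using that stable_nop by (auto simp: threads_def)
  moreover have "zop M \<in> threads"
    using stable_zop by (auto simp: threads_def)
  ultimately show ?thesis
    using threads_carrier by (auto simp: mv_subuniverse_def)
qed

lemma threads_ops [simp]:
  "zop M \<in> threads" "x \<in> threads \<Longrightarrow> nop M x \<in> threads"
  "x \<in> threads \<Longrightarrow> y \<in> threads \<Longrightarrow> pop M x y \<in> threads"
  using threads_subuniverse by (auto simp: mv_subuniverse_def)

text \<open>On its tail a stable element absorbs shifts, so in the diagonal that defines
  \<open>stab\<close> each shifted argument may be replaced by x itself.\<close>

lemma tail_stable:
  assumes "stable m x"
  shows "tailop M m x = stab M m x"
proof -
  have x: "x \<in> carrier M" "tailop M (Suc k) (uop M x) = tailop M (Suc k) x" if "m \<le> k" for k
    using stable_mono[OF assms that] by (auto simp: stable_def)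
  \<comment> \<open>Each shift moves the truncation one place up; stability at m + j then removes
    the shift.\<close>
  have "tailop M (m + j) ((uop M ^^ j) x) = tailop M (m + j) x" for j
  proof (induction j)
    case (Suc j)
    have "tailop M (m + Suc j) ((uop M ^^ Suc j) x) = uop M (tailop M (m + j) ((uop M ^^ j) x))"
      using x(1)[OF order_refl] by (simp add: tail_uop)
    also have "\<dots> = tailop M (m + Suc j) x"
      using x[of "m + j"] unfolding Suc.IH by (simp flip: tail_uop)
    finally show ?case .
  qed simp
  then have pow: "tailop M k ((uop M ^^ (k - m)) x) = tailop M k x" if "m \<le> k" for k
    using that by (metis le_add_diff_inverse)
  have "stab M m x = dop M (\<lambda>k. if k < m then zop M else tailop M k ((uop M ^^ (k - m)) x))"
    using stab_tail_pow[OF x(1)[OF order_refl]] by simp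
  also have "\<dots> = dop M (\<lambda>k. if k < m then zop M else tailop M k x)"
    using pow by (intro arg_cong[where f = "dop M"] ext) auto
  finally show ?thesis
    using dop_tail[OF x(1)[OF order_refl]] by simp
qed

text \<open>The element of the quotient by eventual equality, encoded as a chosen member of the
  class so that it remains an element of M.\<close>

definition lim :: "'u \<Rightarrow> 'u" where
  "lim x = (SOME y. y \<in> threads \<and> eqv y x)"

lemma lim: "x \<in> threads \<Longrightarrow> lim x \<in> threads" "x \<in> threads \<Longrightarrow> eqv (lim x) x"
  using someI[of "\<lambda>y. y \<in> threads \<and> eqv y x" x] eqv_refl unfolding lim_def by auto

lemma lim_eq_iff:
  assumes "x \<in> threads" "y \<in> threads"
  shows "lim x = lim y \<longleftrightarrow> eqv x y"
proof
  assume "lim x = lim y"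
  then show "eqv x y"
    using lim[OF assms(1)] lim[OF assms(2)] eqv_trans[of x "lim x" y] eqv_sym assms threads_carrier
    by auto
next
  assume xy: "eqv x y"
  have "z \<in> threads \<and> eqv z x \<longleftrightarrow> z \<in> threads \<and> eqv z y" for z
    using xy eqv_trans[of z x y] eqv_trans[of z y x] eqv_sym threads_carrier assms by blast
  then show "lim x = lim y"
    unfolding lim_def by simp
qed

definition lim_mv :: "'u mv" where
  "lim_mv = \<lparr>carrier = lim ` threads, mv_plus = (\<lambda>a b. lim (pop M a b)), mv_neg = (\<lambda>a. lim (nop M a)),
     mv_zero = lim (zop M)\<rparr>"

lemma lim_mv_carrier [simp]: "carrier lim_mv = lim ` threads"
  by (simp add: lim_mv_def)

lemma lim_zop: "lim (zop M) = mv_zero lim_mv"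
  by (simp add: lim_mv_def)

lemma lim_nop:
  assumes "x \<in> threads"
  shows "lim (nop M x) = mv_neg lim_mv (lim x)"
proof -
  obtain n where n: "tailop M n (lim x) = tailop M n x"
    using lim[OF assms] by (auto simp: eqv_def)
  have c: "x \<in> carrier M" "lim x \<in> carrier M"
    using assms lim threads_carrier by auto
  have "tailop M n (nop M x) = tailop M n (nop M (lim x))"
    using tail_nop[OF c(1), of n] tail_nop[OF c(2), of n] n by simp
  then have "eqv (nop M x) (nop M (lim x))"
    unfolding eqv_def by blast
  then show ?thesis
    using assms lim by (simp add: lim_mv_def lim_eq_iff)
qed

lemma lim_pop:
  assumes "x \<in> threads" "y \<in> threads"
  shows "lim (pop M x y) = mv_plus lim_mv (lim x) (lim y)"
proof -
  have c: "x \<in> carrier M" "lim x \<in> carrier M" "y \<in> carrier M" "lim y \<in> carrier M"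
    using assms lim threads_carrier by auto
  obtain n m where nm: "tailop M n (lim x) = tailop M n x" "tailop M m (lim y) = tailop M m y"
    using lim[OF assms(1)] lim[OF assms(2)] by (auto simp: eqv_def)
  then have "tailop M (max n m) (lim x) = tailop M (max n m) x"
    "tailop M (max n m) (lim y) = tailop M (max n m) y"
    using c by (auto intro: tail_eq_mono)
  then have "tailop M (max n m) (pop M x y) = tailop M (max n m) (pop M (lim x) (lim y))"
    using c by (simp add: tail_pop)
  then have "eqv (pop M x y) (pop M (lim x) (lim y))"
    unfolding eqv_def by blast
  then show ?thesis
    using assms lim by (simp add: lim_mv_def lim_eq_iff)
qed

lemma ev_lim:
  assumes "\<And>i. \<rho> i \<in> threads"
  shows "ev lim_mv (\<lambda>i. lim (\<rho> i)) t = lim (ev (mv_of M) \<rho> t)"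
  using ev_in_subuniverse[OF threads_subuniverse assms]
  by (induction t) (auto simp: lim_zop lim_nop lim_pop)

text \<open>The map \<open>lim\<close> is a homomorphism from the threads onto this algebra, and the
  threads inherit the MV-axioms from M.\<close>

lemma mv_algebra_lim: "mv_algebra lim_mv"
proof (rule mv_algebra.intro)
  note [simp] = threads_carrier lim_zop[symmetric] lim_nop[symmetric] lim_pop[symmetric]
  show "Group.comm_monoid \<lparr>carrier = carrier lim_mv, mult = mv_plus lim_mv, one = mv_zero lim_mv\<rparr>"
    by (rule comm_monoidI) (auto simp: pop_assoc zop_pop, metis pop_comm threads_carrier)
qed (auto simp: lim_nop[symmetric] lim_pop[symmetric] lim_zop[symmetric] threads_carrier nop_nop nop_zop_pop
    intro!: arg_cong[where f = lim] pop_lukasiewicz)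

lemma lim_lvl_iff:
  assumes "x \<in> threads"
  shows "lim x \<in> lvl lim_mv n \<longleftrightarrow> eqv (ev (mv_of M) (\<lambda>_. x) (defect n)) (zop M)"
proof -
  have "ev (mv_of M) (\<lambda>_. x) (defect n) \<in> threads"
    by (rule ev_in_subuniverse[OF threads_subuniverse assms])
  then show ?thesis
    using assms ev_lim[of "\<lambda>_. x" "defect n"] lim_eq_iff[of "ev (mv_of M) (\<lambda>_. x) (defect n)" "zop M"]
    by (simp add: lvl_def lim_zop)
qed

lemma lim_stab_lvl: "x \<in> carrier M \<Longrightarrow> lim (stab M n x) \<in> lvl lim_mv n"
  using stab_threads by (simp add: lim_lvl_iff defect_stab eqv_refl)

lemma lim_eq_stab:
  assumes "stable m x"
  shows "lim x = lim (stab M m x)"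
proof -
  have x: "x \<in> carrier M" "x \<in> threads"
    using assms by (auto simp: threads_def stable_def)
  have "tailop M m x = tailop M m (stab M m x)"
    using tail_tail[OF x(1), of m m] unfolding tail_stable[OF assms] by simp
  then have "eqv x (stab M m x)"
    unfolding eqv_def by blast
  then show ?thesis
    using x stab_threads by (simp add: lim_eq_iff)
qed

text \<open>In sequences, stabilised elements have all entries in level m, so agreement on the
  finite chain suffices. Restricting to k variables, with zero for the others, keeps the range of
  the valuation finite.\<close>

lemma ev_stab_eq:
  assumes "\<And>i. \<rho> i \<in> carrier M"
    and "\<And>v. (\<And>i. i < k \<Longrightarrow> v i \<in> lev m) \<Longrightarrow> (\<And>i. k \<le> i \<Longrightarrow> v i = 0) \<Longrightarrow>
      ev unit_mv v s = ev unit_mv v t"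
  shows "ev (mv_of M) (\<lambda>i. if i < k then stab M m (\<rho> i) else zop M) s =
    ev (mv_of M) (\<lambda>i. if i < k then stab M m (\<rho> i) else zop M) t"
proof -
  let ?term = "\<lambda>t. mterm t (\<lambda>i. if i < k then St m (Var i) else Zt)"
  have "eval_term lf_sig M \<rho> (?term s) = eval_term lf_sig M \<rho> (?term t)"
  proof (rule transfer)
    fix A :: "'u mv" and \<sigma> :: "nat \<Rightarrow> nat \<Rightarrow> 'u"
    assume A: "lf_mv A" and \<sigma>: "\<And>v. \<sigma> v \<in> carrier (seq_alg A)"
    have "ev A (\<lambda>i. if i < k then if j < m then mv_zero A else \<sigma> i m else mv_zero A) s =
        ev A (\<lambda>i. if i < k then if j < m then mv_zero A else \<sigma> i m else mv_zero A) t" for j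
    proof (rule lf_mv.ev_eq_on_lvl[OF A])
      let ?\<rho> = "\<lambda>i. if i < k then if j < m then mv_zero A else \<sigma> i m else mv_zero A"
      show "?\<rho> i \<in> lvl A m" for i
        using \<sigma>[of i] lf_zero[OF A] by simp
      have "range ?\<rho> \<subseteq> insert (mv_zero A) ((\<lambda>i. \<sigma> i m) ` {..<k})"
        by auto
      then show "finite (range ?\<rho>)"
        by (rule finite_subset) auto
      fix h :: "'u \<Rightarrow> real"
      assume h: "\<And>i. h (?\<rho> i) \<in> lev m" "h (mv_zero A) = 0"
      show "ev unit_mv (\<lambda>i. h (?\<rho> i)) s = ev unit_mv (\<lambda>i. h (?\<rho> i)) t"
        by (rule assms(2)) (rule h(1), simp add: h(2))
    qed
    then show "eval_term lf_sig (seq_alg A) \<sigma> (?term s) = eval_term lf_sig (seq_alg A) \<sigma> (?term t)"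
      by (simp add: fun_eq_iff ev_seq_alg eval_if if_distrib[of "\<lambda>f. f _"] cong: if_cong)
  qed (use assms in auto)
  then show ?thesis
    by (simp add: eval_if cong: if_cong)
qed

lemma locally_finite_lim: "locally_finite_mv lim_mv"
  unfolding locally_finite_mv_def
proof (intro allI impI)
  fix S assume S: "S \<subseteq> carrier lim_mv" "finite S"
  have "\<forall>a \<in> S. \<exists>y n. stable n y \<and> lim y = a"
    using S(1) by (fastforce simp: threads_def)
  then obtain y n where yn: "\<And>a. a \<in> S \<Longrightarrow> stable (n a) (y a) \<and> lim (y a) = a"
    by metis
  \<comment> \<open>From m on all representatives of the generators are constant; the 0 covers an
    empty S.\<close>
  define m where "m = Max (insert 0 (n ` S))"
  have stab: "lim (stab M m (y a)) = a" "y a \<in> carrier M" if "a \<in> S" for a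
  proof -
    have "n a \<le> m"
      unfolding m_def using S(2) that by (intro Max_ge) auto
    then have "stable m (y a)"
      using stable_mono yn[OF that] by blast
    then show "lim (stab M m (y a)) = a" "y a \<in> carrier M"
      using lim_eq_stab[of m "y a"] yn[OF that] by (auto simp: stable_def)
  qed
  obtain e and k :: nat where e: "S = e ` {i. i < k}"
    using finite_imp_nat_seg_image_inj_on[OF S(2)] by blast
  define \<rho> where "\<rho> i = (if i < k then y (e i) else zop M)" for i
  define \<sigma> where "\<sigma> i = (if i < k then stab M m (\<rho> i) else zop M)" for i
  have \<rho>: "\<rho> i \<in> carrier M" for i
    using stab(2) e by (auto simp: \<rho>_def)
  have \<sigma>: "\<sigma> i \<in> threads" for i
    using stab_threads \<rho> by (auto simp: \<sigma>_def)
  define g where "g t = lim (ev (mv_of M) \<sigma> t)" for t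
  \<comment> \<open>Valuations in the chain supported on the first k variables: a finite set, so
    only finitely many functions from it to the chain arise from terms.\<close>
  define Vs where "Vs = {v. \<forall>i :: nat. (i \<in> {..<k} \<longrightarrow> v i \<in> lev m) \<and> (i \<notin> {..<k} \<longrightarrow> v i = 0)}"
  define G where "G t = (\<lambda>v \<in> Vs. ev unit_mv v t)" for t
  have "finite Vs"
    unfolding Vs_def by (rule finite_set_of_finite_funs) (auto simp: finite_lev)
  moreover have "range G \<subseteq> Vs \<rightarrow>\<^sub>E lev m"
  proof -
    have "v i \<in> lev m" if "v \<in> Vs" for v i
      using that zero_lev by (cases "i < k") (auto simp: Vs_def)
    then have "ev unit_mv v t \<in> lev m" if "v \<in> Vs" for v t
      using that by (intro ev_in_subuniverse[OF lev_subuniverse])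
    then show ?thesis
      by (auto simp: G_def)
  qed
  ultimately have "finite (range G)"
    using finite_PiE[of Vs "\<lambda>_. lev m"] finite_lev finite_subset by blast
  moreover have G: "g s = g t" if "G s = G t" for s t
  proof -
    have evv: "ev unit_mv v s = ev unit_mv v t"
      if "\<And>i. i < k \<Longrightarrow> v i \<in> lev m" "\<And>i. k \<le> i \<Longrightarrow> v i = 0" for v
    proof -
      have "v \<in> Vs"
        using that by (auto simp: Vs_def)
      then show ?thesis
        using fun_cong[OF \<open>G s = G t\<close>, of v] by (simp add: G_def)
    qed
    then show ?thesis
      unfolding g_def \<sigma>_def by (intro arg_cong[where f = lim] ev_stab_eq[OF \<rho> evv])
  qed
  \<comment> \<open>Values in the limit algebra factor through these functions, so there are
    finitely many.\<close>
  have "g t = g (inv_into UNIV G (G t))" for t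
    by (rule G) (simp add: f_inv_into_f)
  then have "range g \<subseteq> (\<lambda>f. g (inv_into UNIV G f)) ` range G"
    by auto
  ultimately have "finite (range g)"
    using finite_surj by blast
  moreover have "mv_subuniverse lim_mv hull S \<subseteq> range g"
  proof (rule hull_minimal)
    show "S \<subseteq> range g"
    proof
      fix a assume a: "a \<in> S"
      then obtain i where i: "i < k" "a = e i"
        using e by auto
      have "a = g (V i)"
        using stab(1)[OF a] i by (simp add: g_def \<sigma>_def \<rho>_def)
      then show "a \<in> range g" by blast
    qed
    have gl: "g t = ev lim_mv (\<lambda>i. lim (\<sigma> i)) t" for t
      unfolding g_def by (rule ev_lim[symmetric]) (rule \<sigma>)
    have "mv_zero lim_mv = g Zr" "\<And>t. mv_neg lim_mv (g t) = g (Ng t)"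
      "\<And>s t. mv_plus lim_mv (g s) (g t) = g (Pl s t)"
      by (simp_all add: gl)
    moreover have "g t \<in> lim ` threads" for t
      unfolding g_def by (intro imageI ev_in_subuniverse[OF threads_subuniverse \<sigma>])
    ultimately show "mv_subuniverse lim_mv (range g)"
      by (auto simp: mv_subuniverse_def)
  qed
  ultimately show "finite (mv_subuniverse lim_mv hull S)"
    by (rule finite_subset[rotated])
qed

lemma lf_mv_lim: "lf_mv lim_mv"
  using mv_algebra_lim locally_finite_lim by (simp add: lf_mv_def lf_mv_axioms_def)

section \<open>Comparison of a model with the sequences over its limit algebra\<close>

definition unit :: "'u \<Rightarrow> nat \<Rightarrow> 'u" where
  "unit = (\<lambda>x \<in> carrier M. \<lambda>n. lim (stab M n x))"

lemma unit_apply: "x \<in> carrier M \<Longrightarrow> unit x n = lim (stab M n x)"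
  by (simp add: unit_def)

lemma lim_eqI:
  assumes "tailop M n x = tailop M n y" "x \<in> threads" "y \<in> threads"
  shows "lim x = lim y"
  using assms lim_eq_iff unfolding eqv_def by blast

lemma tail_idem: "x \<in> carrier M \<Longrightarrow> tailop M n (tailop M n x) = tailop M n x"
  by (simp add: tail_tail)

lemma unit_hom: "unit \<in> alg_hom lf_sig M (seq_alg lim_mv)"
proof (rule alg_hom_lf_sigI)
  show "unit \<in> carrier M \<rightarrow>\<^sub>E carrier (seq_alg lim_mv)"
    using lim_stab_lvl by (auto simp: unit_def)
  show "unit (zop M) = zop (seq_alg lim_mv)"
    by (simp add: fun_eq_iff unit_apply stab_zop lim_zop)
  fix x assume x: "x \<in> carrier M"
  show "unit (nop M x) = nop (seq_alg lim_mv) (unit x)"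
  proof
    fix n
    have "lim (stab M n (nop M x)) = lim (nop M (stab M n x))"
      using x by (intro lim_eqI[of n]) (simp_all add: stab_nop stab_threads)
    then show "unit (nop M x) n = nop (seq_alg lim_mv) (unit x) n"
      using x by (simp add: unit_apply lim_nop stab_threads)
  qed
  show "unit (uop M x) = uop (seq_alg lim_mv) (unit x)"
  proof
    fix n
    show "unit (uop M x) n = uop (seq_alg lim_mv) (unit x) n"
    proof (cases n)
      case 0
      then show ?thesis
        using x by (simp add: unit_apply stab_0_uop lim_zop)
    next
      case (Suc k)
      \<comment> \<open>In \<open>stab_uop\<close> only one side is truncated; idempotence truncates
        both, as equality of limits demands.\<close>
      have "tailop M (Suc k) (stab M (Suc k) (uop M x)) = tailop M (Suc k) (stab M k x)"
        using x by (simp add: tail_idem flip: stab_uop)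
      then have "lim (stab M (Suc k) (uop M x)) = lim (stab M k x)"
        using x by (intro lim_eqI[of "Suc k"]) (simp_all add: stab_threads)
      then show ?thesis
        using x Suc by (simp add: unit_apply)
    qed
  qed
  show "unit (wop M x) = wop (seq_alg lim_mv) (unit x)"
  proof
    fix n
    let ?r = "ev (mv_of M) (\<lambda>_. stab M (Suc n) x) (retract n (Suc n))"
    have r: "?r \<in> threads"
      using x by (intro ev_in_subuniverse[OF threads_subuniverse] stab_threads)
    have "tailop M (Suc n) (stab M n (wop M x)) = tailop M (Suc n) ?r"
      using stab_wop[OF x, of n, symmetric] tail_idem[of "stab M n (wop M x)" "Suc n"] x by simp
    then have "lim (stab M n (wop M x)) = lim ?r"
      using x r by (intro lim_eqI[of "Suc n"]) (simp_all add: stab_threads)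
    then show "unit (wop M x) n = wop (seq_alg lim_mv) (unit x) n"
      using x ev_lim[of "\<lambda>_. stab M (Suc n) x" "retract n (Suc n)"]
      by (simp add: unit_apply rtr_def stab_threads)
  qed
  fix y assume y: "y \<in> carrier M"
  show "unit (pop M x y) = pop (seq_alg lim_mv) (unit x) (unit y)"
    using x y by (simp add: fun_eq_iff unit_apply stab_pop lim_pop stab_threads)
next
  fix xs :: "nat \<Rightarrow> 'u" assume xs: "\<And>i. xs i \<in> carrier M"
  show "unit (dop M xs) = dop (seq_alg lim_mv) (\<lambda>i. unit (xs i))"
    using xs by (simp add: fun_eq_iff unit_apply stab_dop)
qed

text \<open>Equal limits give equality of the stabilised elements only on some tail. Retractions
  extend it to the whole, and the diagonal reassembles x from its stabilised elements.\<close>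

lemma unit_inj: "inj_on unit (carrier M)"
proof (rule inj_onI)
  fix x y assume xy: "x \<in> carrier M" "y \<in> carrier M" "unit x = unit y"
  have "stab M n x = stab M n y" for n
  proof -
    have "lim (stab M n x) = lim (stab M n y)"
      using fun_cong[OF xy(3), of n] unfolding unit_apply[OF xy(1)] unit_apply[OF xy(2)] .
    then obtain k where "tailop M k (stab M n x) = tailop M k (stab M n y)"
      using xy stab_threads by (auto simp: lim_eq_iff eqv_def)
    then have "tailop M (max n k) (stab M n x) = tailop M (max n k) (stab M n y)"
      by (rule tail_eq_mono) (use xy in auto)
    then show ?thesis
      using stab_pow_wop_tail_stab[OF xy(1), of n "max n k"] stab_pow_wop_tail_stab[OF xy(2), of n "max n k"]
      by (metis max.cobounded1)
  qed
  then have "dop M (\<lambda>n. stab M n x) = dop M (\<lambda>n. stab M n y)"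
    by simp
  then show "x = y"
    using dop_stab[OF xy(1)] dop_stab[OF xy(2)] by metis
qed

text \<open>If the defect is zero in M, so are all its multiples, and the retraction subtracts
  nothing.\<close>

lemma ev_retract_if_defect:
  assumes "x \<in> carrier M" "ev (mv_of M) (\<lambda>_. x) (defect n) = zop M"
  shows "ev (mv_of M) (\<lambda>_. x) (retract n m) = x"
proof -
  interpret mv_algebra "mv_of M"
    by (rule mv_algebra_mv_of)
  have "ev (mv_of M) (\<lambda>_. x) (Ml k (defect n)) = zop M" for k
    by (induction k) (simp_all add: assms(2) zop_pop)
  then show ?thesis
    using assms(1) plus_zero[of "nop M x"] by (simp add: retract_def Sb_def nop_nop)
qed

text \<open>An eventually constant y whose limit lies in level n is pulled back from a late entry m
  to place n. Its defect vanishes on the tail, so the retraction does not change the limit.\<close>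

lemma lim_lvl_surj:
  assumes "a \<in> lvl lim_mv n"
  obtains x where "x \<in> carrier M" "lim (stab M n x) = a"
proof -
  obtain y where y: "y \<in> threads" "a = lim y"
    using assms by (auto simp: lvl_def)
  obtain j where j: "stable j y"
    using y by (auto simp: threads_def)
  obtain k where k: "tailop M k (ev (mv_of M) (\<lambda>_. y) (defect n)) = tailop M k (zop M)"
    using assms y lim_lvl_iff by (auto simp: eqv_def)
  \<comment> \<open>From m on y is constant and its defect is zero; m must also be at least n for
    the retraction to reach level n.\<close>
  define m where "m = Max {n, j, k}"
  have m: "n \<le> m" "j \<le> m" "k \<le> m"
    by (auto simp: m_def)
  have yc: "y \<in> carrier M"
    using y threads_carrier by auto
  have st: "stable m y"
    using stable_mono[OF j m(2)] .
  have evc: "ev (mv_of M) (\<lambda>_. y) (defect n) \<in> carrier M"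
    by (intro threads_carrier ev_in_subuniverse[OF threads_subuniverse y(1)])
  have "ev (mv_of M) (\<lambda>_. stab M m y) (defect n) = tailop M m (ev (mv_of M) (\<lambda>_. y) (defect n))"
    using defect_tail[OF yc, of m n] tail_stable[OF st] by simp
  also have "\<dots> = zop M"
    using tail_eq_mono[OF k m(3) evc] by (simp add: tail_zop)
  finally have "ev (mv_of M) (\<lambda>_. stab M m y) (retract n m) = stab M m y"
    using yc by (intro ev_retract_if_defect) auto
  then have *: "tailop M m (stab M n ((wop M ^^ (m - n)) y)) = tailop M m y"
    using tail_stab_pow_wop[OF yc m(1)] tail_stable[OF st] by simp
  have "lim (stab M n ((wop M ^^ (m - n)) y)) = lim y"
    using yc y by (intro lim_eqI[OF *]) (auto intro: stab_threads)
  then show ?thesis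
    using that[of "(wop M ^^ (m - n)) y"] yc y by simp
qed

lemma unit_surj: "unit ` carrier M = carrier (seq_alg lim_mv)"
proof
  show "unit ` carrier M \<subseteq> carrier (seq_alg lim_mv)"
    using lim_stab_lvl by (auto simp: unit_apply)
  show "carrier (seq_alg lim_mv) \<subseteq> unit ` carrier M"
  proof
    fix z assume z: "z \<in> carrier (seq_alg lim_mv)"
    have "\<exists>x. x \<in> carrier M \<and> lim (stab M n x) = z n" for n
      using z lim_lvl_surj[of "z n" n] by (metis seq_alg_simps(1))
    then obtain xs where xs: "\<And>n. xs n \<in> carrier M" "\<And>n. lim (stab M n (xs n)) = z n"
      by metis
    \<comment> \<open>Each entry of z is realised separately; the diagonal assembles the chosen
      elements into one.\<close>
    have "unit (dop M xs) = z"
      using xs by (simp add: fun_eq_iff unit_apply stab_dop)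
    then show "z \<in> unit ` carrier M"
      using xs(1) by (metis closed(4) imageI)
  qed
qed

lemma lim_mv_subset: "carrier lim_mv \<subseteq> carrier M"
  using lim(1) threads_carrier by auto

end

section \<open>The equivalence\<close>

lemma LFMV_Obj: "A \<in> Obj (LFMV \<S>) \<longleftrightarrow> carrier A \<in> \<S> \<and> lf_mv A"
  by (simp add: LFMV_def lf_mv_def lf_mv_axioms_def)

lemma lf_eqs_sig: "\<forall>(s, t) \<in> lf_eqs TYPE('u). sig_term lf_sig s \<and> sig_term lf_sig t"
  by (auto simp: lf_eqs_def)

lemma seq_alg_satisfies:
  fixes A :: "'u mv"
  assumes "lf_mv A"
  shows "satisfies lf_sig (seq_alg A) (lf_eqs TYPE('u))"
  using assms by (auto simp: lf_eqs_def satisfies_def)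

text \<open>This is where the closure of \<open>\<S>\<close> under countable powers enters for
  algebras.\<close>

lemma seq_alg_coding:
  fixes A :: "'u mv"
  assumes "smallness \<S>" "carrier A \<in> \<S>" "lf_mv A"
  shows "\<exists>\<kappa>. inj_on \<kappa> (carrier (seq_alg A)) \<and> \<kappa> ` carrier (seq_alg A) \<in> \<S>"
proof -
  obtain Y where Y: "Y \<in> \<S>" "((UNIV :: nat set) \<rightarrow>\<^sub>E carrier A) \<lesssim> Y"
    using assms(1,2) unfolding smallness_def by blast
  have "carrier (seq_alg A) \<subseteq> UNIV \<rightarrow>\<^sub>E carrier A"
    unfolding PiE_UNIV_domain using lf_mv.lvl_closed[OF assms(3)] by fastforce
  then have "carrier (seq_alg A) \<lesssim> Y"
    using Y(2) by (meson lepoll_trans subset_imp_lepoll)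
  then obtain \<kappa> where \<kappa>: "inj_on \<kappa> (carrier (seq_alg A))" "\<kappa> ` carrier (seq_alg A) \<subseteq> Y"
    unfolding lepoll_def by blast
  have "\<kappa> ` carrier (seq_alg A) \<in> \<S>"
    using smallness_subset[OF assms(1) Y(1) subset_imp_lepoll[OF \<kappa>(2)]] .
  then show ?thesis
    using \<kappa>(1) by blast
qed

definition transport_hom :: "'a set \<Rightarrow> ('a \<Rightarrow> 'c) \<Rightarrow> ('b \<Rightarrow> 'd) \<Rightarrow> ('a \<Rightarrow> 'b) \<Rightarrow> 'c \<Rightarrow> 'd" where
  "transport_hom X \<kappa> \<mu> g = (\<lambda>x \<in> \<kappa> ` X. \<mu> (g (inv_into X \<kappa> x)))"

lemma interp_copy_alg_PiE:
  assumes "inj_on \<kappa> (carrier B)" "xs \<in> arity \<Sigma> f \<rightarrow>\<^sub>E carrier B"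
  shows "interp (copy_alg \<Sigma> \<kappa> B) f (\<lambda>i \<in> arity \<Sigma> f. \<kappa> (xs i)) = \<kappa> (interp B f xs)"
proof -
  have "restrict xs (arity \<Sigma> f) = xs"
    using assms(2) by (auto simp: PiE_iff extensional_restrict)
  then show ?thesis
    using interp_copy_alg[OF assms(1), of \<Sigma> f xs] assms(2) by (simp add: PiE_iff)
qed

text \<open>Conjugation with the two codings is undone by conjugating back, which is the map
  \<open>?R\<close>.\<close>

lemma transport_hom_bij:
  assumes B: "sig_algebra \<Sigma> B" "inj_on \<kappa> (carrier B)"
    and sC: "sig_algebra \<Sigma> C" and C: "inj_on \<mu> (carrier C)"
  shows "bij_betw (transport_hom (carrier B) \<kappa> \<mu>) (alg_hom \<Sigma> B C)
    (alg_hom \<Sigma> (copy_alg \<Sigma> \<kappa> B) (copy_alg \<Sigma> \<mu> C))"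
proof (rule bij_betw_byWitness)
  let ?T = "transport_hom (carrier B) \<kappa> \<mu>"
  let ?R = "\<lambda>h. \<lambda>x \<in> carrier B. inv_into (carrier C) \<mu> (h (\<kappa> x))"
  have T: "?T g (\<kappa> x) = \<mu> (g x)" if "x \<in> carrier B" for g x
    using that B(2) by (simp add: transport_hom_def)
  show "\<forall>g \<in> alg_hom \<Sigma> B C. ?R (?T g) = g"
  proof
    fix g assume g: "g \<in> alg_hom \<Sigma> B C"
    then have gc: "g x \<in> carrier C" if "x \<in> carrier B" for x
      using that by (auto simp: alg_hom_def)
    have "g \<in> extensional (carrier B)"
      using g by (auto simp: alg_hom_def PiE_def)
    then show "?R (?T g) = g"
      using T gc C by (intro extensionalityI[of _ "carrier B"]) auto
  qed
  have hc: "h (\<kappa> x) \<in> \<mu> ` carrier C"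
    if "h \<in> alg_hom \<Sigma> (copy_alg \<Sigma> \<kappa> B) (copy_alg \<Sigma> \<mu> C)" "x \<in> carrier B" for h x
    using that by (auto simp: alg_hom_def)
  show "\<forall>h \<in> alg_hom \<Sigma> (copy_alg \<Sigma> \<kappa> B) (copy_alg \<Sigma> \<mu> C). ?T (?R h) = h"
  proof
    fix h assume h: "h \<in> alg_hom \<Sigma> (copy_alg \<Sigma> \<kappa> B) (copy_alg \<Sigma> \<mu> C)"
    then have "h \<in> extensional (\<kappa> ` carrier B)"
      by (auto simp: alg_hom_def PiE_def)
    then show "?T (?R h) = h"
      using T hc[OF h] by (intro extensionalityI[of _ "\<kappa> ` carrier B"])
        (auto simp: transport_hom_def f_inv_into_f B(2))
  qed
  show "?T ` alg_hom \<Sigma> B C \<subseteq> alg_hom \<Sigma> (copy_alg \<Sigma> \<kappa> B) (copy_alg \<Sigma> \<mu> C)"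
  proof safe
    fix g assume g: "g \<in> alg_hom \<Sigma> B C"
    then have gc: "g x \<in> carrier C" if "x \<in> carrier B" for x
      using that by (auto simp: alg_hom_def)
    show "?T g \<in> alg_hom \<Sigma> (copy_alg \<Sigma> \<kappa> B) (copy_alg \<Sigma> \<mu> C)"
      unfolding alg_hom_def
    proof (intro CollectI conjI ballI)
      show "?T g \<in> carrier (copy_alg \<Sigma> \<kappa> B) \<rightarrow>\<^sub>E carrier (copy_alg \<Sigma> \<mu> C)"
        using gc by (auto simp: transport_hom_def inv_into_into)
      fix f xs assume f: "f \<in> ops \<Sigma>" and "xs \<in> arity \<Sigma> f \<rightarrow>\<^sub>E carrier (copy_alg \<Sigma> \<kappa> B)"
      then obtain ys where ys: "ys \<in> arity \<Sigma> f \<rightarrow>\<^sub>E carrier B" "xs = (\<lambda>i \<in> arity \<Sigma> f. \<kappa> (ys i))"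
        using copy_alg_args[of xs "arity \<Sigma> f" \<kappa> "carrier B"] by auto
      have "?T g (interp (copy_alg \<Sigma> \<kappa> B) f xs) = ?T g (\<kappa> (interp B f ys))"
        unfolding ys(2) interp_copy_alg_PiE[OF B(2) ys(1)] ..
      also have "\<dots> = \<mu> (interp C f (\<lambda>i \<in> arity \<Sigma> f. g (ys i)))"
        using T[OF interp_closed[OF B(1) f ys(1)]] g f ys(1) by (simp add: alg_hom_def)
      also have "\<dots> = interp (copy_alg \<Sigma> \<mu> C) f (\<lambda>i \<in> arity \<Sigma> f. \<mu> (g (ys i)))"
        using gc ys(1) by (intro interp_copy_alg[OF C, symmetric]) auto
      also have "(\<lambda>i \<in> arity \<Sigma> f. \<mu> (g (ys i))) = (\<lambda>i \<in> arity \<Sigma> f. ?T g (xs i))"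
        using T[OF PiE_mem[OF ys(1)]] ys(2) by (auto intro!: restrict_ext)
      finally show "?T g (interp (copy_alg \<Sigma> \<kappa> B) f xs) =
          interp (copy_alg \<Sigma> \<mu> C) f (\<lambda>i \<in> arity \<Sigma> f. ?T g (xs i))" .
    qed
  qed
  show "?R ` alg_hom \<Sigma> (copy_alg \<Sigma> \<kappa> B) (copy_alg \<Sigma> \<mu> C) \<subseteq> alg_hom \<Sigma> B C"
  proof safe
    fix h assume h: "h \<in> alg_hom \<Sigma> (copy_alg \<Sigma> \<kappa> B) (copy_alg \<Sigma> \<mu> C)"
    have R: "?R h x \<in> carrier C" "\<mu> (?R h x) = h (\<kappa> x)" if "x \<in> carrier B" for x
      using hc[OF h that] that by (auto simp: inv_into_into f_inv_into_f)
    show "?R h \<in> alg_hom \<Sigma> B C"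
      unfolding alg_hom_def
    proof (intro CollectI conjI ballI)
      show "?R h \<in> carrier B \<rightarrow>\<^sub>E carrier C"
        using R(1) by auto
      fix f ys assume f: "f \<in> ops \<Sigma>" and ys: "ys \<in> arity \<Sigma> f \<rightarrow>\<^sub>E carrier B"
      have "(\<lambda>i \<in> arity \<Sigma> f. \<kappa> (ys i)) \<in> arity \<Sigma> f \<rightarrow>\<^sub>E carrier (copy_alg \<Sigma> \<kappa> B)"
        using ys by auto
      then have "h (interp (copy_alg \<Sigma> \<kappa> B) f (\<lambda>i \<in> arity \<Sigma> f. \<kappa> (ys i))) =
          interp (copy_alg \<Sigma> \<mu> C) f (\<lambda>i \<in> arity \<Sigma> f. h ((\<lambda>i \<in> arity \<Sigma> f. \<kappa> (ys i)) i))"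
        using h f unfolding alg_hom_def by blast
      moreover have "interp (copy_alg \<Sigma> \<kappa> B) f (\<lambda>i \<in> arity \<Sigma> f. \<kappa> (ys i)) = \<kappa> (interp B f ys)"
        by (rule interp_copy_alg_PiE[OF B(2) ys])
      moreover have "(\<lambda>i \<in> arity \<Sigma> f. h ((\<lambda>i \<in> arity \<Sigma> f. \<kappa> (ys i)) i)) = (\<lambda>i \<in> arity \<Sigma> f. \<mu> (?R h (ys i)))"
        using ys R(2) by (auto intro!: restrict_ext)
      moreover have "interp (copy_alg \<Sigma> \<mu> C) f (\<lambda>i \<in> arity \<Sigma> f. \<mu> (?R h (ys i))) =
          \<mu> (interp C f (\<lambda>i \<in> arity \<Sigma> f. ?R h (ys i)))"
        by (rule interp_copy_alg[OF C R(1)[OF PiE_mem[OF ys]]])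
      ultimately have "h (\<kappa> (interp B f ys)) = \<mu> (interp C f (\<lambda>i \<in> arity \<Sigma> f. ?R h (ys i)))"
        by simp
      then show "?R h (interp B f ys) = interp C f (\<lambda>i \<in> arity \<Sigma> f. ?R h (ys i))"
        using interp_closed[OF B(1) f ys] interp_closed[OF sC f, of "\<lambda>i \<in> arity \<Sigma> f. ?R h (ys i)"]
          R(1) ys C by (auto simp: PiE_iff)
    qed
  qed
qed

definition seq_code :: "'u set set \<Rightarrow> 'u mv \<Rightarrow> (nat \<Rightarrow> 'u) \<Rightarrow> 'u" where
  "seq_code \<S> A = (SOME \<kappa>. inj_on \<kappa> (carrier (seq_alg A)) \<and> \<kappa> ` carrier (seq_alg A) \<in> \<S>)"

lemma seq_code:
  assumes "smallness \<S>" "A \<in> Obj (LFMV \<S>)"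
  shows "inj_on (seq_code \<S> A) (carrier (seq_alg A))" "seq_code \<S> A ` carrier (seq_alg A) \<in> \<S>"
  using someI_ex[OF seq_alg_coding[OF assms(1)]] assms(2) unfolding seq_code_def LFMV_Obj by auto

definition seq_func :: "'u set set \<Rightarrow> ('u mv, 'u \<Rightarrow> 'u, (nat, nat, 'u) alg, 'u \<Rightarrow> 'u) func" where
  "seq_func \<S> = \<lparr>omap = (\<lambda>A. copy_alg lf_sig (seq_code \<S> A) (seq_alg A)),
     amap = (\<lambda>A B h. transport_hom (carrier (seq_alg A)) (seq_code \<S> A) (seq_code \<S> B) (lift_hom A h))\<rparr>"

lemma seq_func_omap:
  fixes A :: "'u mv"
  assumes "smallness \<S>" "A \<in> Obj (LFMV \<S>)"
  shows "omap (seq_func \<S>) A \<in> models \<S> lf_sig (lf_eqs TYPE('u))"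
proof -
  have A: "lf_mv A"
    using assms(2) by (simp add: LFMV_Obj)
  note \<kappa> = seq_code[OF assms]
  show ?thesis
    using \<kappa>(2) sig_algebra_copy[OF lf_mv.sig_algebra_seq[OF A] \<kappa>(1)]
      satisfies_copy[OF lf_mv.sig_algebra_seq[OF A] \<kappa>(1) seq_alg_satisfies[OF A] lf_eqs_sig]
    by (simp add: models_def seq_func_def)
qed

lemma seq_func_amap_bij:
  assumes "smallness \<S>" "A \<in> Obj (LFMV \<S>)" "B \<in> Obj (LFMV \<S>)"
  shows "bij_betw (amap (seq_func \<S>) A B) (mv_hom A B)
    (alg_hom lf_sig (omap (seq_func \<S>) A) (omap (seq_func \<S>) B))"
proof -
  have AB: "lf_mv A" "lf_mv B"
    using assms(2,3) by (simp_all add: LFMV_Obj)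
  have "bij_betw (transport_hom (carrier (seq_alg A)) (seq_code \<S> A) (seq_code \<S> B) \<circ> lift_hom A) (mv_hom A B)
      (alg_hom lf_sig (omap (seq_func \<S>) A) (omap (seq_func \<S>) B))"
    unfolding seq_func_def func.simps
    by (rule bij_betw_trans[OF lift_hom_bij[OF AB] transport_hom_bij])
      (use lf_mv.sig_algebra_seq AB seq_code assms in blast)+
  then show ?thesis
    by (simp add: seq_func_def comp_def)
qed

lemma cat_functor_seq_func:
  fixes \<S> :: "'u set set"
  assumes S: "smallness \<S>"
  shows "cat_functor (LFMV \<S>) (VAR \<S> lf_sig (lf_eqs TYPE('u))) (seq_func \<S>)"
proof (intro cat_functor.intro category_LFMV category_VAR cat_functor_axioms.intro)
  let ?\<kappa> = "seq_code \<S>"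
  fix A :: "'u mv" assume A: "A \<in> Obj (LFMV \<S>)"
  then have lfA: "lf_mv A"
    by (simp add: LFMV_Obj)
  note inj = seq_code(1)[OF S]
  have inv: "inv_into (carrier (seq_alg A)) (?\<kappa> A) (?\<kappa> A x) = x" if "x \<in> carrier (seq_alg A)" for x
    using inj[OF A] that by (rule inv_into_f_f)
  show "omap (seq_func \<S>) A \<in> Obj (VAR \<S> lf_sig (lf_eqs TYPE('u)))"
    using seq_func_omap[OF S A] by (simp add: VAR_def)
  have "lift_hom A (\<lambda>a \<in> carrier A. a) x = x" if "x \<in> carrier (seq_alg A)" for x
  proof -
    have "x n \<in> carrier A" for n
      using that lf_mv.lvl_closed[OF lfA, of "x n" n] by simp
    then show ?thesis
      using that by (simp add: lift_hom_def)
  qed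
  then show "amap (seq_func \<S>) A A (Id (LFMV \<S>) A) =
      Id (VAR \<S> lf_sig (lf_eqs TYPE('u))) (omap (seq_func \<S>) A)"
    using inv by (auto simp: seq_func_def LFMV_def VAR_def transport_hom_def simp del: seq_alg_simps
        intro!: restrict_ext)
  fix B :: "'u mv" assume B: "B \<in> Obj (LFMV \<S>)"
  show "amap (seq_func \<S>) A B f \<in> Hom (VAR \<S> lf_sig (lf_eqs TYPE('u))) (omap (seq_func \<S>) A) (omap (seq_func \<S>) B)"
    if "f \<in> Hom (LFMV \<S>) A B" for f
    using bij_betwE[OF seq_func_amap_bij[OF S A B]] that by (simp add: LFMV_def VAR_def)
  fix C :: "'u mv" and f g
  assume C: "C \<in> Obj (LFMV \<S>)" and fg: "f \<in> Hom (LFMV \<S>) A B" "g \<in> Hom (LFMV \<S>) B C"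
  have fh: "lift_hom A f x \<in> carrier (seq_alg B)" if "x \<in> carrier (seq_alg A)" for x
    using mv_hom_lvl[OF lfA, of f B] fg(1) that by (auto simp: lift_hom_def LFMV_def)
  have invB: "inv_into (carrier (seq_alg B)) (?\<kappa> B) (?\<kappa> B x) = x" if "x \<in> carrier (seq_alg B)" for x
    using inj[OF B] that by (rule inv_into_f_f)
  have "lift_hom A (compose (carrier A) g f) x = lift_hom B g (lift_hom A f x)"
    if "x \<in> carrier (seq_alg A)" for x
  proof -
    have "x n \<in> carrier A" for n
      using that lf_mv.lvl_closed[OF lfA, of "x n" n] by simp
    then show ?thesis
      using that fh[OF that] by (auto simp: lift_hom_def compose_def)
  qed
  then show "amap (seq_func \<S>) A C (Comp (LFMV \<S>) A B C g f) =
      Comp (VAR \<S> lf_sig (lf_eqs TYPE('u))) (omap (seq_func \<S>) A) (omap (seq_func \<S>) B)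
        (omap (seq_func \<S>) C) (amap (seq_func \<S>) B C g) (amap (seq_func \<S>) A B f)"
    using inv invB fh by (auto simp: seq_func_def LFMV_def VAR_def transport_hom_def compose_def
        simp del: seq_alg_simps intro!: restrict_ext)
qed

text \<open>The preimage of M is its limit algebra: \<open>unit\<close> followed by the coding of
  sequences is a bijective homomorphism from M to the image of that algebra.\<close>

lemma seq_func_essentially_surjective:
  fixes \<S> :: "'u set set"
  assumes S: "smallness \<S>" and M: "M \<in> Obj (VAR \<S> lf_sig (lf_eqs TYPE('u)))"
  shows "\<exists>A \<in> Obj (LFMV \<S>). \<exists>f. isomorphism (VAR \<S> lf_sig (lf_eqs TYPE('u))) (omap (seq_func \<S>) A) M f"
proof -
  have M': "M \<in> models \<S> lf_sig (lf_eqs TYPE('u))"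
    using M by (simp add: VAR_def)
  then interpret lf_model M
    by unfold_locales (simp_all add: models_def)
  \<comment> \<open>Limits are elements of M, so the carrier of the limit algebra is small along
    with that of M.\<close>
  have A: "lim_mv \<in> Obj (LFMV \<S>)"
    using lf_mv_lim smallness_subset[OF S _ subset_imp_lepoll[OF lim_mv_subset]] M'
    unfolding LFMV_Obj models_def by blast
  let ?\<kappa> = "seq_code \<S> lim_mv" and ?B = "omap (seq_func \<S>) lim_mv"
  have B: "?B = copy_alg lf_sig ?\<kappa> (seq_alg lim_mv)"
    by (simp add: seq_func_def)
  note \<kappa> = seq_code(1)[OF S A]
  define r where "r = (\<lambda>x \<in> carrier (seq_alg lim_mv). ?\<kappa> x)"
  have r: "r \<in> alg_hom lf_sig (seq_alg lim_mv) ?B"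
    unfolding r_def B by (rule copy_hom[OF lf_mv.sig_algebra_seq[OF lf_mv_lim] \<kappa>])
  have unit_in: "unit x \<in> carrier (seq_alg lim_mv)" if "x \<in> carrier M" for x
    using unit_surj that by blast
  have hom: "compose (carrier M) r unit \<in> alg_hom lf_sig M ?B"
    using M' by (intro alg_hom_compose[OF _ unit_hom r]) (simp add: models_def)
  have "bij_betw r (carrier (seq_alg lim_mv)) (carrier ?B)"
    using \<kappa> unfolding B by (simp add: bij_betw_def r_def inj_on_def del: seq_alg_simps)
  moreover have "bij_betw unit (carrier M) (carrier (seq_alg lim_mv))"
    using unit_inj unit_surj by (simp add: bij_betw_def)
  ultimately have "bij_betw (r \<circ> unit) (carrier M) (carrier ?B)"
    by (rule bij_betw_trans[rotated])
  then have "bij_betw (compose (carrier M) r unit) (carrier M) (carrier ?B)"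
    by (rule bij_betw_cong[THEN iffD1, rotated]) (simp add: compose_def)
  then have "isomorphism (VAR \<S> lf_sig (lf_eqs TYPE('u))) M ?B (compose (carrier M) r unit)"
    by (intro bijective_alg_hom_isomorphism M' seq_func_omap S A hom)
  then show ?thesis
    by (intro bexI[OF _ A] isomorphism_sym)
qed

theorem theorem5p4:
  "\<exists>(\<Sigma> :: (nat, nat) signature) (E :: (nat, nat, nat) equations).
     (\<forall>f \<in> ops \<Sigma>. countable (arity \<Sigma> f)) \<and>
     (\<forall>\<S> :: 'u set set. smallness \<S> \<longrightarrow>
        variety \<S> \<Sigma> E \<and> equivalent_categories (LFMV \<S>) (VAR \<S> \<Sigma> E))"
proof (intro exI conjI ballI allI impI)
  fix f
  \<comment> \<open>Arities are sets of natural numbers.\<close>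
  show "countable (arity lf_sig f)"
    by (rule countableI_type)
next
  fix \<S> :: "'u set set" assume S: "smallness \<S>"
  show "variety \<S> lf_sig (lf_eqs TYPE('u))"
    unfolding variety_def using lf_eqs_sig free_algebra_exists[OF lf_eqs_sig S] by blast
  show "equivalent_categories (LFMV \<S>) (VAR \<S> lf_sig (lf_eqs TYPE('u)))"
  proof (rule equivalent_categoriesI[OF cat_functor_seq_func[OF S]])
    fix A B :: "'u mv" assume "A \<in> Obj (LFMV \<S>)" "B \<in> Obj (LFMV \<S>)"
    then show "bij_betw (amap (seq_func \<S>) A B) (Hom (LFMV \<S>) A B)
        (Hom (VAR \<S> lf_sig (lf_eqs TYPE('u))) (omap (seq_func \<S>) A) (omap (seq_func \<S>) B))"
      using seq_func_amap_bij[OF S] by (simp add: LFMV_def VAR_def)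
  qed (rule seq_func_essentially_surjective[OF S])
qed

end
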